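(* Let $\varphi\in\mathcal S(\mathbb R^d)$ with $\|\varphi\|_{L^2}=1$. Let $a\in S^m_\rho$ for some $m\in\mathbb R$, $\rho\in[0,1/2)$, with $a\ge0$. For every $N\in\mathbb N$ there exists $C_N>0$ such that, for every $h\in(0,1]$, $$C_N^{-1}\boldsymbol\lambda'(a,h)-C_Nh^N\le\inf\sigma(A_{a,h})\le C_N\big(\boldsymbol\lambda'(a,h)+h^N\big),$$ where $$\boldsymbol\lambda'(a,h):=\inf_{(x_0,\omega_0)\in\mathbb R^{2d}}\ \sup_{(x,\omega)\in B((x_0,\omega_0),h^{1/2})}a(x,\omega,h)$$ and $\sigma(A_{a,h})$ is the spectrum of the anti-Wick operator $A_{a,h}$ with symbol $a(\cdot,h)$ and window $\varphi$.
   Context: $B((x_0,\omega_0),r)$ is the Euclidean ball in $\mathbb R^{2d}$. $S^m_\rho$ is the space of families of smooth functions $a(\cdot,h)$ on $\mathbb R^{2d}$, $h\in(0,1]$, such that for some $N_0\in\mathbb N$ and all $\alpha,\beta\in\mathbb N^d$ with $|\alpha|+|\beta|\ge N_0$, $$\sup_{(x,\omega,h)\in\mathbb R^{2d}\times(0,1]}|\partial_x^\alpha\partial_\omega^\beta a(x,\omega,h)|\,h^{m+\rho(|\alpha|+|\beta|)}<\infty.$$ For $h>0$, the generalized coherent states are $\varphi^h_{(x_0,\omega_0)}(x)=h^{-d/4}e^{\frac ih\omega_0\cdot x}\varphi(h^{-1/2}(x-x_0))$, $x,x_0,\omega_0\in\mathbb R^d$. For $a\ge0$ in $S^m_\rho$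 and $h\in(0,1]$, the quadratic form $$Q_{a,h}(f)=(2\pi h)^{-d}\int_{\mathbb R^{2d}}a(x,\omega,h)|\langle f,\varphi^h_{(x,\omega)}\rangle|^2\,dx\,d\omega$$ with domain $\mathcal D_{a,h}=\{f\in L^2(\mathbb R^d):Q_{a,h}(f)<\infty\}$ is densely defined, nonnegative and closed. $A_{a,h}$ denotes the unique self-adjoint operator on $L^2(\mathbb R^d)$ associated with it: $\mathrm{dom}\,A_{a,h}\subset\mathcal D_{a,h}$ and $\langle A_{a,h}f,g\rangle=Q_{a,h}(f,g)$ for $f\in\mathrm{dom}\,A_{a,h}$, $g\in\mathcal D_{a,h}$. *)

theory Defs
  imports "HOL-Analysis.Analysis"
begin

section \<open>Partial derivatives, Schwartz functions and symbols\<close>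

definition dir_deriv ::
    "'a::euclidean_space \<Rightarrow> ('a \<Rightarrow> 'b::real_normed_vector) \<Rightarrow> 'a \<Rightarrow> 'b" where
  "dir_deriv b f x = vector_derivative (\<lambda>t. f (x + t *\<^sub>R b)) (at 0)"

text \<open>A partial derivative of order \<open>k\<close> is indexed by a list of \<open>k\<close> coordinate directions.
  For smooth functions the order of the list is irrelevant, so the lists of elements of \<open>Basis\<close>
  of length \<open>k\<close> give exactly the multi-indices of order \<open>k\<close>. On \<open>'a \<times> 'a\<close> the coordinate
  directions are those of both factors, and the length of the list is
  \<open>\<bar>\<alpha>\<bar> + \<bar>\<beta>\<bar>\<close> for the derivative of order \<open>\<alpha>\<close> in the first and
  \<open>\<beta>\<close> in the second variable.\<close>

definition partials ::
    "'a::euclidean_space list \<Rightarrow> ('a \<Rightarrow> 'b::real_normed_vector) \<Rightarrow> 'a \<Rightarrow> 'b" where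
  "partials bs f = foldr dir_deriv bs f"

definition smooth :: "('a::euclidean_space \<Rightarrow> 'b::real_normed_vector) \<Rightarrow> bool" where
  "smooth f \<longleftrightarrow> (\<forall>bs. set bs \<subseteq> Basis \<longrightarrow> (\<forall>x. partials bs f differentiable (at x)))"

definition schwartz :: "('a::euclidean_space \<Rightarrow> complex) set" where
  "schwartz = {f. smooth f \<and>
     (\<forall>k::nat. \<forall>bs. set bs \<subseteq> Basis \<longrightarrow>
        bdd_above (range (\<lambda>x. norm x ^ k * norm (partials bs f x))))}"

definition symbol_class ::
    "real \<Rightarrow> real \<Rightarrow> ('a::euclidean_space \<times> 'a \<Rightarrow> real \<Rightarrow> 'b::real_normed_vector) set" where
  "symbol_class m \<rho> = {a. (\<forall>h\<in>{0<..1}. smooth (\<lambda>z. a z h)) \<and>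
     (\<exists>N\<^sub>0::nat. \<forall>bs. set bs \<subseteq> Basis \<and> length bs \<ge> N\<^sub>0 \<longrightarrow>
        bdd_above ((\<lambda>(z, h). norm (partials bs (\<lambda>w. a w h) z) * h powr (m + \<rho> * real (length bs)))
                     ` (UNIV \<times> {0<..1})))}"

section \<open>Square-integrable functions and unbounded operators\<close>

text \<open>Elements of the Hilbert space are represented by Borel functions, up to equality almost
  everywhere. The inner product is linear in the first argument.\<close>

definition L2 :: "('a::euclidean_space \<Rightarrow> complex) set" where
  "L2 = {f. f \<in> borel_measurable lborel \<and> integrable lborel (\<lambda>x. (norm (f x))\<^sup>2)}"

definition l2_inner ::
    "('a::euclidean_space \<Rightarrow> complex) \<Rightarrow> ('a \<Rightarrow> complex) \<Rightarrow> complex" where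
  "l2_inner f g = (LINT x|lborel. f x * cnj (g x))"

definition l2_norm :: "('a::euclidean_space \<Rightarrow> complex) \<Rightarrow> real" where
  "l2_norm f = sqrt (LINT x|lborel. (norm (f x))\<^sup>2)"

text \<open>An operator is given by its graph. The graph is closed under changing either component on a
  null set (it is a union of products of equivalence classes), and is single-valued modulo null
  sets.\<close>

type_synonym 'a l2_op = "(('a \<Rightarrow> complex) \<times> ('a \<Rightarrow> complex)) set"

definition linear_operator :: "'a::euclidean_space l2_op \<Rightarrow> bool" where
  "linear_operator A \<longleftrightarrow>
     A \<subseteq> L2 \<times> L2 \<and>
     (\<forall>f u f' u'. (f, u) \<in> A \<and> f' \<in> L2 \<and> u' \<in> L2 \<and>
        (AE x in lborel. f' x = f x) \<and> (AE x in lborel. u' x = u x) \<longrightarrow> (f', u') \<in> A) \<and>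
     (\<forall>f u v. (f, u) \<in> A \<and> (f, v) \<in> A \<longrightarrow> (AE x in lborel. u x = v x)) \<and>
     (\<lambda>x. 0, \<lambda>x. 0) \<in> A \<and>
     (\<forall>f u g v. (f, u) \<in> A \<and> (g, v) \<in> A \<longrightarrow> (\<lambda>x. f x + g x, \<lambda>x. u x + v x) \<in> A) \<and>
     (\<forall>c f u. (f, u) \<in> A \<longrightarrow> (\<lambda>x. c * f x, \<lambda>x. c * u x) \<in> A)"

definition densely_defined :: "'a::euclidean_space l2_op \<Rightarrow> bool" where
  "densely_defined A \<longleftrightarrow>
     (\<forall>g\<in>L2. \<forall>\<epsilon>>0. \<exists>f\<in>Domain A. l2_norm (\<lambda>x. f x - g x) < \<epsilon>)"

definition adjoint_op :: "'a::euclidean_space l2_op \<Rightarrow> 'a l2_op" where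
  "adjoint_op A = {(g, w). g \<in> L2 \<and> w \<in> L2 \<and> (\<forall>(f, u)\<in>A. l2_inner u g = l2_inner f w)}"

definition self_adjoint :: "'a::euclidean_space l2_op \<Rightarrow> bool" where
  "self_adjoint A \<longleftrightarrow> linear_operator A \<and> densely_defined A \<and> adjoint_op A = A"

text \<open>\<open>z\<close> is in the resolvent set iff \<open>A - z\<close> maps the domain of \<open>A\<close> bijectively onto the
  whole space and has a bounded inverse; the estimate contains the injectivity.\<close>

definition resolvent_set :: "'a::euclidean_space l2_op \<Rightarrow> complex set" where
  "resolvent_set A = {z.
     (\<forall>g\<in>L2. \<exists>(f, u)\<in>A. AE x in lborel. u x - z * f x = g x) \<and>
     (\<exists>C::real. \<forall>(f, u)\<in>A. l2_norm f \<le> C * l2_norm (\<lambda>x. u x - z * f x))}"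

definition spectrum :: "'a::euclidean_space l2_op \<Rightarrow> complex set" where
  "spectrum A = - resolvent_set A"

text \<open>Intended for self-adjoint operators that are bounded below: their spectrum is a nonempty set
  of real numbers, bounded below.\<close>

definition inf_spectrum :: "'a::euclidean_space l2_op \<Rightarrow> real" where
  "inf_spectrum A = Inf {t. complex_of_real t \<in> spectrum A}"

section \<open>Anti-Wick operators\<close>

definition coherent_state ::
    "('a::euclidean_space \<Rightarrow> complex) \<Rightarrow> real \<Rightarrow> 'a \<times> 'a \<Rightarrow> 'a \<Rightarrow> complex" where
  "coherent_state \<phi> h = (\<lambda>(x\<^sub>0, \<omega>\<^sub>0) x.
     complex_of_real (h powr (- real DIM('a) / 4)) *
     exp (\<i> * complex_of_real ((\<omega>\<^sub>0 \<bullet> x) / h)) *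
     \<phi> ((h powr (- 1 / 2)) *\<^sub>R (x - x\<^sub>0)))"

definition antiwick_quad ::
    "('a::euclidean_space \<Rightarrow> complex) \<Rightarrow> ('a \<times> 'a \<Rightarrow> real \<Rightarrow> real) \<Rightarrow> real \<Rightarrow> ('a \<Rightarrow> complex) \<Rightarrow> ennreal"
  where
  "antiwick_quad \<phi> a h f =
     ennreal (1 / (2 * pi * h) ^ DIM('a)) *
     (\<integral>\<^sup>+z. ennreal (a z h * (norm (l2_inner f (coherent_state \<phi> h z)))\<^sup>2) \<partial>lborel)"

definition antiwick_dom ::
    "('a::euclidean_space \<Rightarrow> complex) \<Rightarrow> ('a \<times> 'a \<Rightarrow> real \<Rightarrow> real) \<Rightarrow> real \<Rightarrow> ('a \<Rightarrow> complex) set" where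
  "antiwick_dom \<phi> a h = {f \<in> L2. antiwick_quad \<phi> a h f < \<infinity>}"

text \<open>The sesquilinear form obtained by polarization; the integral converges absolutely for
  \<open>f\<close> and \<open>g\<close> in the form domain.\<close>

definition antiwick_form ::
    "('a::euclidean_space \<Rightarrow> complex) \<Rightarrow> ('a \<times> 'a \<Rightarrow> real \<Rightarrow> real) \<Rightarrow> real \<Rightarrow>
     ('a \<Rightarrow> complex) \<Rightarrow> ('a \<Rightarrow> complex) \<Rightarrow> complex" where
  "antiwick_form \<phi> a h f g =
     complex_of_real (1 / (2 * pi * h) ^ DIM('a)) *
     (LINT z|lborel. complex_of_real (a z h) *
        l2_inner f (coherent_state \<phi> h z) * cnj (l2_inner g (coherent_state \<phi> h z)))"

definition antiwick_op ::
    "('a::euclidean_space \<Rightarrow> complex) \<Rightarrow> ('a \<times> 'a \<Rightarrow> real \<Rightarrow> real) \<Rightarrow> real \<Rightarrow> 'a l2_op" where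
  "antiwick_op \<phi> a h = (THE A. self_adjoint A \<and> Domain A \<subseteq> antiwick_dom \<phi> a h \<and>
     (\<forall>(f, u)\<in>A. \<forall>g\<in>antiwick_dom \<phi> a h. l2_inner u g = antiwick_form \<phi> a h f g))"

text \<open>The norm of \<open>'a \<times> 'a\<close> is the Euclidean one.\<close>

definition lambda' :: "('a::euclidean_space \<times> 'a \<Rightarrow> real \<Rightarrow> real) \<Rightarrow> real \<Rightarrow> real" where
  "lambda' a h = (INF z\<^sub>0. SUP z\<in>ball z\<^sub>0 (sqrt h). a z h)"

end

theory Submission
  imports Defs "HOL-Probability.Probability" "HOL-Computational_Algebra.Polynomial"
begin

text \<open>
  Write \<open>V f z = \<langle>f, \<phi>\<^sub>z\<rangle>\<close>. The bottom of the spectrum is the infimum of the closed form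
  \<open>Q f = (2 \<pi> h)\<^sup>-\<^sup>d \<integral> a \<bar>V f\<bar>\<^sup>2\<close> over unit vectors \<open>f\<close>. By Plancherel \<open>V\<close> is a multiple of an
  isometry, and by integration by parts \<open>\<langle>\<phi>\<^sub>z, \<phi>\<^sub>w\<rangle>\<close> is rapidly decreasing in \<open>(z - w) / sqrt h\<close>.
  Along rays the symbol, on the scale \<open>sqrt h\<close>, is a polynomial of bounded degree up to
  \<open>O(h\<^sup>N)\<close>; this is where \<open>\<rho> < 1/2\<close> enters.

  Upper bound: test \<open>Q\<close> with \<open>\<phi>\<^sub>z\<close>. Being nearly a polynomial, \<open>a\<close> grows at most polynomially away
  from the ball of radius \<open>sqrt h\<close> about \<open>z\<close>, relative to its supremum there.

  Lower bound: since \<open>a\<close> is nearly a polynomial, the set \<open>A\<close> where \<open>a < \<epsilon> \<lambda>'\<close> fills only a small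
  proportion of every ball of radius \<open>sqrt h\<close>. By the reproducing formula for \<open>V f\<close> and the Schur
  test, at most half of the mass of \<open>V f\<close> lies in \<open>A\<close>, hence \<open>Q f \<ge> \<epsilon> \<lambda>' / 2\<close>.
\<close>

section \<open>Square-integrable functions\<close>

text \<open>\<open>antiwick_op\<close> is a definite description, so existence and uniqueness of the
  self-adjoint operator of a closed form have to be proved. This is done for functions instead of
  classes, which leaves every inner product semidefinite only. The constants must not depend on
  \<open>h\<close>: overlaps of coherent states are values of one \<open>h\<close>-free function at
  arguments divided by \<open>sqrt h\<close>, and the degree of the approximating polynomials is
  fixed before \<open>h\<close>. A derivative of order \<open>M\<close> along a ray on the scale
  \<open>sqrt h\<close> gains \<open>h powr (M / 2)\<close> and costs
  \<open>h powr (- (m + \<rho> * M))\<close>, so \<open>h ^ N\<close> remains once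
  \<open>M * (1/2 - \<rho>) \<ge> N + m\<close>. Both uses of the polynomials rest on Lagrange
  interpolation at separated nodes: fixed nodes near the start of a ray give growth, nodes found in
  a sublevel set give smallness at the start. The second conclusion is useful only if the infimum of
  the suprema dominates the error \<open>h ^ N\<close>; otherwise the lower bound holds because the
  form is nonnegative.\<close>

lemma nn_integral_lborel_affine:
  fixes f :: "'a::euclidean_space \<Rightarrow> ennreal"
  assumes [measurable]: "f \<in> borel_measurable borel" and "c \<noteq> 0"
  shows "(\<integral>\<^sup>+x. f x \<partial>lborel) = ennreal (\<bar>c\<bar> ^ DIM('a)) * (\<integral>\<^sup>+x. f (t + c *\<^sub>R x) \<partial>lborel)"
  by (subst lborel_affine[OF \<open>c \<noteq> 0\<close>, of t])
     (simp add: nn_integral_density nn_integral_distr nn_integral_cmult)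

lemma integrable_lborel_affine:
  fixes f :: "'a::euclidean_space \<Rightarrow> 'b::{banach, second_countable_topology}"
  assumes "integrable lborel f" and "c \<noteq> 0"
  shows "integrable lborel (\<lambda>x. f (t + c *\<^sub>R x))"
proof -
  have [measurable]: "f \<in> borel_measurable borel"
    using assms(1) by (auto dest: borel_measurable_integrable)
  have "(\<integral>\<^sup>+x. ennreal (norm (f x)) \<partial>lborel) < \<infinity>"
    using assms(1) by (simp add: integrable_iff_bounded)
  then have "(\<integral>\<^sup>+x. ennreal (norm (f (t + c *\<^sub>R x))) \<partial>lborel) < \<infinity>"
    using \<open>c \<noteq> 0\<close> nn_integral_lborel_affine[of "\<lambda>x. ennreal (norm (f x))" c t]
    by (auto simp: ennreal_mult_less_top)
  then show ?thesis
    by (simp add: integrable_iff_bounded)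
qed

lemma integral_lborel_affine:
  fixes f :: "'a::euclidean_space \<Rightarrow> 'b::{banach, second_countable_topology}"
  assumes [measurable]: "f \<in> borel_measurable borel" and "c \<noteq> 0"
  shows "(LINT x|lborel. f x) = \<bar>c\<bar> ^ DIM('a) *\<^sub>R (LINT x|lborel. f (t + c *\<^sub>R x))"
  by (subst lborel_affine[OF \<open>c \<noteq> 0\<close>, of t])
     (simp add: integral_density integral_distr)

text \<open>Each coordinate satisfies \<open>\<bar>x \<bullet> b\<bar> \<le> norm x\<close>, so the
  weight is dominated by a product of one-dimensional weights of exponent 2, one per coordinate.
  This accounts for \<open>2 * DIM('a)\<close> and avoids polar coordinates.\<close>

lemma integrable_inverse_power_norm:
  assumes "2 * DIM('a::euclidean_space) \<le> k"
  shows "integrable lborel (\<lambda>x::'a. 1 / (1 + norm x) ^ k)"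
proof -
  have 1: "(\<integral>\<^sup>+(t::real). ennreal (1 / (1 + \<bar>t\<bar>)\<^sup>2) \<partial>lborel) < \<infinity>"
  proof -
    \<comment> \<open>The arctangent integral covers the half-line \<open>x > 0\<close>; reflection
      adds \<open>x < 0\<close>, and the point 0 is a null set.\<close>
    have "integrable lborel (\<lambda>x::real. indicator {0<..} x *\<^sub>R (1 / (1 + x\<^sup>2)))"
      using integrable_I0i_1_div_plus_square
      by (simp add: interval_lebesgue_integrable_def set_integrable_def zero_ereal_def)
    then have i: "integrable lborel (\<lambda>x::real. indicator {0<..} x * (1 / (1 + x\<^sup>2)))"
      by simp
    from integrable_lborel_affine[OF this, of "-1" 0]
    have "integrable lborel (\<lambda>x::real. indicator {0<..} (-x) * (1 / (1 + x\<^sup>2)))"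
      by simp
    from Bochner_Integration.integrable_add[OF i this]
    have i2: "integrable lborel (\<lambda>x::real. indicator {0<..} x * (1 / (1 + x\<^sup>2)) + indicator {0<..} (-x) * (1 / (1 + x\<^sup>2)))" .
    have "integrable lborel (\<lambda>t::real. 1 / (1 + \<bar>t\<bar>)\<^sup>2)"
    proof (rule integrableI_bounded)
      show "(\<lambda>t::real. 1 / (1 + \<bar>t\<bar>)\<^sup>2) \<in> borel_measurable lborel" by measurable
      have "(\<integral>\<^sup>+(t::real). ennreal (norm (1 / (1 + \<bar>t\<bar>)\<^sup>2)) \<partial>lborel) \<le>
        (\<integral>\<^sup>+(x::real). ennreal (norm (indicator {0<..} x * (1 / (1 + x\<^sup>2)) + indicator {0<..} (-x) * (1 / (1 + x\<^sup>2)))) \<partial>lborel)"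
      proof (rule nn_integral_mono_AE)
        have "AE x in lborel. (x::real) \<noteq> 0" by (rule AE_lborel_singleton)
        then show "AE x in lborel. ennreal (norm (1 / (1 + \<bar>x::real\<bar>)\<^sup>2)) \<le>
           ennreal (norm (indicator {0<..} x * (1 / (1 + x\<^sup>2)) + indicator {0<..} (-x) * (1 / (1 + x\<^sup>2))))"
        proof eventually_elim
          case (elim x)
          have "1 + x\<^sup>2 \<le> (1 + \<bar>x\<bar>)\<^sup>2" by (simp add: power2_eq_square algebra_simps)
          then have "1 / (1 + \<bar>x\<bar>)\<^sup>2 \<le> 1 / (1 + x\<^sup>2)"
            by (intro divide_left_mono) (auto intro!: mult_pos_pos add_pos_nonneg)
          with elim show ?case
            by (intro ennreal_leI) (auto simp: indicator_def)
        qed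
      qed
      also have "\<dots> < \<infinity>" using i2 by (simp only: integrable_iff_bounded)
      finally show "(\<integral>\<^sup>+(t::real). ennreal (norm (1 / (1 + \<bar>t\<bar>)\<^sup>2)) \<partial>lborel) < \<infinity>" .
    qed
    then show ?thesis by (simp add: integrable_iff_bounded)
  qed
  have "(\<integral>\<^sup>+(x::'a). ennreal (1 / (1 + norm x) ^ k) \<partial>lborel)
      \<le> (\<integral>\<^sup>+(x::'a). (\<Prod>b\<in>Basis. ennreal (1 / (1 + \<bar>x \<bullet> b\<bar>)\<^sup>2)) \<partial>lborel)"
  proof (rule nn_integral_mono)
    fix x :: 'a
    have "(\<Prod>b\<in>(Basis::'a set). (1 + \<bar>x \<bullet> b\<bar>)\<^sup>2) \<le> (\<Prod>b\<in>(Basis::'a set). (1 + norm x)\<^sup>2)"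
      by (intro prod_mono) (auto intro!: power_mono Basis_le_norm)
    also have "\<dots> = (1 + norm x) ^ (2 * DIM('a))" by (simp add: power_mult)
    also have "\<dots> \<le> (1 + norm x) ^ k" using assms by (intro power_increasing) auto
    finally have "1 / (1 + norm x) ^ k \<le> 1 / (\<Prod>b\<in>(Basis::'a set). (1 + \<bar>x \<bullet> b\<bar>)\<^sup>2)"
      by (intro divide_left_mono mult_pos_pos prod_pos) (auto intro!: add_pos_nonneg zero_less_power)
    also have "\<dots> = (\<Prod>b\<in>(Basis::'a set). 1 / (1 + \<bar>x \<bullet> b\<bar>)\<^sup>2)"
      by (simp add: prod_dividef)
    finally show "ennreal (1 / (1 + norm x) ^ k) \<le> (\<Prod>b\<in>Basis. ennreal (1 / (1 + \<bar>x \<bullet> b\<bar>)\<^sup>2))"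
      by (subst prod_ennreal) (auto intro: ennreal_leI)
  qed
  also have "\<dots> = (\<Prod>b\<in>(Basis::'a set). \<integral>\<^sup>+t. ennreal (1 / (1 + \<bar>t\<bar>)\<^sup>2) \<partial>lborel)"
    by (rule nn_integral_lborel_prod) auto
  also have "\<dots> < \<infinity>"
    using 1 by (simp add: power_less_top_ennreal)
  finally have "(\<integral>\<^sup>+(x::'a). ennreal (1 / (1 + norm x) ^ k) \<partial>lborel) < \<infinity>" .
  then show ?thesis by (intro integrableI_bounded) auto
qed

section \<open>Vector operations, inner product and completeness of \<open>L2\<close>\<close>

lemma L2_cmult_integrable:
  assumes "f \<in> L2" and "g \<in> L2"
  shows "integrable lborel (\<lambda>x. f x * g x)"
proof (rule Bochner_Integration.integrable_bound)
  have [measurable]: "f \<in> borel_measurable lborel" "g \<in> borel_measurable lborel"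
    using assms by (auto simp: L2_def)
  show "integrable lborel (\<lambda>x. (norm (f x))\<^sup>2 + (norm (g x))\<^sup>2)"
    using assms by (auto simp: L2_def)
  show "(\<lambda>x. f x * g x) \<in> borel_measurable lborel" by measurable
  show "AE x in lborel. norm (f x * g x) \<le> norm ((norm (f x))\<^sup>2 + (norm (g x))\<^sup>2)"
  proof (intro AE_I2)
    fix x
    have "0 \<le> (norm (f x) - norm (g x))\<^sup>2" by simp
    then have "2 * (norm (f x) * norm (g x)) \<le> (norm (f x))\<^sup>2 + (norm (g x))\<^sup>2"
      by (simp add: power2_diff)
    moreover have "0 \<le> norm (f x) * norm (g x)" by simp
    ultimately show "norm (f x * g x) \<le> norm ((norm (f x))\<^sup>2 + (norm (g x))\<^sup>2)"
      unfolding norm_mult real_norm_def by linarith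
  qed
qed

lemma borel_measurable_cnj [measurable (raw)]:
  "f \<in> borel_measurable M \<Longrightarrow> (\<lambda>x. cnj (f x)) \<in> borel_measurable M"
  by (rule measurable_compose[OF _ borel_measurable_continuous_onI[OF continuous_on_cnj[OF continuous_on_id]]])

lemma L2_cnj: "f \<in> L2 \<Longrightarrow> (\<lambda>x. cnj (f x)) \<in> L2"
  by (auto simp: L2_def)

lemma L2_zero: "(\<lambda>x. 0) \<in> L2"
  by (auto simp: L2_def)

lemma L2_scale: "f \<in> L2 \<Longrightarrow> (\<lambda>x. c * f x) \<in> L2"
  by (auto simp: L2_def norm_mult power_mult_distrib)

lemma L2_measurable: "f \<in> L2 \<Longrightarrow> f \<in> borel_measurable borel"
  by (auto simp: L2_def)

lemma L2_add:
  assumes "f \<in> L2" and "g \<in> L2"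
  shows "(\<lambda>x. f x + g x) \<in> L2"
proof -
  have [measurable]: "f \<in> borel_measurable lborel" "g \<in> borel_measurable lborel"
    using assms by (auto simp: L2_def)
  have "integrable lborel (\<lambda>x. (norm (f x + g x))\<^sup>2)"
  proof (rule Bochner_Integration.integrable_bound)
    show "integrable lborel (\<lambda>x. 2 * (norm (f x))\<^sup>2 + 2 * (norm (g x))\<^sup>2)"
      using assms by (auto simp: L2_def)
    show "(\<lambda>x. (norm (f x + g x))\<^sup>2) \<in> borel_measurable lborel" by measurable
    show "AE x in lborel. norm ((norm (f x + g x))\<^sup>2) \<le> norm (2 * (norm (f x))\<^sup>2 + 2 * (norm (g x))\<^sup>2)"
    proof (intro AE_I2)
      fix x
      have "(norm (f x + g x))\<^sup>2 \<le> (norm (f x) + norm (g x))\<^sup>2"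
        by (intro power_mono norm_triangle_ineq) auto
      moreover have "0 \<le> (norm (f x) - norm (g x))\<^sup>2" by simp
      ultimately show "norm ((norm (f x + g x))\<^sup>2) \<le> norm (2 * (norm (f x))\<^sup>2 + 2 * (norm (g x))\<^sup>2)"
        by (simp add: power2_diff power2_sum)
    qed
  qed
  then show ?thesis by (auto simp: L2_def)
qed

lemma L2_diff:
  assumes "f \<in> L2" and "g \<in> L2"
  shows "(\<lambda>x. f x - g x) \<in> L2"
  using L2_add[OF assms(1) L2_scale[OF assms(2), of "-1"]] by simp

lemma L2_sq_integrable: "f \<in> L2 \<Longrightarrow> integrable lborel (\<lambda>x. (norm (f x))\<^sup>2)"
  by (simp add: L2_def)

lemma l2_inner_integrable:
  assumes "f \<in> L2" and "g \<in> L2"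
  shows "integrable lborel (\<lambda>x. f x * cnj (g x))"
  using L2_cmult_integrable[OF assms(1) L2_cnj[OF assms(2)]] .

lemma l2_inner_add:
  assumes "f \<in> L2" "g \<in> L2" "k \<in> L2"
  shows "l2_inner (\<lambda>x. f x + g x) k = l2_inner f k + l2_inner g k"
  using assms by (simp add: l2_inner_def distrib_right l2_inner_integrable)

lemma l2_inner_diff:
  assumes "f \<in> L2" "g \<in> L2" "k \<in> L2"
  shows "l2_inner (\<lambda>x. f x - g x) k = l2_inner f k - l2_inner g k"
  using assms by (simp add: l2_inner_def left_diff_distrib l2_inner_integrable)

lemma l2_inner_scale: "l2_inner (\<lambda>x. c * f x) k = c * l2_inner f k"
  by (simp add: l2_inner_def mult.assoc)

lemma l2_inner_commute: "l2_inner g f = cnj (l2_inner f g)"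
proof -
  have "cnj (l2_inner f g) = (LINT x|lborel. cnj (f x * cnj (g x)))"
    unfolding l2_inner_def by (rule Bochner_Integration.integral_cnj[symmetric])
  then show ?thesis by (simp add: l2_inner_def mult.commute)
qed

lemma l2_inner_self: "l2_inner f f = complex_of_real ((l2_norm f)\<^sup>2)"
proof -
  have "l2_inner f f = (LINT x|lborel. complex_of_real ((norm (f x))\<^sup>2))"
    unfolding l2_inner_def by (simp add: complex_norm_square[symmetric])
  also have "\<dots> = complex_of_real (LINT x|lborel. (norm (f x))\<^sup>2)"
    by (rule integral_complex_of_real)
  also have "(LINT x|lborel. (norm (f x))\<^sup>2) = (l2_norm f)\<^sup>2"
    by (simp add: l2_norm_def)
  finally show ?thesis .
qed

lemma l2_norm_nonneg: "0 \<le> l2_norm f"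
  by (simp add: l2_norm_def)

lemma l2_norm_sq: "(l2_norm f)\<^sup>2 = (LINT x|lborel. (norm (f x))\<^sup>2)"
  by (simp add: l2_norm_def)

lemma l2_norm_scale: "l2_norm (\<lambda>x. c * f x) = norm c * l2_norm f"
  by (simp add: l2_norm_def norm_mult power_mult_distrib real_sqrt_mult)

lemma nn_integral_L2:
  "f \<in> L2 \<Longrightarrow> (\<integral>\<^sup>+x. ennreal ((norm (f x))\<^sup>2) \<partial>lborel) = ennreal ((l2_norm f)\<^sup>2)"
  unfolding l2_norm_sq by (rule nn_integral_eq_integral) (auto simp: L2_def)

lemma L2I:
  assumes "f \<in> borel_measurable borel" and "(\<integral>\<^sup>+x. ennreal ((norm (f x))\<^sup>2) \<partial>lborel) < \<infinity>"
  shows "f \<in> L2"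
  using assms by (auto simp: L2_def intro!: integrableI_bounded)

lemma l2_cauchy_schwarz:
  assumes "f \<in> L2" and "g \<in> L2"
  shows "norm (l2_inner f g) \<le> l2_norm f * l2_norm g"
proof -
  have [measurable]: "f \<in> borel_measurable lborel" "g \<in> borel_measurable lborel"
    using assms by (auto simp: L2_def)
  have i: "integrable lborel (\<lambda>x. norm (f x) * norm (g x))"
    using integrable_norm[OF L2_cmult_integrable[OF assms]] by (simp add: norm_mult)
  have "norm (l2_inner f g) \<le> (LINT x|lborel. norm (f x * cnj (g x)))"
    unfolding l2_inner_def by (rule integral_norm_bound)
  also have "\<dots> = (LINT x|lborel. norm (f x) * norm (g x))"
    by (simp add: norm_mult)
  finally have 1: "norm (l2_inner f g) \<le> (LINT x|lborel. norm (f x) * norm (g x))" .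
  have "(\<integral>\<^sup>+x. ennreal (norm (f x)) * ennreal (norm (g x)) \<partial>lborel)\<^sup>2 \<le>
     (\<integral>\<^sup>+x. (ennreal (norm (f x)))\<^sup>2 \<partial>lborel) * (\<integral>\<^sup>+x. (ennreal (norm (g x)))\<^sup>2 \<partial>lborel)"
    by (rule Cauchy_Schwarz_nn_integral) measurable
  also have "\<dots> = ennreal ((l2_norm f)\<^sup>2) * ennreal ((l2_norm g)\<^sup>2)"
    by (simp add: ennreal_power nn_integral_L2 assms)
  also have "(\<integral>\<^sup>+x. ennreal (norm (f x)) * ennreal (norm (g x)) \<partial>lborel) =
      ennreal (LINT x|lborel. norm (f x) * norm (g x))"
    using nn_integral_eq_integral[OF i] by (simp add: ennreal_mult)
  finally have "ennreal ((LINT x|lborel. norm (f x) * norm (g x))\<^sup>2) \<le> ennreal ((l2_norm f * l2_norm g)\<^sup>2)"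
    by (simp add: ennreal_power ennreal_mult power_mult_distrib)
  then have "(LINT x|lborel. norm (f x) * norm (g x))\<^sup>2 \<le> (l2_norm f * l2_norm g)\<^sup>2"
    by (subst (asm) ennreal_le_iff) auto
  then have "(LINT x|lborel. norm (f x) * norm (g x)) \<le> l2_norm f * l2_norm g"
    by (rule power2_le_imp_le) (simp add: l2_norm_nonneg)
  with 1 show ?thesis by simp
qed

lemma l2_norm_triangle:
  assumes "f \<in> L2" and "g \<in> L2"
  shows "l2_norm (\<lambda>x. f x + g x) \<le> l2_norm f + l2_norm g"
proof (rule power2_le_imp_le)
  note L = assms L2_add[OF assms]
  have "complex_of_real ((l2_norm (\<lambda>x. f x + g x))\<^sup>2) = l2_inner f f + l2_inner g g + l2_inner f g + cnj (l2_inner f g)"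
    unfolding l2_inner_self[symmetric] l2_inner_add[OF assms L(3)]
    by (subst (1 2) l2_inner_commute) (simp add: l2_inner_add assms l2_inner_commute[of g f] l2_inner_self)
  then have "(l2_norm (\<lambda>x. f x + g x))\<^sup>2 = (l2_norm f)\<^sup>2 + (l2_norm g)\<^sup>2 + 2 * Re (l2_inner f g)"
    by (auto simp: complex_eq_iff l2_inner_self)
  moreover have "Re (l2_inner f g) \<le> l2_norm f * l2_norm g"
    using l2_cauchy_schwarz[OF assms] complex_Re_le_cmod order_trans by blast
  ultimately show "(l2_norm (\<lambda>x. f x + g x))\<^sup>2 \<le> (l2_norm f + l2_norm g)\<^sup>2"
    by (simp add: power2_sum)
qed (simp add: l2_norm_nonneg)

lemma l2_norm_eq_0_AE:
  assumes "f \<in> L2" and "l2_norm f = 0"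
  shows "AE x in lborel. f x = 0"
proof -
  have "(\<integral>\<^sup>+x. ennreal ((norm (f x))\<^sup>2) \<partial>lborel) = 0"
    using assms by (simp add: nn_integral_L2)
  moreover have [measurable]: "f \<in> borel_measurable lborel" using assms by (auto simp: L2_def)
  ultimately have "AE x in lborel. ennreal ((norm (f x))\<^sup>2) = 0"
    by (subst (asm) nn_integral_0_iff_AE) auto
  then show ?thesis by eventually_elim auto
qed

lemma l2_inner_cong_AE:
  assumes "f \<in> L2" "f' \<in> L2" "g \<in> L2" "g' \<in> L2"
    and "AE x in lborel. f x = f' x" and "AE x in lborel. g x = g' x"
  shows "l2_inner f g = l2_inner f' g'"
  unfolding l2_inner_def
proof (rule integral_cong_AE)
  have [measurable]: "f \<in> borel_measurable lborel" "g \<in> borel_measurable lborel"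
      "f' \<in> borel_measurable lborel" "g' \<in> borel_measurable lborel"
    using assms by (auto simp: L2_def)
  show "(\<lambda>x. f x * cnj (g x)) \<in> borel_measurable lborel" "(\<lambda>x. f' x * cnj (g' x)) \<in> borel_measurable lborel"
    by measurable
  show "AE x in lborel. f x * cnj (g x) = f' x * cnj (g' x)"
    using assms(5,6) by eventually_elim simp
qed

lemma l2_norm_cong_AE:
  assumes "f \<in> L2" "f' \<in> L2" "AE x in lborel. f x = f' x"
  shows "l2_norm f = l2_norm f'"
proof -
  have "complex_of_real ((l2_norm f)\<^sup>2) = complex_of_real ((l2_norm f')\<^sup>2)"
    unfolding l2_inner_self[symmetric] by (rule l2_inner_cong_AE) (use assms in auto)
  then show ?thesis
    using l2_norm_nonneg by (metis of_real_eq_iff power2_eq_iff_nonneg)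
qed

text \<open>Riesz-Fischer: a subsequence with geometric increments converges almost everywhere, and
  Fatou's lemma turns its pointwise limit into the norm limit of the whole sequence.\<close>

lemma L2_complete:
  fixes F :: "nat \<Rightarrow> 'a::euclidean_space \<Rightarrow> complex"
  assumes L: "\<And>n. F n \<in> L2"
    and C: "\<And>e. 0 < e \<Longrightarrow> \<exists>n0. \<forall>m\<ge>n0. \<forall>n\<ge>n0. l2_norm (\<lambda>x. F m x - F n x) < e"
  shows "\<exists>f\<in>L2. (\<lambda>n. l2_norm (\<lambda>x. F n x - f x)) \<longlonglongrightarrow> 0"
proof -
  have Fm[measurable]: "F n \<in> borel_measurable borel" for n using L by (simp add: L2_measurable)
  have "\<forall>k. \<exists>n0. \<forall>m\<ge>n0. \<forall>n\<ge>n0. l2_norm (\<lambda>x. F m x - F n x) < (1/2)^k"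
    using C by simp
  then obtain N where N: "\<And>k m n. m \<ge> N k \<Longrightarrow> n \<ge> N k \<Longrightarrow> l2_norm (\<lambda>x. F m x - F n x) < (1/2)^k"
    by metis
  \<comment> \<open>Partial sums of \<open>N\<close> are nondecreasing and dominate each
    \<open>N k\<close>, so they can serve as indices of the subsequence.\<close>
  define r where "r = (\<lambda>k::nat. \<Sum>j\<le>k. N j)"
  have rN: "N k \<le> r k" for k unfolding r_def by (rule member_le_sum) auto
  have rmono: "r k \<le> r (Suc k)" for k by (simp add: r_def)
  define d where "d = (\<lambda>k x. F (r (Suc k)) x - F (r k) x)"
  have [measurable]: "d k \<in> borel_measurable borel" for k unfolding d_def by measurable
  have dL: "d k \<in> L2" for k unfolding d_def by (intro L2_diff L)
  have dn: "l2_norm (d k) \<le> (1/2)^k" for k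
    unfolding d_def using N[of k "r (Suc k)" "r k"] rN[of k] rmono[of k] by simp
  \<comment> \<open>The weights \<open>2 ^ k\<close> make the squared increments summable almost everywhere with a geometric margin, so that the increments themselves are summable.\<close>
  have "(\<integral>\<^sup>+x. (\<Sum>k. ennreal (2^k * (norm (d k x))\<^sup>2)) \<partial>lborel) = (\<Sum>k. \<integral>\<^sup>+x. ennreal (2^k * (norm (d k x))\<^sup>2) \<partial>lborel)"
    by (rule nn_integral_suminf) auto
  also have "\<dots> = (\<Sum>k. ennreal (2^k * (l2_norm (d k))\<^sup>2))"
    by (simp add: ennreal_mult nn_integral_cmult nn_integral_L2 dL)
  also have "\<dots> \<le> (\<Sum>k. ennreal ((1/2)^k))"
  proof (rule suminf_le)
    fix k
    have "(l2_norm (d k))\<^sup>2 \<le> ((1/2)^k)\<^sup>2"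
      by (intro power_mono dn l2_norm_nonneg)
    then have "2^k * (l2_norm (d k))\<^sup>2 \<le> 2^k * ((1/2)^k)\<^sup>2" by simp
    also have "\<dots> = (1/2)^k" by (simp add: power2_eq_square power_divide)
    finally show "ennreal (2^k * (l2_norm (d k))\<^sup>2) \<le> ennreal ((1/2)^k)" by (rule ennreal_leI)
  qed auto
  also have "\<dots> < \<infinity>"
    by (subst suminf_ennreal2) (auto intro: summable_geometric)
  finally have "(\<integral>\<^sup>+x. (\<Sum>k. ennreal (2^k * (norm (d k x))\<^sup>2)) \<partial>lborel) \<noteq> \<infinity>" by simp
  then have "AE x in lborel. (\<Sum>k. ennreal (2^k * (norm (d k x))\<^sup>2)) \<noteq> \<infinity>"
    by (intro nn_integral_noteq_infinite) auto
  then have conv: "AE x in lborel. convergent (\<lambda>k. F (r k) x)"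
  proof eventually_elim
    case (elim x)
    then have s: "summable (\<lambda>k. 2^k * (norm (d k x))\<^sup>2)"
      by (intro summable_suminf_not_top) auto
    then have "(\<lambda>k. 2^k * (norm (d k x))\<^sup>2) \<longlonglongrightarrow> 0" by (rule summable_LIMSEQ_zero)
    then have "Bseq (\<lambda>k. 2^k * (norm (d k x))\<^sup>2)" by (simp add: convergent_imp_Bseq convergentI)
    then obtain K where K: "\<And>k. 2^k * (norm (d k x))\<^sup>2 \<le> K" "K > 0"
      by (auto simp: Bseq_def)
    have bd: "norm (d k x) \<le> sqrt K * (sqrt (1/2))^k" for k
    proof (rule power2_le_imp_le)
      have "(norm (d k x))\<^sup>2 \<le> K / 2^k" using K(1)[of k] by (simp add: field_simps)
      also have "\<dots> = (sqrt K * (sqrt (1/2))^k)\<^sup>2"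
        using K(2) by (simp add: power_mult_distrib power2_eq_square power_divide real_sqrt_power[symmetric] field_simps
             flip: power_mult_distrib)
      finally show "(norm (d k x))\<^sup>2 \<le> (sqrt K * (sqrt (1/2))^k)\<^sup>2" .
    qed (use K in auto)
    have "summable (\<lambda>k. sqrt K * (sqrt (1/2))^k)"
      by (intro summable_mult summable_geometric) (simp add: real_less_lsqrt)
    then have "summable (\<lambda>k. d k x)" by (rule summable_comparison_test'[of _ 0]) (use bd in auto)
    then have "(\<lambda>n. \<Sum>k<n. d k x) \<longlonglongrightarrow> (\<Sum>k. d k x)" by (rule summable_LIMSEQ)
    then have "(\<lambda>n. F (r n) x - F (r 0) x) \<longlonglongrightarrow> (\<Sum>k. d k x)"
      by (simp add: d_def sum_lessThan_telescope[of "\<lambda>n. F (r n) x"])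
    from tendsto_add[OF this tendsto_const[of "F (r 0) x"]] show ?case
      by (auto intro: convergentI)
  qed
  \<comment> \<open>Where the subsequence diverges, \<open>lim\<close> has an unspecified value;
    this happens on a null set only.\<close>
  define f where "f = (\<lambda>x. lim (\<lambda>k. F (r k) x))"
  have fm[measurable]: "f \<in> borel_measurable borel" unfolding f_def by measurable
  have flim: "AE x in lborel. (\<lambda>k. F (r k) x) \<longlonglongrightarrow> f x"
    using conv by eventually_elim (simp add: f_def convergent_LIMSEQ_iff)
  \<comment> \<open>Fatou's lemma with \<open>n\<close> fixed: the integrand is the limit of the
    squared distances to \<open>F (r k)\<close>, whose integrals are below the bound as soon as
    \<open>k \<ge> j\<close>.\<close>
  have est: "(\<integral>\<^sup>+x. ennreal ((norm (F n x - f x))\<^sup>2) \<partial>lborel) \<le> ennreal (((1/2)^j)\<^sup>2)" if "n \<ge> N j" for n j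
  proof -
    have rj: "N j \<le> r k" if "k \<ge> j" for k
      using rN[of j] lift_Suc_mono_le[of r, OF rmono that] by linarith
    have "(\<integral>\<^sup>+x. ennreal ((norm (F n x - f x))\<^sup>2) \<partial>lborel) = (\<integral>\<^sup>+x. liminf (\<lambda>k. ennreal ((norm (F n x - F (r k) x))\<^sup>2)) \<partial>lborel)"
    proof (rule nn_integral_cong_AE)
      show "AE x in lborel. ennreal ((norm (F n x - f x))\<^sup>2) = liminf (\<lambda>k. ennreal ((norm (F n x - F (r k) x))\<^sup>2))"
        using flim
      proof eventually_elim
        case (elim x)
        have "(\<lambda>k. ennreal ((norm (F n x - F (r k) x))\<^sup>2)) \<longlonglongrightarrow> ennreal ((norm (F n x - f x))\<^sup>2)"
          using elim by (intro tendsto_intros)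
        then show ?case by (metis lim_imp_Liminf sequentially_bot)
      qed
    qed
    also have "\<dots> \<le> liminf (\<lambda>k. \<integral>\<^sup>+x. ennreal ((norm (F n x - F (r k) x))\<^sup>2) \<partial>lborel)"
      by (rule nn_integral_liminf) auto
    also have "\<dots> = liminf (\<lambda>k. ennreal ((l2_norm (\<lambda>x. F n x - F (r k) x))\<^sup>2))"
      by (simp add: nn_integral_L2 L2_diff L)
    also have "\<dots> \<le> limsup (\<lambda>k. ennreal ((l2_norm (\<lambda>x. F n x - F (r k) x))\<^sup>2))"
      by (rule Liminf_le_Limsup) simp
    also have "\<dots> \<le> ennreal (((1/2)^j)\<^sup>2)"
    proof (rule Limsup_bounded)
      show "\<forall>\<^sub>F k in sequentially. ennreal ((l2_norm (\<lambda>x. F n x - F (r k) x))\<^sup>2) \<le> ennreal (((1/2)^j)\<^sup>2)"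
        using eventually_ge_at_top[of j]
      proof eventually_elim
        case (elim k)
        show ?case
          using N[OF that rj[OF elim]] by (intro ennreal_leI power_mono l2_norm_nonneg) simp
      qed
    qed
    finally show ?thesis .
  qed
  have diffL: "(\<lambda>x. F (N 0) x - f x) \<in> L2"
    using est[of 0 "N 0"] by (intro L2I) (auto intro: le_less_trans)
  have fL: "f \<in> L2"
    using L2_diff[OF L[of "N 0"] diffL] by simp
  have "(\<lambda>n. l2_norm (\<lambda>x. F n x - f x)) \<longlonglongrightarrow> 0"
  proof (rule LIMSEQ_I)
    fix e :: real assume "0 < e"
    obtain j where j: "(1/2::real)^j < e" using \<open>0 < e\<close> real_arch_pow_inv[of e "1/2"] by auto
    show "\<exists>no. \<forall>n\<ge>no. norm (l2_norm (\<lambda>x. F n x - f x) - 0) < e"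
    proof (intro exI allI impI)
      fix n assume "n \<ge> N j"
      from est[OF this] have "ennreal ((l2_norm (\<lambda>x. F n x - f x))\<^sup>2) \<le> ennreal (((1/2)^j)\<^sup>2)"
        by (simp add: nn_integral_L2 L2_diff L fL)
      then have "(l2_norm (\<lambda>x. F n x - f x))\<^sup>2 \<le> ((1/2)^j)\<^sup>2" by (subst (asm) ennreal_le_iff) auto
      then have "l2_norm (\<lambda>x. F n x - f x) \<le> (1/2)^j" by (rule power2_le_imp_le) simp
      with j l2_norm_nonneg[of "\<lambda>x. F n x - f x"]
      show "norm (l2_norm (\<lambda>x. F n x - f x) - 0) < e" by simp
    qed
  qed
  with fL show ?thesis by auto
qed

section \<open>Translations and Gaussians\<close>

lemma integrable_lborel_translate:
  fixes f :: "'a::euclidean_space \<Rightarrow> 'b::{banach, second_countable_topology}"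
  assumes "integrable lborel f"
  shows "integrable lborel (\<lambda>x. f (x + t))"
  using integrable_lborel_affine[OF assms, of 1 t] by (simp add: add.commute)

lemma integral_lborel_translate:
  fixes f :: "'a::euclidean_space \<Rightarrow> 'b::{banach, second_countable_topology}"
  assumes "f \<in> borel_measurable borel"
  shows "(LINT x|lborel. f (x + t)) = (LINT x|lborel. f x)"
  using integral_lborel_affine[OF assms, of 1 t] by (simp add: add.commute)

text \<open>Induction over integrable functions: indicators, sums, dominated limits. The local fact
  \<open>step\<close> says that the property survives approximation in mean; it serves the first
  case, where open sets approximate measurable ones, and the last.\<close>

lemma L1_translation_continuous:
  fixes f :: "'a::euclidean_space \<Rightarrow> complex"
  assumes "integrable lborel f" and v: "v \<longlonglongrightarrow> 0"
  shows "(\<lambda>n. LINT x|lborel. norm (f (x + v n) - f x)) \<longlonglongrightarrow> 0"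
  using assms(1)
proof (induction rule: integrable_induct)
  have step: "(\<lambda>n. LINT x|lborel. norm (g (x + v n) - g x)) \<longlonglongrightarrow> 0"
    if g: "integrable lborel g"
      and approx: "\<And>e. e > 0 \<Longrightarrow> \<exists>k. integrable lborel k \<and> (LINT x|lborel. norm (g x - k x)) \<le> e \<and>
        (\<lambda>n. LINT x|lborel. norm (k (x + v n) - k x)) \<longlonglongrightarrow> 0" for g :: "'a \<Rightarrow> complex"
  proof (rule LIMSEQ_I)
    fix e :: real assume "0 < e"
    obtain k where k: "integrable lborel k" "(LINT x|lborel. norm (g x - k x)) \<le> e / 4"
       and lim: "(\<lambda>n. LINT x|lborel. norm (k (x + v n) - k x)) \<longlonglongrightarrow> 0"
      using approx[of "e/4"] \<open>0 < e\<close> by auto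
    obtain n0 where n0: "\<And>n. n \<ge> n0 \<Longrightarrow> norm (LINT x|lborel. norm (k (x + v n) - k x)) < e / 4"
      using LIMSEQ_D[OF lim, of "e/4"] \<open>0 < e\<close> by auto
    have gk: "integrable lborel (\<lambda>x. g x - k x)" using g k by auto
    have [measurable]: "g \<in> borel_measurable borel" "k \<in> borel_measurable borel"
      using g k by (auto dest: borel_measurable_integrable)
    show "\<exists>no. \<forall>n\<ge>no. norm ((LINT x|lborel. norm (g (x + v n) - g x)) - 0) < e"
    proof (intro exI allI impI)
      fix n assume n: "n \<ge> n0"
      have i: "integrable lborel (\<lambda>x. norm (g (x + v n) - k (x + v n)))"
           "integrable lborel (\<lambda>x. norm (k (x + v n) - k x))" "integrable lborel (\<lambda>x. norm (g x - k x))"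
           "integrable lborel (\<lambda>x. norm (g (x + v n) - g x))"
        using integrable_lborel_translate[OF g, of "v n"] integrable_lborel_translate[OF k(1), of "v n"] g k
        by auto
      have "(LINT x|lborel. norm (g (x + v n) - g x)) \<le>
         (LINT x|lborel. norm (g (x + v n) - k (x + v n)) + norm (k (x + v n) - k x) + norm (g x - k x))"
      proof (rule integral_mono)
        fix x
        have "g (x + v n) - g x = (g (x + v n) - k (x + v n)) + (k (x + v n) - k x) - (g x - k x)" by simp
        then show "norm (g (x + v n) - g x) \<le> norm (g (x + v n) - k (x + v n)) + norm (k (x + v n) - k x) + norm (g x - k x)"
          using order_trans[OF norm_triangle_ineq4 add_right_mono[OF norm_triangle_ineq]] by metis
      qed (use i in auto)
      also have "\<dots> = (LINT x|lborel. norm (g (x + v n) - k (x + v n))) + (LINT x|lborel. norm (k (x + v n) - k x)) + (LINT x|lborel. norm (g x - k x))"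
        using i by simp
      also have "(LINT x|lborel. norm (g (x + v n) - k (x + v n))) = (LINT x|lborel. norm (g x - k x))"
        by (rule integral_lborel_translate[of "\<lambda>x. norm (g x - k x)"]) measurable
      finally have "(LINT x|lborel. norm (g (x + v n) - g x)) < e"
        using k(2) n0[OF n] \<open>0 < e\<close> unfolding real_norm_def by linarith
      then show "norm ((LINT x|lborel. norm (g (x + v n) - g x)) - 0) < e" by simp
    qed
  qed
  {
    case (base A c)
    have opn: "(\<lambda>n. LINT x|lborel. norm (indicat_real U (x + v n) *\<^sub>R c - indicat_real U x *\<^sub>R c)) \<longlonglongrightarrow> 0"
      if U: "open U" "emeasure lborel U < \<infinity>" for U :: "'a set" and c :: complex
    proof -
      have [measurable]: "U \<in> sets borel" using U by auto
      have iU: "integrable lborel (indicat_real U)" using U by (intro integrable_real_indicator) auto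
      have iUn: "integrable lborel (\<lambda>x. indicat_real U (x + v n))" for n
        by (rule integrable_lborel_translate[OF iU])
      have iUn2: "integrable lborel (\<lambda>x. indicat_real U x * indicat_real U (x + v n))" for n
        by (rule Bochner_Integration.integrable_bound[OF iU]) (auto simp: indicator_def)
      \<comment> \<open>By invariance of the measure, \<open>1\<^sub>U - 1\<^sub>U(\<sqdot> + v)\<close> has vanishing integral, so it suffices to bound its positive part, which tends to 0 pointwise because \<open>U\<close> is open.\<close>
      have eq: "(LINT x|lborel. norm (indicat_real U (x + v n) *\<^sub>R c - indicat_real U x *\<^sub>R c)) =
          2 * norm c * (LINT x|lborel. indicat_real U x * (1 - indicat_real U (x + v n)))" for n
      proof -
        have "(LINT x|lborel. norm (indicat_real U (x + v n) *\<^sub>R c - indicat_real U x *\<^sub>R c)) =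
           (LINT x|lborel. norm c * (2 * (indicat_real U x * (1 - indicat_real U (x + v n))) + (indicat_real U (x + v n) - indicat_real U x)))"
          by (intro Bochner_Integration.integral_cong) (auto simp: indicator_def)
        also have "\<dots> = norm c * (2 * (LINT x|lborel. indicat_real U x * (1 - indicat_real U (x + v n))) + ((LINT x|lborel. indicat_real U (x + v n)) - (LINT x|lborel. indicat_real U x)))"
          using iU iUn iUn2 by (simp add: right_diff_distrib)
        also have "(LINT x|lborel. indicat_real U (x + v n)) = (LINT x|lborel. indicat_real U x)"
          by (rule integral_lborel_translate) measurable
        finally show ?thesis by simp
      qed
      have "(\<lambda>n. LINT x|lborel. indicat_real U x * (1 - indicat_real U (x + v n))) \<longlonglongrightarrow> (LINT (x::'a)|lborel. 0 :: real)"
      proof (rule integral_dominated_convergence[where w="indicat_real U"])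
        show "AE x in lborel. (\<lambda>n. indicat_real U x * (1 - indicat_real U (x + v n))) \<longlonglongrightarrow> 0"
        proof (intro AE_I2)
          fix x
          show "(\<lambda>n. indicat_real U x * (1 - indicat_real U (x + v n))) \<longlonglongrightarrow> 0"
          proof (cases "x \<in> U")
            case True
            have "(\<lambda>n. x + v n) \<longlonglongrightarrow> x + 0" by (intro tendsto_intros v)
            then have "\<forall>\<^sub>F n in sequentially. x + v n \<in> U"
              using topological_tendstoD[OF _ U(1)] True by (metis add.right_neutral)
            then show ?thesis
              by (intro tendsto_eventually, eventually_elim) simp
          qed simp
        qed
        show "AE x in lborel. norm (indicat_real U x * (1 - indicat_real U (x + v n))) \<le> indicat_real U x" for n
          by (auto simp: indicator_def)
      qed (use iU in auto)
      from tendsto_mult_left[OF this, of "2 * norm c"] show ?thesis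
        by (simp only: eq) simp
    qed
    show ?case
    proof (rule step)
      show "integrable lborel (\<lambda>x. indicat_real A x *\<^sub>R c)"
        using base by (intro integrable_scaleR_left integrable_real_indicator) auto
      fix e :: real assume "e > 0"
      \<comment> \<open>The summand 1 covers \<open>c = 0\<close>.\<close>
      define e' where "e' = e / (1 + norm c)"
      have "e' > 0" using \<open>e > 0\<close> by (simp add: e'_def add_pos_nonneg)
      have [measurable]: "A \<in> sets borel" using base by simp
      have "A \<in> sets lebesgue" by (simp add: sets_completionI_sets)
      \<comment> \<open>Outer regularity reduces a measurable set to an open one, for which
        \<open>opn\<close> is available.\<close>
      from sets_lebesgue_outer_open[OF this \<open>e' > 0\<close>] obtain U where
        U: "open U" "A \<subseteq> U" "emeasure lebesgue (U - A) < ennreal e'" by metis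
      have [measurable]: "U \<in> sets borel" using U by auto
      have UA: "emeasure lborel (U - A) < ennreal e'"
        using U(3) by simp
      have "emeasure lborel U \<le> emeasure lborel A + emeasure lborel (U - A)"
        using U(2) by (subst plus_emeasure) (auto intro!: emeasure_mono)
      also have "\<dots> < \<infinity>" using base(2) UA by (auto simp: top.not_eq_extremum intro: less_trans)
      finally have Uf: "emeasure lborel U < \<infinity>" .
      have UAm: "measure lborel (U - A) \<le> e'"
        using UA \<open>e' > 0\<close> unfolding measure_def by (intro enn2real_leI) auto
      show "\<exists>k. integrable lborel k \<and> (LINT x|lborel. norm (indicat_real A x *\<^sub>R c - k x)) \<le> e \<and>
        (\<lambda>n. LINT x|lborel. norm (k (x + v n) - k x)) \<longlonglongrightarrow> 0"
      proof (intro exI[of _ "\<lambda>x. indicat_real U x *\<^sub>R c"] conjI opn U(1) Uf)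
        show "integrable lborel (\<lambda>x. indicat_real U x *\<^sub>R c)"
          using Uf by (intro integrable_scaleR_left integrable_real_indicator) auto
        have "(LINT x|lborel. norm (indicat_real A x *\<^sub>R c - indicat_real U x *\<^sub>R c)) = (LINT x|lborel. norm c * indicat_real (U - A) x)"
          using U(2) by (intro Bochner_Integration.integral_cong) (auto simp: indicator_def)
        also have "\<dots> = norm c * measure lborel (U - A)" by simp
        also have "\<dots> \<le> norm c * e'" using UAm by (intro mult_left_mono) auto
        also have "\<dots> \<le> e" using \<open>e > 0\<close> by (simp add: e'_def field_simps add_pos_nonneg)
        finally show "(LINT x|lborel. norm (indicat_real A x *\<^sub>R c - indicat_real U x *\<^sub>R c)) \<le> e" .
      qed
    qed
  next
    case (add f g)
    have [measurable]: "f \<in> borel_measurable borel" "g \<in> borel_measurable borel"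
      using add by (auto dest: borel_measurable_integrable)
    have i: "integrable lborel (\<lambda>x. norm (f (x + v n) - f x))" "integrable lborel (\<lambda>x. norm (g (x + v n) - g x))" for n
      using add integrable_lborel_translate[OF add(1), of "v n"] integrable_lborel_translate[OF add(2), of "v n"]
      by auto
    have i3: "integrable lborel (\<lambda>x. norm ((f (x + v n) + g (x + v n)) - (f x + g x)))" for n
      using add integrable_lborel_translate[OF add(1), of "v n"] integrable_lborel_translate[OF add(2), of "v n"]
      by auto
    show ?case
    proof (rule tendsto_sandwich[OF _ _ tendsto_const])
      show "\<forall>\<^sub>F n in sequentially. 0 \<le> (LINT x|lborel. norm ((f (x + v n) + g (x + v n)) - (f x + g x)))"
        by simp
      show "\<forall>\<^sub>F n in sequentially. (LINT x|lborel. norm ((f (x + v n) + g (x + v n)) - (f x + g x)))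
         \<le> (LINT x|lborel. norm (f (x + v n) - f x)) + (LINT x|lborel. norm (g (x + v n) - g x))"
      proof (intro always_eventually allI)
        fix n
        have "(LINT x|lborel. norm ((f (x + v n) + g (x + v n)) - (f x + g x))) \<le>
          (LINT x|lborel. norm (f (x + v n) - f x) + norm (g (x + v n) - g x))"
          by (intro integral_mono i3 Bochner_Integration.integrable_add i norm_diff_triangle_ineq)
        then show "(LINT x|lborel. norm ((f (x + v n) + g (x + v n)) - (f x + g x)))
         \<le> (LINT x|lborel. norm (f (x + v n) - f x)) + (LINT x|lborel. norm (g (x + v n) - g x))"
          by (simp add: i)
      qed
      show "(\<lambda>n. (LINT x|lborel. norm (f (x + v n) - f x)) + (LINT x|lborel. norm (g (x + v n) - g x))) \<longlonglongrightarrow> 0"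
        using tendsto_add[OF add(3,4)] by simp
    qed
  next
    case (lim f s)
    have [measurable]: "f \<in> borel_measurable borel" "s k \<in> borel_measurable borel" for k
      using borel_measurable_integrable[OF lim.hyps(1)[of k]] borel_measurable_integrable[OF lim.hyps(4)] by auto
    show ?case
    proof (rule step)
      show "integrable lborel f" by fact
      fix e :: real assume "e > 0"
      have "(\<lambda>k. LINT x|lborel. norm (f x - s k x)) \<longlonglongrightarrow> (LINT (x::'a)|lborel. 0 :: real)"
      proof (rule integral_dominated_convergence[where w="\<lambda>x. 3 * norm (f x)"])
        show "AE x in lborel. (\<lambda>k. norm (f x - s k x)) \<longlonglongrightarrow> 0"
        proof (intro AE_I2)
          fix x
          have "(\<lambda>k. norm (f x - s k x)) \<longlonglongrightarrow> norm (f x - f x)"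
            using lim.hyps(2) by (intro tendsto_intros) auto
          then show "(\<lambda>k. norm (f x - s k x)) \<longlonglongrightarrow> 0" by simp
        qed
        \<comment> \<open>The simple approximants satisfy
          \<open>norm (s k x) \<le> 2 * norm (f x)\<close>, whence the factor 3.\<close>
        show "AE x in lborel. norm (norm (f x - s k x)) \<le> 3 * norm (f x)" for k
        proof (intro AE_I2)
          fix x show "norm (norm (f x - s k x)) \<le> 3 * norm (f x)"
            using lim.hyps(3)[of x k] norm_triangle_ineq4[of "f x" "s k x"] by simp
        qed
      qed (use lim.hyps(4) in auto)
      then have "(\<lambda>k. LINT x|lborel. norm (f x - s k x)) \<longlonglongrightarrow> 0" by simp
      from LIMSEQ_D[OF this \<open>e > 0\<close>] obtain k where "(LINT x|lborel. norm (f x - s k x)) < e"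
        by auto
      then show "\<exists>k. integrable lborel k \<and> (LINT x|lborel. norm (f x - k x)) \<le> e \<and>
        (\<lambda>n. LINT x|lborel. norm (k (x + v n) - k x)) \<longlonglongrightarrow> 0"
        using lim.hyps(1)[of k] lim.IH[of k] by (intro exI[of _ "s k"]) auto
    qed
  }
qed

section \<open>The standard Gaussian and its Fourier transform\<close>

lemma borel_measurable_cis [measurable (raw)]:
  "f \<in> borel_measurable M \<Longrightarrow> (\<lambda>x. cis (f x)) \<in> borel_measurable M"
  unfolding cis_conv_exp by measurable

text \<open>The standard normal density on \<open>'a\<close>. It serves as convergence factor in the
  Plancherel formula, since its Fourier transform is explicit and again a Gaussian.\<close>

definition gauss :: "'a::euclidean_space \<Rightarrow> real" where
  "gauss x = (1 / sqrt (2 * pi)) ^ DIM('a) * exp (- (norm x)\<^sup>2 / 2)"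

lemma gauss_prod: "gauss (x::'a::euclidean_space) = (\<Prod>b\<in>Basis. std_normal_density (x \<bullet> b))"
proof -
  have "(norm x)\<^sup>2 = (\<Sum>b\<in>Basis. (x \<bullet> b)\<^sup>2)"
    by (subst power2_norm_eq_inner, subst euclidean_inner) (simp add: power2_eq_square)
  then have "exp (- (norm x)\<^sup>2 / 2) = (\<Prod>b\<in>Basis. exp (- (x \<bullet> b)\<^sup>2 / 2))"
    by (simp add: exp_sum[symmetric] sum_negf sum_divide_distrib)
  then show ?thesis
    by (simp add: gauss_def std_normal_density_def prod.distrib power_one_over prod_dividef)
qed

lemma gauss_measurable [measurable]: "gauss \<in> borel_measurable borel"
  unfolding gauss_def by measurable

lemma gauss_pos: "0 < gauss x"
  by (simp add: gauss_def)

text \<open>Density and character are both products over the coordinates; in one dimension the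
  integral is the characteristic function of the standard normal distribution.\<close>

lemma gauss_fourier:
  fixes t :: "'a::euclidean_space"
  shows "integrable lborel (\<lambda>x. complex_of_real (gauss x) * cis (x \<bullet> t))"
    and "(LINT x|lborel. complex_of_real (gauss x) * cis (x \<bullet> t)) = exp (- (norm t)\<^sup>2 / 2)"
proof -
  interpret P: product_sigma_finite "\<lambda>b::'a. lborel :: real measure" by standard
  define F where "F = (\<lambda>b y. complex_of_real (std_normal_density y) * cis (y * (t \<bullet> b)))"
  have Fi: "integrable lborel (F b)" for b
  proof (rule Bochner_Integration.integrable_bound[of _ std_normal_density])
    show "integrable lborel std_normal_density" by simp
  qed (auto simp: F_def norm_mult abs_mult)
  have F1: "(LINT y|lborel. F b y) = exp (- (t \<bullet> b)\<^sup>2 / 2)" for b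
  proof -
    have "complex_of_real (exp (- (t \<bullet> b)\<^sup>2 / 2)) = char std_normal_distribution (t \<bullet> b)"
      by (simp add: char_std_normal_distribution)
    also have "\<dots> = (LINT y|lborel. std_normal_density y *\<^sub>R iexp ((t \<bullet> b) * y))"
      unfolding char_def by (rule integral_density) auto
    also have "\<dots> = (LINT y|lborel. F b y)"
      by (simp add: F_def cis_conv_exp scaleR_conv_of_real mult.commute)
    finally show ?thesis by simp
  qed
  have G: "complex_of_real (gauss x) * cis (x \<bullet> t) = (\<Prod>b\<in>Basis. F b (x \<bullet> b))" for x
  proof -
    have "cis (x \<bullet> t) = (\<Prod>b\<in>Basis. cis ((x \<bullet> b) * (t \<bullet> b)))"
      by (subst euclidean_inner) (simp add: cis_conv_exp exp_sum[symmetric] sum_distrib_left)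
    then show ?thesis
      by (simp add: F_def gauss_prod prod.distrib)
  qed
  have inj: "(\<Sum>b'\<in>Basis. f b' *\<^sub>R b') \<bullet> b = f b" if "b \<in> Basis" for b :: 'a and f :: "'a \<Rightarrow> real"
    using that by simp
  have eq: "(\<Prod>b\<in>Basis. F b ((\<Sum>b'\<in>Basis. f b' *\<^sub>R b') \<bullet> b)) = (\<Prod>b\<in>Basis. F b (f b))" for f :: "'a \<Rightarrow> real"
    by (intro prod.cong refl) (simp only: inj)
  have [measurable]: "F b \<in> borel_measurable borel" for b unfolding F_def by measurable
  have m: "(\<lambda>x. \<Prod>b\<in>Basis. F b (x \<bullet> b)) \<in> borel_measurable borel" by measurable
  \<comment> \<open>\<open>lborel\<close> is the image of the product of one-dimensional Lebesgue
    measures under this map, and the product theorems for integrals apply to that product.\<close>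
  have T: "(\<lambda>f. \<Sum>b\<in>(Basis::'a set). f b *\<^sub>R b) \<in> (\<Pi>\<^sub>M b\<in>Basis. lborel) \<rightarrow>\<^sub>M borel" by measurable
  show "integrable lborel (\<lambda>x. complex_of_real (gauss x) * cis (x \<bullet> t))"
    unfolding G by (subst lborel_eq, subst integrable_distr_eq[OF T m])
      (simp only: eq, intro P.product_integrable_prod Fi finite_Basis)
  have "(LINT x|lborel. complex_of_real (gauss x) * cis (x \<bullet> t)) = (\<Prod>b\<in>Basis. (LINT y|lborel. F b y))"
    unfolding G by (subst lborel_eq, subst integral_distr[OF T m])
      (simp only: eq, intro P.product_integral_prod Fi finite_Basis)
  also have "\<dots> = complex_of_real (\<Prod>b\<in>Basis. exp (- (t \<bullet> b)\<^sup>2 / 2))"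
    by (simp add: F1)
  also have "(\<Prod>b\<in>Basis. exp (- (t \<bullet> b)\<^sup>2 / 2)) = exp (- (norm t)\<^sup>2 / 2)"
    by (subst power2_norm_eq_inner, subst euclidean_inner)
      (simp add: exp_sum[symmetric] sum_negf sum_divide_distrib power2_eq_square)
  finally show "(LINT x|lborel. complex_of_real (gauss x) * cis (x \<bullet> t)) = exp (- (norm t)\<^sup>2 / 2)" .
qed

lemma gauss_integrable: "integrable lborel (gauss :: 'a::euclidean_space \<Rightarrow> real)"
  using integrable_norm[OF gauss_fourier(1)[of "0::'a"]] by (simp add: gauss_pos less_imp_le)

lemma gauss_integral: "(LINT x|lborel. gauss (x::'a::euclidean_space)) = 1"
proof -
  have "complex_of_real (LINT x|lborel. gauss (x::'a)) = 1"
    using gauss_fourier(2)[of "0::'a"] by simp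
  then show ?thesis by simp
qed

section \<open>The Plancherel formula\<close>

text \<open>A product majorant supplies the hypothesis of Fubini's theorem for two of the
  interchanges in the proof of \<open>plancherel\<close>.\<close>

lemma integrable_pair_bound:
  fixes f :: "'a::euclidean_space \<Rightarrow> 'b::euclidean_space \<Rightarrow> complex" and a :: "'a \<Rightarrow> real" and b :: "'b \<Rightarrow> real"
  assumes a: "integrable lborel a" and b: "integrable lborel b"
    and [measurable]: "case_prod f \<in> borel_measurable (lborel \<Otimes>\<^sub>M lborel)"
    and bd: "\<And>x y. norm (f x y) \<le> a x * b y"
  shows "integrable (lborel \<Otimes>\<^sub>M lborel) (case_prod f)"
proof (rule Bochner_Integration.integrable_bound)
  have [measurable]: "a \<in> borel_measurable borel" "b \<in> borel_measurable borel"
    using borel_measurable_integrable[OF a] borel_measurable_integrable[OF b] by auto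
  show "integrable (lborel \<Otimes>\<^sub>M lborel) (\<lambda>(x, y). a x * b y)"
  proof (rule lborel_pair.Fubini_integrable)
    show "integrable lborel (\<lambda>x. LINT y|lborel. norm (case (x, y) of (x, y) \<Rightarrow> a x * b y))"
      using a b by (simp add: abs_mult)
    show "AE x in lborel. integrable lborel (\<lambda>y. case (x, y) of (x, y) \<Rightarrow> a x * b y)"
      using b by simp
  qed measurable
  show "AE z in lborel \<Otimes>\<^sub>M lborel. norm (case_prod f z) \<le> norm (case z of (x, y) \<Rightarrow> a x * b y)"
    using bd by (auto intro!: AE_I2 order_trans[OF _ abs_ge_self])
qed measurable

lemma L2_translate: "f \<in> L2 \<Longrightarrow> (\<lambda>x. f (x + t)) \<in> L2"
  using integrable_lborel_translate[of "\<lambda>x. (norm (f x))\<^sup>2" t] by (auto simp: L2_def)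

lemma l2_norm_translate:
  assumes "f \<in> L2"
  shows "l2_norm (\<lambda>x. f (x + t)) = l2_norm f"
proof -
  have [measurable]: "f \<in> borel_measurable borel" using assms by (rule L2_measurable)
  show ?thesis
    unfolding l2_norm_def by (subst integral_lborel_translate[of "\<lambda>x. (norm (f x))\<^sup>2"]) auto
qed

text \<open>The factor that is not translated is truncated to a bounded function, so that continuity of
  translations is needed in \<open>L\<^sup>1\<close> only.\<close>

lemma autocorrelation_continuous:
  fixes g :: "'a::euclidean_space \<Rightarrow> complex"
  assumes g1: "integrable lborel g" and g2: "g \<in> L2" and v: "v \<longlonglongrightarrow> 0"
  shows "(\<lambda>n. l2_inner g (\<lambda>y. g (y + v n))) \<longlonglongrightarrow> l2_inner g g"
proof (rule LIMSEQ_I)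
  fix e :: real assume "0 < e"
  have [measurable]: "g \<in> borel_measurable borel" using g2 by (rule L2_measurable)
  \<comment> \<open>\<open>c k\<close> is bounded by \<open>k\<close> and is paired with the
    estimate in mean; \<open>r k\<close> has small norm and is paired with Cauchy-Schwarz.\<close>
  define c where "c = (\<lambda>k::nat. \<lambda>y. if norm (g y) \<le> k then g y else 0)"
  define r where "r = (\<lambda>k::nat. \<lambda>y. if norm (g y) \<le> k then 0 else g y)"
  have [measurable]: "c k \<in> borel_measurable borel" "r k \<in> borel_measurable borel" for k
    unfolding c_def r_def by measurable
  have cr: "g y = c k y + r k y" for k y by (simp add: c_def r_def)
  have cL: "c k \<in> L2" and rL: "r k \<in> L2" for k
    using L2_sq_integrable[OF g2] unfolding L2_def
    by (auto intro!: Bochner_Integration.integrable_bound[OF L2_sq_integrable[OF g2]] simp: c_def r_def)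
  have "(\<lambda>k. LINT y|lborel. (norm (r k y))\<^sup>2) \<longlonglongrightarrow> (LINT (y::'a)|lborel. 0 :: real)"
  proof (rule integral_dominated_convergence[where w="\<lambda>y. (norm (g y))\<^sup>2"])
    show "AE y in lborel. (\<lambda>k. (norm (r k y))\<^sup>2) \<longlonglongrightarrow> 0"
    proof (intro AE_I2 tendsto_eventually)
      fix y
      obtain k0 :: nat where "norm (g y) \<le> k0" using real_arch_simple by blast
      then show "\<forall>\<^sub>F k in sequentially. (norm (r k y))\<^sup>2 = 0"
        by (intro eventually_sequentiallyI[of k0]) (auto simp: r_def)
    qed
  qed (auto simp: r_def L2_sq_integrable[OF g2])
  then have "(\<lambda>k. l2_norm (r k)) \<longlonglongrightarrow> sqrt 0"
    unfolding l2_norm_def by (intro tendsto_intros) simp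
  then have "(\<lambda>k. l2_norm (r k) * (2 * l2_norm g)) \<longlonglongrightarrow> 0"
    by (auto intro: tendsto_mult_left_zero)
  from LIMSEQ_D[OF this, of "e/2"] \<open>0 < e\<close> obtain k where
    "norm (l2_norm (r k) * (2 * l2_norm g) - 0) < e / 2"
    by (meson half_gt_zero order_refl)
  then have k: "l2_norm (r k) * (2 * l2_norm g) < e / 2" by simp
  have "(\<lambda>n. k * (LINT y|lborel. norm (g (y + v n) - g y))) \<longlonglongrightarrow> real k * 0"
    by (intro tendsto_intros L1_translation_continuous g1 v)
  from LIMSEQ_D[OF this, of "e/2"] \<open>0 < e\<close> obtain n0 where
    n0: "\<And>n. n \<ge> n0 \<Longrightarrow> norm (k * (LINT y|lborel. norm (g (y + v n) - g y))) < e / 2" by auto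
  show "\<exists>no. \<forall>n\<ge>no. norm (l2_inner g (\<lambda>y. g (y + v n)) - l2_inner g g) < e"
  proof (intro exI allI impI)
    fix n assume n: "n \<ge> n0"
    let ?w = "\<lambda>y. g (y + v n) - g y"
    have wL: "?w \<in> L2" by (intro L2_diff L2_translate g2)
    have wi: "integrable lborel ?w" by (intro Bochner_Integration.integrable_diff integrable_lborel_translate g1)
    have "cnj (l2_inner g (\<lambda>y. g (y + v n)) - l2_inner g g) = l2_inner ?w g"
      unfolding l2_inner_diff[OF L2_translate[OF g2] g2 g2] complex_cnj_diff
      by (simp only: l2_inner_commute[symmetric])
    also have "\<dots> = cnj (l2_inner (\<lambda>y. c k y + r k y) ?w)"
      unfolding cr[symmetric] by (rule l2_inner_commute)
    also have "l2_inner (\<lambda>y. c k y + r k y) ?w = l2_inner (c k) ?w + l2_inner (r k) ?w"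
      by (intro l2_inner_add cL rL wL)
    finally have "norm (l2_inner g (\<lambda>y. g (y + v n)) - l2_inner g g) = norm (l2_inner (c k) ?w + l2_inner (r k) ?w)"
      by (metis complex_mod_cnj)
    also have "\<dots> \<le> norm (l2_inner (c k) ?w) + norm (l2_inner (r k) ?w)" by (rule norm_triangle_ineq)
    also have "norm (l2_inner (c k) ?w) \<le> (LINT y|lborel. norm (c k y * cnj (?w y)))"
      unfolding l2_inner_def by (rule integral_norm_bound)
    also have "\<dots> \<le> (LINT y|lborel. k * norm (?w y))"
    proof (rule integral_mono)
      show "integrable lborel (\<lambda>y. norm (c k y * cnj (?w y)))"
        using l2_inner_integrable[OF cL wL] by auto
      show "integrable lborel (\<lambda>y. k * norm (?w y))" using wi by auto
      show "norm (c k y * cnj (?w y)) \<le> k * norm (?w y)" for y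
        unfolding norm_mult complex_mod_cnj by (intro mult_right_mono) (auto simp: c_def)
    qed
    also have "\<dots> = k * (LINT y|lborel. norm (?w y))" by simp
    also have "\<dots> < e / 2" using n0[OF n] by simp
    also have "norm (l2_inner (r k) ?w) \<le> l2_norm (r k) * l2_norm ?w"
      by (rule l2_cauchy_schwarz[OF rL wL])
    also have "\<dots> \<le> l2_norm (r k) * (2 * l2_norm g)"
    proof (intro mult_left_mono l2_norm_nonneg)
      have "l2_norm ?w = l2_norm (\<lambda>y. g (y + v n) + (-1) * g y)" by simp
      also have "\<dots> \<le> l2_norm (\<lambda>y. g (y + v n)) + l2_norm (\<lambda>y. (-1) * g y)"
        by (intro l2_norm_triangle L2_translate g2 L2_scale)
      also have "\<dots> = 2 * l2_norm g" unfolding l2_norm_scale by (simp add: l2_norm_translate g2)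
      finally show "l2_norm ?w \<le> 2 * l2_norm g" .
    qed
    also have "\<dots> < e / 2" by (rule k)
    finally show "norm (l2_inner g (\<lambda>y. g (y + v n)) - l2_inner g g) < e" by simp
  qed
qed

text \<open>The transform of a wide Gaussian is a narrow one of width \<open>e\<close>. Written
  through \<open>gauss\<close>, it is visibly a multiple of the approximate identity that averages
  the autocorrelation near 0.\<close>

lemma gauss_dilated_fourier:
  fixes v :: "'a::euclidean_space"
  assumes "0 < e"
  shows "(LINT x|lborel. complex_of_real (gauss (e *\<^sub>R x)) * cis (x \<bullet> v)) =
    gauss (v /\<^sub>R e) / (e ^ DIM('a) * (1 / sqrt (2 * pi)) ^ DIM('a))"
proof -
  have inn: "(0 + e *\<^sub>R x) \<bullet> (v /\<^sub>R e) = x \<bullet> v" for x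
    using assms by simp
  have "complex_of_real (exp (- (norm (v /\<^sub>R e))\<^sup>2 / 2)) = (LINT x|lborel. complex_of_real (gauss x) * cis (x \<bullet> (v /\<^sub>R e)))"
    by (simp only: gauss_fourier)
  also have "\<dots> = \<bar>e\<bar> ^ DIM('a) *\<^sub>R (LINT x|lborel. complex_of_real (gauss (0 + e *\<^sub>R x)) * cis ((0 + e *\<^sub>R x) \<bullet> (v /\<^sub>R e)))"
    using assms by (intro integral_lborel_affine) auto
  also have "\<dots> = e ^ DIM('a) * (LINT x|lborel. complex_of_real (gauss (e *\<^sub>R x)) * cis (x \<bullet> v))"
    using assms unfolding inn by (simp add: scaleR_conv_of_real)
  finally show ?thesis
    using assms by (simp add: gauss_def field_simps)
qed

text \<open>The factor \<open>gauss (e *\<^sub>R w)\<close> makes the frequency integral absolutely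
  convergent, and Fubini's theorem turns it into a Gaussian average of the autocorrelation
  \<open>R\<close> at distances of order \<open>e\<close>. As \<open>e\<close> tends to 0, this
  average tends to \<open>R 0\<close>, the squared norm.\<close>

theorem plancherel:
  fixes g :: "'a::euclidean_space \<Rightarrow> complex"
  assumes g1: "integrable lborel g" and g2: "g \<in> L2"
  shows "(\<integral>\<^sup>+w. ennreal ((norm (LINT y|lborel. g y * cis (- (w \<bullet> y))))\<^sup>2) \<partial>lborel) =
    ennreal ((2 * pi) ^ DIM('a) * (l2_norm g)\<^sup>2)"
proof -
  have gm[measurable]: "g \<in> borel_measurable borel" using g2 by (rule L2_measurable)
  define G where "G = (\<lambda>w. LINT y|lborel. g y * cis (- (w \<bullet> y)))"
  have Gw: "(LINT y|lborel. g y * cis (- (w \<bullet> y))) = G w" for w by (simp add: G_def)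
  define A where "A = (LINT y|lborel. norm (g y))"
  define c0 where "c0 = (1 / sqrt (2 * pi)) ^ DIM('a)"
  have c0: "c0 > 0" by (simp add: c0_def)
  have Gm[measurable]: "G \<in> borel_measurable borel" unfolding G_def by measurable
  have GA: "norm (G w) \<le> A" for w
  proof -
    have "norm (G w) \<le> (LINT y|lborel. norm (g y * cis (- (w \<bullet> y))))"
      unfolding G_def by (rule integral_norm_bound)
    then show ?thesis by (simp add: norm_mult A_def)
  qed
  have A0: "0 \<le> A" by (simp add: A_def)
  have gi: "integrable lborel (\<lambda>w::'a. gauss (e *\<^sub>R w))" if "e > 0" for e
    using integrable_lborel_affine[OF gauss_integrable, of e 0] that by simp
  have ni: "integrable lborel (\<lambda>y. norm (g y))" using g1 by simp
  define R where "R = (\<lambda>v. l2_inner g (\<lambda>y. g (y + v)))"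
  have Rm[measurable]: "R \<in> borel_measurable borel" unfolding R_def l2_inner_def by measurable
  have Rb: "norm (R v) \<le> (l2_norm g)\<^sup>2" for v
    unfolding R_def power2_eq_square
    using l2_cauchy_schwarz[OF g2 L2_translate[OF g2, of v]] by (simp add: l2_norm_translate g2)
  have key: "complex_of_real (c0 * (LINT w|lborel. gauss (e *\<^sub>R w) * (norm (G w))\<^sup>2)) =
      (LINT u|lborel. gauss u * R (e *\<^sub>R u))" if e: "e > 0" for e
  proof -
    have "complex_of_real (LINT w|lborel. gauss (e *\<^sub>R w) * (norm (G w))\<^sup>2) =
       (LINT w|lborel. complex_of_real (gauss (e *\<^sub>R w) * (norm (G w))\<^sup>2))"
      by (rule integral_complex_of_real[symmetric])
    also have "\<dots> = (LINT w|lborel. complex_of_real (gauss (e *\<^sub>R w)) * cnj (G w) * (LINT y|lborel. g y * cis (- (w \<bullet> y))))"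
      by (intro Bochner_Integration.integral_cong refl, unfold Gw of_real_mult complex_norm_square)
         (simp only: mult.assoc mult.commute[of "G _"])
    also have "\<dots> = (LINT w|lborel. LINT y|lborel. complex_of_real (gauss (e *\<^sub>R w)) * cnj (G w) * (g y * cis (- (w \<bullet> y))))"
      by simp
    also have "\<dots> = (LINT y|lborel. LINT w|lborel. complex_of_real (gauss (e *\<^sub>R w)) * cnj (G w) * (g y * cis (- (w \<bullet> y))))"
    proof (rule lborel_pair.Fubini_integral[symmetric])
      show "integrable (lborel \<Otimes>\<^sub>M lborel) (\<lambda>(w, y). complex_of_real (gauss (e *\<^sub>R w)) * cnj (G w) * (g y * cis (- (w \<bullet> y))))"
      proof (rule integrable_pair_bound[of "\<lambda>w. A * gauss (e *\<^sub>R w)" "\<lambda>y. norm (g y)"])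
        show "norm (complex_of_real (gauss (e *\<^sub>R w)) * cnj (G w) * (g y * cis (- (w \<bullet> y)))) \<le> A * gauss (e *\<^sub>R w) * norm (g y)" for w y
          using mult_right_mono[OF GA[of w], of "gauss (e *\<^sub>R w) * norm (g y)"]
          by (simp add: norm_mult gauss_pos less_imp_le mult_ac)
      qed (use gi[OF e] ni in auto)
    qed
    also have "\<dots> = (LINT y|lborel. g y * ((1 / complex_of_real c0) * (LINT u|lborel. gauss u * cnj (g (y + e *\<^sub>R u)))))"
    proof (intro Bochner_Integration.integral_cong refl)
      fix y
      have cnjG: "cnj (G w) = (LINT y'|lborel. cnj (g y') * cis (w \<bullet> y'))" for w
        unfolding G_def by (subst Bochner_Integration.integral_cnj[symmetric]) (simp add: cis_cnj)
      have "(LINT w|lborel. complex_of_real (gauss (e *\<^sub>R w)) * cnj (G w) * (g y * cis (- (w \<bullet> y)))) =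
         (LINT w|lborel. g y * (complex_of_real (gauss (e *\<^sub>R w)) * cnj (G w) * cis (- (w \<bullet> y))))"
        by (simp add: mult_ac)
      also have "\<dots> = g y * (LINT w|lborel. complex_of_real (gauss (e *\<^sub>R w)) * cnj (G w) * cis (- (w \<bullet> y)))"
        by (rule integral_mult_right_zero)
      also have "(LINT w|lborel. complex_of_real (gauss (e *\<^sub>R w)) * cnj (G w) * cis (- (w \<bullet> y))) =
         (LINT w|lborel. LINT y'|lborel. cnj (g y') * (complex_of_real (gauss (e *\<^sub>R w)) * cis (w \<bullet> (y' - y))))"
      proof (intro Bochner_Integration.integral_cong refl)
        fix w
        have "complex_of_real (gauss (e *\<^sub>R w)) * cnj (G w) * cis (- (w \<bullet> y)) =
          (complex_of_real (gauss (e *\<^sub>R w)) * cis (- (w \<bullet> y))) * (LINT y'|lborel. cnj (g y') * cis (w \<bullet> y'))"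
          by (simp add: cnjG mult_ac)
        also have "\<dots> = (LINT y'|lborel. (complex_of_real (gauss (e *\<^sub>R w)) * cis (- (w \<bullet> y))) * (cnj (g y') * cis (w \<bullet> y')))"
          by (rule integral_mult_right_zero[symmetric])
        also have "\<dots> = (LINT y'|lborel. cnj (g y') * (complex_of_real (gauss (e *\<^sub>R w)) * cis (w \<bullet> (y' - y))))"
        proof (intro Bochner_Integration.integral_cong refl)
          fix y'
          have "cis (w \<bullet> (y' - y)) = cis (- (w \<bullet> y)) * cis (w \<bullet> y')"
            by (simp add: cis_mult inner_diff_right)
          then show "(complex_of_real (gauss (e *\<^sub>R w)) * cis (- (w \<bullet> y))) * (cnj (g y') * cis (w \<bullet> y'))
             = cnj (g y') * (complex_of_real (gauss (e *\<^sub>R w)) * cis (w \<bullet> (y' - y)))"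
            by (simp only: mult_ac)
        qed
        finally show "complex_of_real (gauss (e *\<^sub>R w)) * cnj (G w) * cis (- (w \<bullet> y)) =
          (LINT y'|lborel. cnj (g y') * (complex_of_real (gauss (e *\<^sub>R w)) * cis (w \<bullet> (y' - y))))" .
      qed
      also have "\<dots> = (LINT y'|lborel. LINT w|lborel. cnj (g y') * (complex_of_real (gauss (e *\<^sub>R w)) * cis (w \<bullet> (y' - y))))"
      proof (rule lborel_pair.Fubini_integral[symmetric])
        show "integrable (lborel \<Otimes>\<^sub>M lborel) (\<lambda>(w, y'). cnj (g y') * (complex_of_real (gauss (e *\<^sub>R w)) * cis (w \<bullet> (y' - y))))"
        proof (rule integrable_pair_bound[of "\<lambda>w. gauss (e *\<^sub>R w)" "\<lambda>y. norm (g y)"])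
          show "norm (cnj (g y') * (complex_of_real (gauss (e *\<^sub>R w)) * cis (w \<bullet> (y' - y)))) \<le> gauss (e *\<^sub>R w) * norm (g y')" for w y'
            by (simp add: norm_mult gauss_pos less_imp_le mult_ac)
        qed (use gi[OF e] ni in auto)
      qed
      also have "\<dots> = (LINT y'|lborel. cnj (g y') * (gauss ((y' - y) /\<^sub>R e) / (e ^ DIM('a) * c0)))"
        unfolding c0_def by (simp add: gauss_dilated_fourier e)
      \<comment> \<open>The substitution \<open>y' = y + e *\<^sub>R u\<close> absorbs
        \<open>e ^ DIM('a)\<close> and brings the Gaussian back to unit scale.\<close>
      also have "\<dots> = \<bar>e\<bar> ^ DIM('a) *\<^sub>R (LINT u|lborel. cnj (g (y + e *\<^sub>R u)) * (gauss ((y + e *\<^sub>R u - y) /\<^sub>R e) / (e ^ DIM('a) * c0)))"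
        using e by (intro integral_lborel_affine) auto
      also have "\<dots> = (LINT u|lborel. (1 / complex_of_real c0) * (gauss u * cnj (g (y + e *\<^sub>R u))))"
        using e c0 by (subst integral_scaleR_right[symmetric])
          (intro Bochner_Integration.integral_cong refl, simp add: scaleR_conv_of_real field_simps)
      also have "\<dots> = (1 / complex_of_real c0) * (LINT u|lborel. gauss u * cnj (g (y + e *\<^sub>R u)))"
        by (rule integral_mult_right_zero)
      finally show "(LINT w|lborel. complex_of_real (gauss (e *\<^sub>R w)) * cnj (G w) * (g y * cis (- (w \<bullet> y)))) =
         g y * ((1 / complex_of_real c0) * (LINT u|lborel. gauss u * cnj (g (y + e *\<^sub>R u))))" by simp
    qed
    also have "\<dots> = (LINT y|lborel. LINT u|lborel. (1 / complex_of_real c0) * (gauss u * (g y * cnj (g (y + e *\<^sub>R u)))))"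
      by (simp add: mult_ac flip: integral_mult_right_zero)
    also have "\<dots> = (LINT u|lborel. LINT y|lborel. (1 / complex_of_real c0) * (gauss u * (g y * cnj (g (y + e *\<^sub>R u)))))"
    proof (rule lborel_pair.Fubini_integral)
      show "integrable (lborel \<Otimes>\<^sub>M lborel) (\<lambda>(u, y). (1 / complex_of_real c0) * (gauss u * (g y * cnj (g (y + e *\<^sub>R u)))))"
      \<comment> \<open>The translate of \<open>g\<close> couples \<open>u\<close> and
        \<open>y\<close>, so no product majorant is at hand. Instead Cauchy-Schwarz bounds the
        integral over \<open>y\<close> by \<open>(l2_norm g)\<^sup>2\<close> for every
        \<open>u\<close>, and \<open>gauss\<close> is integrable in \<open>u\<close>.\<close>
      proof (rule lborel_pair.Fubini_integrable)
        have gL: "integrable lborel (\<lambda>y. norm (g y) * norm (g (y + e *\<^sub>R u)))" for u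
          using integrable_norm[OF l2_inner_integrable[OF g2 L2_translate[OF g2, of "e *\<^sub>R u"]]]
          by (simp add: norm_mult)
        have 1: "(LINT y|lborel. norm ((1 / complex_of_real c0) * (gauss u * (g y * cnj (g (y + e *\<^sub>R u)))))) =
           (1 / c0) * gauss u * (LINT y|lborel. norm (g y) * norm (g (y + e *\<^sub>R u)))" for u
          using c0 by (subst integral_mult_right_zero[symmetric]) (simp add: norm_mult norm_divide gauss_pos less_imp_le mult_ac)
        have 2: "(LINT y|lborel. norm (g y) * norm (g (y + e *\<^sub>R u))) \<le> (l2_norm g)\<^sup>2" for u
        proof -
          have nL: "(\<lambda>y. complex_of_real (norm (f y))) \<in> L2" "l2_norm (\<lambda>y. complex_of_real (norm (f y))) = l2_norm f"
            if "f \<in> L2" for f :: "'a \<Rightarrow> complex" using that by (auto simp: L2_def l2_norm_def)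
          have "l2_inner (\<lambda>y. complex_of_real (norm (g y))) (\<lambda>y. complex_of_real (norm (g (y + e *\<^sub>R u)))) =
             complex_of_real (LINT y|lborel. norm (g y) * norm (g (y + e *\<^sub>R u)))"
            unfolding l2_inner_def complex_cnj_complex_of_real of_real_mult[symmetric] by (rule integral_complex_of_real)
          then have "norm (complex_of_real (LINT y|lborel. norm (g y) * norm (g (y + e *\<^sub>R u)))) \<le> l2_norm g * l2_norm g"
            using l2_cauchy_schwarz[OF nL(1)[OF g2] nL(1)[OF L2_translate[OF g2, of "e *\<^sub>R u"]]]
            unfolding nL(2)[OF g2] nL(2)[OF L2_translate[OF g2, of "e *\<^sub>R u"]] l2_norm_translate[OF g2] by simp
          then show ?thesis by (simp add: power2_eq_square)
        qed
        show "integrable lborel (\<lambda>u. LINT y|lborel. norm (case (u, y) of (u, y) \<Rightarrow> (1 / complex_of_real c0) * (gauss u * (g y * cnj (g (y + e *\<^sub>R u))))))"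
          unfolding prod.case 1
        proof (rule Bochner_Integration.integrable_bound)
          show "integrable lborel (\<lambda>u::'a. (1 / c0) * (l2_norm g)\<^sup>2 * gauss u)"
            by (intro integrable_mult_right gauss_integrable)
          show "AE u in lborel. norm ((1 / c0) * gauss u * (LINT y|lborel. norm (g y) * norm (g (y + e *\<^sub>R u))))
             \<le> norm ((1 / c0) * (l2_norm g)\<^sup>2 * gauss u)"
          proof (intro AE_I2)
            fix u :: 'a
            show "norm ((1 / c0) * gauss u * (LINT y|lborel. norm (g y) * norm (g (y + e *\<^sub>R u)))) \<le> norm ((1 / c0) * (l2_norm g)\<^sup>2 * gauss u)"
              using c0 mult_left_mono[OF 2[of u], of "gauss u"] by (simp add: norm_mult gauss_pos less_imp_le divide_right_mono mult_ac)
          qed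
        qed measurable
        show "AE u in lborel. integrable lborel (\<lambda>y. case (u, y) of (u, y) \<Rightarrow> (1 / complex_of_real c0) * (gauss u * (g y * cnj (g (y + e *\<^sub>R u)))))"
        proof (intro AE_I2)
          fix u
          show "integrable lborel (\<lambda>y. case (u, y) of (u, y) \<Rightarrow> (1 / complex_of_real c0) * (gauss u * (g y * cnj (g (y + e *\<^sub>R u)))))"
            unfolding prod.case
            by (intro integrable_mult_right l2_inner_integrable[OF g2 L2_translate[OF g2]])
        qed
      qed measurable
    qed
    also have "\<dots> = (LINT u|lborel. (1 / complex_of_real c0) * (gauss u * R (e *\<^sub>R u)))"
      unfolding R_def l2_inner_def by (simp only: integral_mult_right_zero)
    also have "\<dots> = (1 / complex_of_real c0) * (LINT u|lborel. gauss u * R (e *\<^sub>R u))"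
      by (rule integral_mult_right_zero)
    finally show ?thesis using c0 by simp
  qed
  define e where "e = (\<lambda>n::nat. 1 / real (Suc n))"
  have e0: "e n > 0" for n by (simp add: e_def)
  have elim: "e \<longlonglongrightarrow> 0" unfolding e_def by (rule LIMSEQ_Suc[OF lim_1_over_n])
  define J where "J = (\<lambda>n. LINT w|lborel. gauss (e n *\<^sub>R w) * (norm (G w))\<^sup>2)"
  have "(\<lambda>n. LINT u|lborel. gauss u * R (e n *\<^sub>R u)) \<longlonglongrightarrow> (LINT (u::'a)|lborel. complex_of_real (gauss u) * R 0)"
  proof (rule integral_dominated_convergence[where w="\<lambda>u. gauss u * (l2_norm g)\<^sup>2"])
    show "AE u in lborel. (\<lambda>n. complex_of_real (gauss u) * R (e n *\<^sub>R u)) \<longlonglongrightarrow> complex_of_real (gauss u) * R 0"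
    proof (intro AE_I2)
      fix u :: 'a
      have "(\<lambda>n. e n *\<^sub>R u) \<longlonglongrightarrow> 0 *\<^sub>R u" by (intro tendsto_intros elim)
      then have "(\<lambda>n. R (e n *\<^sub>R u)) \<longlonglongrightarrow> R 0"
        using autocorrelation_continuous[OF g1 g2, of "\<lambda>n. e n *\<^sub>R u"] by (simp add: R_def)
      then show "(\<lambda>n. complex_of_real (gauss u) * R (e n *\<^sub>R u)) \<longlonglongrightarrow> complex_of_real (gauss u) * R 0"
        by (intro tendsto_intros)
    qed
    show "AE u in lborel. norm (complex_of_real (gauss u) * R (e n *\<^sub>R u)) \<le> gauss u * (l2_norm g)\<^sup>2" for n
      using Rb by (intro AE_I2) (simp add: norm_mult gauss_pos less_imp_le mult_left_mono)
    show "integrable lborel (\<lambda>u::'a. gauss u * (l2_norm g)\<^sup>2)"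
      by (intro integrable_mult_left gauss_integrable)
  qed measurable
  also have "(LINT u|lborel. complex_of_real (gauss (u::'a)) * R 0) = complex_of_real ((l2_norm g)\<^sup>2)"
  proof -
    have "(LINT u|lborel. complex_of_real (gauss (u::'a)) * R 0) = (LINT u|lborel. complex_of_real (gauss (u::'a))) * R 0"
      by (rule integral_mult_left_zero)
    also have "(LINT u|lborel. complex_of_real (gauss (u::'a))) = complex_of_real 1"
      by (subst integral_complex_of_real) (simp only: gauss_integral)
    finally show ?thesis by (simp add: R_def l2_inner_self)
  qed
  finally have "(\<lambda>n. complex_of_real (c0 * J n)) \<longlonglongrightarrow> complex_of_real ((l2_norm g)\<^sup>2)"
    unfolding J_def key[OF e0] .
  then have "(\<lambda>n. c0 * J n) \<longlonglongrightarrow> (l2_norm g)\<^sup>2"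
    by (subst (asm) tendsto_of_real_iff)
  then have "(\<lambda>n. ennreal (c0 * J n)) \<longlonglongrightarrow> ennreal ((l2_norm g)\<^sup>2)"
    by (rule tendsto_ennrealI)
  \<comment> \<open>Monotone instead of dominated convergence, since finiteness of the integral of
    \<open>(norm (G w))\<^sup>2\<close> is part of the claim; the convergence factor increases with
    \<open>n\<close>.\<close>
  moreover have "(\<lambda>n. ennreal (c0 * J n)) \<longlonglongrightarrow> (\<integral>\<^sup>+w. ennreal (c0\<^sup>2 * (norm (G w))\<^sup>2) \<partial>lborel)"
  proof -
    have eq: "ennreal (c0 * J n) = (\<integral>\<^sup>+w. ennreal (c0 * (gauss (e n *\<^sub>R w) * (norm (G w))\<^sup>2)) \<partial>lborel)" for n
    proof -
      have i: "integrable lborel (\<lambda>w. c0 * (gauss (e n *\<^sub>R w) * (norm (G w))\<^sup>2))"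
      proof (rule Bochner_Integration.integrable_bound)
        show "integrable lborel (\<lambda>w::'a. c0 * A\<^sup>2 * gauss (e n *\<^sub>R w))" using gi[OF e0] by simp
        show "AE w in lborel. norm (c0 * (gauss (e n *\<^sub>R w) * (norm (G w))\<^sup>2)) \<le> norm (c0 * A\<^sup>2 * gauss (e n *\<^sub>R w))"
        proof (intro AE_I2)
          fix w
          have "(norm (G w))\<^sup>2 \<le> A\<^sup>2" by (intro power_mono GA) simp
          from mult_left_mono[OF this, of "c0 * gauss (e n *\<^sub>R w)"]
          show "norm (c0 * (gauss (e n *\<^sub>R w) * (norm (G w))\<^sup>2)) \<le> norm (c0 * A\<^sup>2 * gauss (e n *\<^sub>R w))"
            using c0 by (simp add: norm_mult gauss_pos less_imp_le mult_ac)
        qed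
      qed measurable
      have "c0 * J n = (LINT w|lborel. c0 * (gauss (e n *\<^sub>R w) * (norm (G w))\<^sup>2))"
        by (simp add: J_def)
      then show ?thesis
        using c0 by (simp only:) (rule nn_integral_eq_integral[OF i, symmetric], auto simp: gauss_pos less_imp_le)
    qed
    show ?thesis
      unfolding eq
    proof (rule nn_integral_LIMSEQ)
      have mono: "gauss (e m *\<^sub>R w) \<le> gauss (e n *\<^sub>R w)" if "m \<le> n" for m n and w :: 'a
      proof -
        have "e n \<le> e m" using that by (simp add: e_def divide_left_mono)
        then have "e n * norm w \<le> e m * norm w" by (intro mult_right_mono) auto
        then have "(norm (e n *\<^sub>R w))\<^sup>2 \<le> (norm (e m *\<^sub>R w))\<^sup>2"
          using e0[of n] e0[of m] by (intro power_mono) auto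
        then show ?thesis by (simp add: gauss_def mult_left_mono del: norm_scaleR)
      qed
      show "incseq (\<lambda>n w. ennreal (c0 * (gauss (e n *\<^sub>R w) * (norm (G w))\<^sup>2)))"
        using c0 by (auto simp: incseq_def le_fun_def intro!: ennreal_leI mult_left_mono mult_right_mono mono)
      show "(\<lambda>n. ennreal (c0 * (gauss (e n *\<^sub>R w) * (norm (G w))\<^sup>2))) \<longlonglongrightarrow> ennreal (c0\<^sup>2 * (norm (G w))\<^sup>2)" for w
      proof -
        have "(\<lambda>n. c0 * (gauss (e n *\<^sub>R w) * (norm (G w))\<^sup>2)) \<longlonglongrightarrow> c0 * ((c0 * exp (- (norm (0 *\<^sub>R w))\<^sup>2 / 2)) * (norm (G w))\<^sup>2)"
          unfolding gauss_def c0_def[symmetric] by (intro tendsto_intros elim) auto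
        then have "(\<lambda>n. c0 * (gauss (e n *\<^sub>R w) * (norm (G w))\<^sup>2)) \<longlonglongrightarrow> c0\<^sup>2 * (norm (G w))\<^sup>2"
          by (simp add: power2_eq_square mult.assoc)
        then show ?thesis by (rule tendsto_ennrealI)
      qed
    qed measurable
  qed
  \<comment> \<open>One factor \<open>c0\<close> comes from \<open>key\<close>, the other is the
    value of \<open>gauss\<close> at 0, the limit of the convergence factor.\<close>
  ultimately have "ennreal ((l2_norm g)\<^sup>2) = (\<integral>\<^sup>+w. ennreal (c0\<^sup>2 * (norm (G w))\<^sup>2) \<partial>lborel)"
    by (rule LIMSEQ_unique)
  also have "\<dots> = ennreal (c0\<^sup>2) * (\<integral>\<^sup>+w. ennreal ((norm (G w))\<^sup>2) \<partial>lborel)"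
    by (subst nn_integral_cmult[symmetric]) (simp_all add: ennreal_mult)
  finally have *: "ennreal ((2 * pi) ^ DIM('a)) * ennreal ((l2_norm g)\<^sup>2) =
     (ennreal ((2 * pi) ^ DIM('a)) * ennreal (c0\<^sup>2)) * (\<integral>\<^sup>+w. ennreal ((norm (G w))\<^sup>2) \<partial>lborel)"
    by (simp only: mult.assoc)
  have "c0\<^sup>2 = ((1 / sqrt (2 * pi))\<^sup>2) ^ DIM('a)"
    unfolding c0_def by (metis power_mult mult.commute)
  also have "(1 / sqrt (2 * pi))\<^sup>2 = 1 / (2 * pi)" by (simp add: power_divide)
  finally have "(2 * pi) ^ DIM('a) * c0\<^sup>2 = (2 * pi * (1 / (2 * pi))) ^ DIM('a)"
    by (simp only: power_mult_distrib)
  also have "\<dots> = 1" by simp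
  finally have "ennreal ((2 * pi) ^ DIM('a)) * ennreal (c0\<^sup>2) = 1"
    by (subst ennreal_mult[symmetric]) simp_all
  then have "(\<integral>\<^sup>+w. ennreal ((norm (G w))\<^sup>2) \<partial>lborel) = ennreal ((2 * pi) ^ DIM('a)) * ennreal ((l2_norm g)\<^sup>2)"
    unfolding * by (simp only: mult_1_left)
  also have "\<dots> = ennreal ((2 * pi) ^ DIM('a) * (l2_norm g)\<^sup>2)"
    by (rule ennreal_mult[symmetric]) simp_all
  finally show ?thesis unfolding G_def .
qed

section \<open>Schwartz functions and their ambiguity functions\<close>

lemma partials_Nil [simp]: "partials [] f = f"
  by (simp add: partials_def)

lemma partials_Cons: "partials (b # bs) f = dir_deriv b (partials bs f)"
  by (simp add: partials_def)

lemma partials_dir_deriv: "partials bs (dir_deriv b f) = partials (bs @ [b]) f"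
  by (simp add: partials_def)

lemma has_vector_derivative_line:
  fixes f :: "'a::euclidean_space \<Rightarrow> 'b::real_normed_vector"
  assumes "(f has_derivative f') (at (x + t *\<^sub>R v))"
  shows "((\<lambda>s. f (x + s *\<^sub>R v)) has_vector_derivative f' v) (at t)"
proof -
  have "((\<lambda>s. x + s *\<^sub>R v) has_derivative (\<lambda>s. s *\<^sub>R v)) (at t)"
    by (auto intro!: derivative_eq_intros)
  from diff_chain_at[OF this assms]
  have "((\<lambda>s. f (x + s *\<^sub>R v)) has_derivative (\<lambda>s. f' (s *\<^sub>R v))) (at t)"
    by (simp add: o_def)
  moreover have "f' (s *\<^sub>R v) = s *\<^sub>R f' v" for s
    using assms by (simp add: has_derivative_linear linear_cmul)
  ultimately show ?thesis by (simp add: has_vector_derivative_def)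
qed

lemma has_vector_derivative_quotient:
  fixes f :: "real \<Rightarrow> 'b::real_normed_vector"
  assumes "(f has_vector_derivative d) (at 0)"
  shows "((\<lambda>s. (f s - f 0) /\<^sub>R s) \<longlongrightarrow> d) (at 0)"
proof -
  have "((\<lambda>s. norm (f (0 + s) - f 0 - s *\<^sub>R d) / norm s) \<longlongrightarrow> 0) (at 0)"
    using assms unfolding has_vector_derivative_def has_derivative_at by blast
  moreover have "\<forall>\<^sub>F s in at 0. norm (f (0 + s) - f 0 - s *\<^sub>R d) / norm s = norm ((f s - f 0) /\<^sub>R s - d)"
    unfolding eventually_at_filter
  proof (intro always_eventually allI impI)
    fix s :: real assume "s \<noteq> 0"
    then have "(f s - f 0) /\<^sub>R s - d = (f (0 + s) - f 0 - s *\<^sub>R d) /\<^sub>R s"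
      by (simp add: scaleR_diff_right)
    then show "norm (f (0 + s) - f 0 - s *\<^sub>R d) / norm s = norm ((f s - f 0) /\<^sub>R s - d)"
      by (simp add: divide_inverse_commute)
  qed
  ultimately have "((\<lambda>s. norm ((f s - f 0) /\<^sub>R s - d)) \<longlongrightarrow> 0) (at 0)"
    by (rule Lim_transform_eventually)
  then show ?thesis
    by (simp only: tendsto_norm_zero_iff flip: Lim_null)
qed

lemma dir_deriv_eq:
  assumes "(f has_derivative f') (at x)"
  shows "dir_deriv v f x = f' v"
  unfolding dir_deriv_def
  by (rule vector_derivative_at) (use has_vector_derivative_line[of f f' x 0 v] assms in simp)

lemma dir_deriv_line:
  assumes "f differentiable (at (x + t *\<^sub>R v))"
  shows "((\<lambda>s. f (x + s *\<^sub>R v)) has_vector_derivative dir_deriv v f (x + t *\<^sub>R v)) (at t)"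
  using assms has_vector_derivative_line[of f _ x t v] dir_deriv_eq[of f _ "x + t *\<^sub>R v" v]
  unfolding differentiable_def by metis

lemma dir_deriv_basis:
  assumes "f differentiable (at x)"
  shows "dir_deriv v f x = (\<Sum>b\<in>Basis. (v \<bullet> b) *\<^sub>R dir_deriv b f x)"
proof -
  obtain f' where f': "(f has_derivative f') (at x)" using assms by (auto simp: differentiable_def)
  then have "linear f'" by (rule has_derivative_linear)
  then have "f' v = (\<Sum>b\<in>Basis. (v \<bullet> b) *\<^sub>R f' b)"
    by (subst euclidean_representation[of v, symmetric]) (simp add: linear_sum linear_cmul)
  then show ?thesis by (simp add: dir_deriv_eq[OF f'])
qed

lemma smooth_partials_differentiable: "smooth f \<Longrightarrow> set bs \<subseteq> Basis \<Longrightarrow> partials bs f differentiable (at x)"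
  by (simp add: smooth_def)

lemma smooth_differentiable: "smooth f \<Longrightarrow> f differentiable (at x)"
  using smooth_partials_differentiable[of f "[]"] by simp

lemma smooth_continuous: "smooth f \<Longrightarrow> continuous_on S f"
  using smooth_differentiable by (metis continuous_at_imp_continuous_on differentiable_imp_continuous_within)

lemma schwartz_smooth: "f \<in> schwartz \<Longrightarrow> smooth f"
  by (simp add: schwartz_def)

lemma schwartz_measurable: "f \<in> schwartz \<Longrightarrow> f \<in> borel_measurable borel"
  by (intro borel_measurable_continuous_onI smooth_continuous schwartz_smooth)

lemma schwartz_dir_deriv: "f \<in> schwartz \<Longrightarrow> b \<in> Basis \<Longrightarrow> dir_deriv b f \<in> schwartz"
  unfolding schwartz_def smooth_def by (auto simp: partials_dir_deriv)

lemma power_one_plus_le: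
  fixes t :: real
  assumes "0 \<le> t"
  shows "(1 + t) ^ k \<le> 2 ^ k * (1 + t ^ k)"
proof -
  have "(1 + t) ^ k \<le> (2 * max 1 t) ^ k" using assms by (intro power_mono) auto
  also have "\<dots> = 2 ^ k * (max 1 t) ^ k" by (rule power_mult_distrib)
  also have "(max 1 t) ^ k \<le> 1 + t ^ k" using assms by (auto simp: max_def)
  finally show ?thesis by simp
qed

lemma schwartz_decay:
  assumes "f \<in> schwartz"
  obtains C where "0 \<le> C" and "\<And>x. norm (f x) \<le> C / (1 + norm x) ^ k"
proof -
  have "bdd_above (range (\<lambda>x. norm x ^ j * norm (f x)))" for j
    using assms unfolding schwartz_def by (auto dest!: spec[of _ "[]"])
  then obtain B where B: "\<And>j x. norm x ^ j * norm (f x) \<le> B j"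
    unfolding bdd_above_def by (auto, metis)
  define C where "C = 2 ^ k * (B 0 + B k)"
  have le: "norm (f x) \<le> C / (1 + norm x) ^ k" for x
  proof -
    have "(1 + norm x) ^ k * norm (f x) \<le> (2 ^ k * (1 + norm x ^ k)) * norm (f x)"
      by (intro mult_right_mono power_one_plus_le) auto
    also have "\<dots> = 2 ^ k * (norm x ^ 0 * norm (f x) + norm x ^ k * norm (f x))" by (simp add: algebra_simps)
    also have "\<dots> \<le> C" unfolding C_def by (intro mult_left_mono add_mono B) auto
    finally show ?thesis by (simp add: pos_le_divide_eq add_pos_nonneg mult.commute)
  qed
  have "0 \<le> C" using order_trans[OF norm_ge_zero le[of 0]] by simp
  then show ?thesis using le by (rule that)
qed

lemma one_plus_norm_le:
  "1 + norm (x + y) \<le> (1 + norm x) * (1 + norm y)"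
proof -
  have "1 + norm (x + y) \<le> 1 + norm x + norm y" using norm_triangle_ineq[of x y] by simp
  also have "\<dots> \<le> (1 + norm x) * (1 + norm y)" by (simp add: algebra_simps)
  finally show ?thesis .
qed

text \<open>Peetre's inequality. It moves the centre of a polynomial weight at the price of the same
  power of the displacement.\<close>

lemma inverse_power_norm_shift:
  "1 / (1 + norm (x :: 'a::real_normed_vector)) ^ k \<le> (1 + norm y) ^ k / (1 + norm (x + y)) ^ k"
proof -
  have "(1 + norm (x + y)) ^ k \<le> (1 + norm x) ^ k * (1 + norm y) ^ k"
    unfolding power_mult_distrib[symmetric] by (intro power_mono one_plus_norm_le) auto
  then show ?thesis by (simp add: divide_simps add_pos_nonneg zero_less_power mult.commute)
qed

lemma schwartz_L2:
  fixes f :: "'a::euclidean_space \<Rightarrow> complex"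
  assumes "f \<in> schwartz"
  shows "f \<in> L2"
proof -
  obtain C where C: "0 \<le> C" "\<And>x. norm (f x) \<le> C / (1 + norm x) ^ DIM('a)"
    using schwartz_decay[OF assms, of "DIM('a)"] by metis
  have [measurable]: "f \<in> borel_measurable borel" using assms by (rule schwartz_measurable)
  have "integrable lborel (\<lambda>x. (norm (f x))\<^sup>2)"
  proof (rule Bochner_Integration.integrable_bound)
    show "integrable lborel (\<lambda>x::'a. C\<^sup>2 * (1 / (1 + norm x) ^ (2 * DIM('a))))"
      by (intro integrable_mult_right integrable_inverse_power_norm) auto
    show "AE x in lborel. norm ((norm (f x))\<^sup>2) \<le> norm (C\<^sup>2 * (1 / (1 + norm x) ^ (2 * DIM('a))))"
    proof (intro AE_I2)
      fix x
      have "(norm (f x))\<^sup>2 \<le> (C / (1 + norm x) ^ DIM('a))\<^sup>2" by (intro power_mono C) auto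
      then show "norm ((norm (f x))\<^sup>2) \<le> norm (C\<^sup>2 * (1 / (1 + norm x) ^ (2 * DIM('a))))"
        by (simp add: power_divide power_mult[symmetric] mult.commute[of _ 2])
    qed
  qed measurable
  then show ?thesis by (auto simp: L2_def)
qed

text \<open>The cross-ambiguity function of \<open>f\<close> and \<open>g\<close> up to a phase.
  Overlaps of coherent states are its values up to a phase, and it contains no
  \<open>h\<close>.\<close>

definition ambiguity ::
    "('a::euclidean_space \<Rightarrow> complex) \<Rightarrow> ('a \<Rightarrow> complex) \<Rightarrow> 'a \<Rightarrow> 'a \<Rightarrow> complex" where
  "ambiguity f g u w = (LINT y|lborel. f (y - u) * cnj (g y) * cis (- (w \<bullet> y)))"

text \<open>Of the decay of \<open>g\<close>, \<open>k\<close> powers pay for moving the weight of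
  \<open>f\<close> from \<open>y - u\<close> to \<open>u\<close>, and the other
  \<open>2 * DIM('a)\<close> make the bound integrable in \<open>y\<close>.\<close>

lemma schwartz_pair_bound:
  fixes f g :: "'a::euclidean_space \<Rightarrow> complex"
  assumes "f \<in> schwartz" and "g \<in> schwartz"
  obtains C where "0 \<le> C"
    and "\<And>u y. norm (f (y - u) * cnj (g y)) \<le> C / (1 + norm u) ^ k * (1 / (1 + norm y) ^ (2 * DIM('a)))"
proof -
  obtain A where A: "0 \<le> A" "\<And>x. norm (f x) \<le> A / (1 + norm x) ^ k"
    using schwartz_decay[OF assms(1), of k] by metis
  obtain B where B: "0 \<le> B" "\<And>x. norm (g x) \<le> B / (1 + norm x) ^ (k + 2 * DIM('a))"
    using schwartz_decay[OF assms(2), of "k + 2 * DIM('a)"] by metis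
  show ?thesis
  proof (rule that[of "A * B"])
    fix u y
    have "norm (f (y - u) * cnj (g y)) \<le> (A / (1 + norm (y - u)) ^ k) * (B / (1 + norm y) ^ (k + 2 * DIM('a)))"
      unfolding norm_mult complex_mod_cnj by (intro mult_mono A B divide_nonneg_nonneg zero_le_power add_nonneg_nonneg) auto
    also have "\<dots> = A * B * (1 / (1 + norm (u - y)) ^ k) * (1 / (1 + norm y) ^ k) * (1 / (1 + norm y) ^ (2 * DIM('a)))"
      by (simp add: power_add norm_minus_commute)
    also have "\<dots> \<le> A * B * ((1 + norm y) ^ k / (1 + norm (u - y + y)) ^ k) * (1 / (1 + norm y) ^ k) * (1 / (1 + norm y) ^ (2 * DIM('a)))"
      using A(1) B(1) by (intro mult_right_mono mult_left_mono inverse_power_norm_shift) auto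
    also have "\<dots> = A * B / (1 + norm u) ^ k * (1 / (1 + norm y) ^ (2 * DIM('a)))"
      using add_pos_nonneg[OF zero_less_one norm_ge_zero[of y]] by simp
    finally show "norm (f (y - u) * cnj (g y)) \<le> A * B / (1 + norm u) ^ k * (1 / (1 + norm y) ^ (2 * DIM('a)))" .
  qed (use A B in auto)
qed

lemma schwartz_pair_integrable:
  fixes f g :: "'a::euclidean_space \<Rightarrow> complex"
  assumes "f \<in> schwartz" and "g \<in> schwartz"
  shows "integrable lborel (\<lambda>y. f (y - u) * cnj (g y) * cis (- (w \<bullet> y)))"
proof -
  have [measurable]: "f \<in> borel_measurable borel" "g \<in> borel_measurable borel"
    using assms by (auto intro: schwartz_measurable)
  obtain C where C: "0 \<le> C"
     "\<And>u y. norm (f (y - u) * cnj (g y)) \<le> C / (1 + norm u) ^ 0 * (1 / (1 + norm y) ^ (2 * DIM('a)))"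
    using schwartz_pair_bound[OF assms, of 0] by metis
  show ?thesis
  proof (rule Bochner_Integration.integrable_bound)
    show "integrable lborel (\<lambda>y::'a. C * (1 / (1 + norm y) ^ (2 * DIM('a))))"
      by (intro integrable_mult_right integrable_inverse_power_norm) auto
    show "AE y in lborel. norm (f (y - u) * cnj (g y) * cis (- (w \<bullet> y))) \<le> norm (C * (1 / (1 + norm y) ^ (2 * DIM('a))))"
    proof (intro AE_I2)
      fix y :: 'a
      have "0 \<le> C * (1 / (1 + norm y) ^ (2 * DIM('a)))" using C(1) by simp
      then show "norm (f (y - u) * cnj (g y) * cis (- (w \<bullet> y))) \<le> norm (C * (1 / (1 + norm y) ^ (2 * DIM('a))))"
        using C(2)[of y u] by (simp only: norm_mult norm_cis power_0 div_by_1 mult_1_right real_norm_def abs_of_nonneg)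
    qed
  qed measurable
qed

lemma ambiguity_decay_translation:
  fixes f g :: "'a::euclidean_space \<Rightarrow> complex"
  assumes "f \<in> schwartz" and "g \<in> schwartz"
  obtains C where "0 \<le> C" and "\<And>u w. norm (ambiguity f g u w) \<le> C / (1 + norm u) ^ k"
proof -
  have [measurable]: "f \<in> borel_measurable borel" "g \<in> borel_measurable borel"
    using assms by (auto intro: schwartz_measurable)
  obtain C where C: "0 \<le> C"
     "\<And>u y. norm (f (y - u) * cnj (g y)) \<le> C / (1 + norm u) ^ k * (1 / (1 + norm y) ^ (2 * DIM('a)))"
    using schwartz_pair_bound[OF assms, of k] by metis
  define I where "I = (LINT (y::'a)|lborel. 1 / (1 + norm y) ^ (2 * DIM('a)))"
  have I: "integrable lborel (\<lambda>y::'a. 1 / (1 + norm y) ^ (2 * DIM('a)))"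
    by (rule integrable_inverse_power_norm) auto
  show ?thesis
  proof (rule that[of "C * I"])
    show "0 \<le> C * I" using C(1) by (simp add: I_def)
    fix u w
    have "norm (ambiguity f g u w) \<le> (LINT y|lborel. norm (f (y - u) * cnj (g y) * cis (- (w \<bullet> y))))"
      unfolding ambiguity_def by (rule integral_norm_bound)
    also have "\<dots> \<le> (LINT (y::'a)|lborel. C / (1 + norm u) ^ k * (1 / (1 + norm y) ^ (2 * DIM('a))))"
    proof (rule integral_mono)
      show "integrable lborel (\<lambda>y. norm (f (y - u) * cnj (g y) * cis (- (w \<bullet> y))))"
        by (intro integrable_norm schwartz_pair_integrable assms)
      show "integrable lborel (\<lambda>y::'a. C / (1 + norm u) ^ k * (1 / (1 + norm y) ^ (2 * DIM('a))))"
        by (intro integrable_mult_right I)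
      show "norm (f (y - u) * cnj (g y) * cis (- (w \<bullet> y))) \<le> C / (1 + norm u) ^ k * (1 / (1 + norm y) ^ (2 * DIM('a)))" for y
        using C(2)[of y u] by (simp only: norm_mult norm_cis mult_1_right)
    qed
    also have "\<dots> = C / (1 + norm u) ^ k * I" unfolding I_def by (rule integral_mult_right_zero)
    finally show "norm (ambiguity f g u w) \<le> C * I / (1 + norm u) ^ k" by simp
  qed
qed

text \<open>Integration by parts, obtained by differentiating the translation covariance of the Fourier
  transform; this avoids boundary terms.\<close>

lemma ambiguity_by_parts:
  fixes f g :: "'a::euclidean_space \<Rightarrow> complex"
  assumes f: "f \<in> schwartz" and g: "g \<in> schwartz" and b: "b \<in> Basis"
  shows "\<i> * (w \<bullet> b) * ambiguity f g u w = ambiguity (dir_deriv b f) g u w + ambiguity f (dir_deriv b g) u w"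
proof -
  have [measurable]: "f \<in> borel_measurable borel" "g \<in> borel_measurable borel"
    using f g by (auto intro: schwartz_measurable)
  let ?f = "dir_deriv b f" and ?g = "dir_deriv b g"
  have f': "?f \<in> schwartz" and g': "?g \<in> schwartz" using f g b by (auto intro: schwartz_dir_deriv)
  define F where "F = (\<lambda>y. f (y - u) * cnj (g y))"
  define F' where "F' = (\<lambda>y. ?f (y - u) * cnj (g y) + f (y - u) * cnj (?g y))"
  have [measurable]: "F \<in> borel_measurable borel" unfolding F_def by measurable
  have fi: "integrable lborel (\<lambda>y. F y * cis (- (w \<bullet> y)))"
    unfolding F_def by (intro schwartz_pair_integrable f g)
  have deriv: "((\<lambda>s. F (y + s *\<^sub>R b)) has_vector_derivative F' (y + t *\<^sub>R b)) (at t)" for y t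
  proof -
    have 1: "((\<lambda>s. f (y - u + s *\<^sub>R b)) has_vector_derivative ?f (y - u + t *\<^sub>R b)) (at t)"
      by (intro dir_deriv_line smooth_differentiable schwartz_smooth f)
    have 2: "((\<lambda>s. cnj (g (y + s *\<^sub>R b))) has_vector_derivative cnj (?g (y + t *\<^sub>R b))) (at t)"
      by (intro has_vector_derivative_cnj dir_deriv_line smooth_differentiable schwartz_smooth g)
    from has_vector_derivative_mult[OF 1 2]
    have "((\<lambda>s. f (y - u + s *\<^sub>R b) * cnj (g (y + s *\<^sub>R b))) has_vector_derivative
      f (y - u + t *\<^sub>R b) * cnj (?g (y + t *\<^sub>R b)) + ?f (y - u + t *\<^sub>R b) * cnj (g (y + t *\<^sub>R b))) (at t)" .
    moreover have "y - u + s *\<^sub>R b = y + s *\<^sub>R b - u" for s by simp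
    ultimately show ?thesis by (simp add: F_def F'_def add.commute)
  qed
  obtain C1 where C1: "0 \<le> C1"
     "\<And>u y. norm (?f (y - u) * cnj (g y)) \<le> C1 / (1 + norm u) ^ 0 * (1 / (1 + norm y) ^ (2 * DIM('a)))"
    using schwartz_pair_bound[OF f' g, of 0] by metis
  obtain C2 where C2: "0 \<le> C2"
     "\<And>u y. norm (f (y - u) * cnj (?g y)) \<le> C2 / (1 + norm u) ^ 0 * (1 / (1 + norm y) ^ (2 * DIM('a)))"
    using schwartz_pair_bound[OF f g', of 0] by metis
  have F'b: "norm (F' y) \<le> (C1 + C2) * (1 / (1 + norm y) ^ (2 * DIM('a)))" for y
    unfolding F'_def using C1(2)[of y u] C2(2)[of y u] norm_triangle_ineq
    by (intro order_trans[OF norm_triangle_ineq]) (simp only: power_0 div_by_1 distrib_right add_mono)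
  \<comment> \<open>The power of 2 comes from moving the weight by at most 1, as \<open>b\<close> is
    a unit vector and the step \<open>s\<close> is at most 1.\<close>
  define D where "D = (C1 + C2) * 2 ^ (2 * DIM('a))"
  have D: "norm (F (y + s *\<^sub>R b) - F y) \<le> s * (D * (1 / (1 + norm y) ^ (2 * DIM('a))))" if s: "0 < s" "s \<le> 1" for s y
  proof -
    have "\<exists>x\<in>{0<..<s}. norm (F (y + s *\<^sub>R b) - F (y + 0 *\<^sub>R b)) \<le> norm ((s - 0) *\<^sub>R F' (y + x *\<^sub>R b))"
    proof (rule mvt_general[of 0 s "\<lambda>s. F (y + s *\<^sub>R b)" "\<lambda>x t. t *\<^sub>R F' (y + x *\<^sub>R b)"])
      show "continuous_on {0..s} (\<lambda>s. F (y + s *\<^sub>R b))"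
        using deriv by (intro continuous_at_imp_continuous_on ballI has_vector_derivative_continuous)
      show "((\<lambda>s. F (y + s *\<^sub>R b)) has_derivative (\<lambda>t. t *\<^sub>R F' (y + x *\<^sub>R b))) (at x)" for x
        using deriv[of y x] by (simp add: has_vector_derivative_def)
    qed (use s in auto)
    then obtain x where x: "0 < x" "x < s" and "norm (F (y + s *\<^sub>R b) - F y) \<le> s * norm (F' (y + x *\<^sub>R b))"
      using s by auto
    note this(3)
    also have "norm (F' (y + x *\<^sub>R b)) \<le> (C1 + C2) * (1 / (1 + norm (y + x *\<^sub>R b)) ^ (2 * DIM('a)))"
      by (rule F'b)
    also have "\<dots> \<le> (C1 + C2) * ((1 + norm (- (x *\<^sub>R b))) ^ (2 * DIM('a)) / (1 + norm (y + x *\<^sub>R b + - (x *\<^sub>R b))) ^ (2 * DIM('a)))"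
      using C1 C2 by (intro mult_left_mono inverse_power_norm_shift) auto
    also have "\<dots> \<le> (C1 + C2) * (2 ^ (2 * DIM('a)) / (1 + norm y) ^ (2 * DIM('a)))"
      using C1 C2 x s b by (intro mult_left_mono) (auto intro!: divide_right_mono power_mono)
    finally show ?thesis using s by (simp add: D_def mult_left_mono mult_ac)
  qed
  define e where "e = (\<lambda>n::nat. 1 / real (Suc n))"
  have e0: "0 < e n" "e n \<le> 1" for n by (auto simp: e_def)
  have elim: "e \<longlonglongrightarrow> 0" unfolding e_def by (rule LIMSEQ_Suc[OF lim_1_over_n])
  have efl: "filterlim e (at 0) sequentially"
    unfolding filterlim_at using elim e0(1) by (auto simp: less_imp_neq[THEN not_sym])
  \<comment> \<open>Translating \<open>F\<close> multiplies its Fourier integral by the phase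
    \<open>cis (e n * (w \<bullet> b))\<close>, so the difference quotient of \<open>F\<close> is
    transformed into the difference quotient of this phase.\<close>
  have eq: "((cis (e n * (w \<bullet> b)) - 1) /\<^sub>R e n) * ambiguity f g u w =
     (LINT y|lborel. ((F (y + e n *\<^sub>R b) - F y) /\<^sub>R e n) * cis (- (w \<bullet> y)))" for n
  proof -
    have sh: "F (y + e n *\<^sub>R b) * cis (- (w \<bullet> y)) = cis (e n * (w \<bullet> b)) * (F (y + e n *\<^sub>R b) * cis (- (w \<bullet> (y + e n *\<^sub>R b))))" for y
    proof -
      have "cis (- (w \<bullet> y)) = cis (e n * (w \<bullet> b)) * cis (- (w \<bullet> (y + e n *\<^sub>R b)))"
        by (simp add: cis_mult inner_add_right)
      then show ?thesis by (simp only: mult_ac)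
    qed
    have i1: "integrable lborel (\<lambda>y. F (y + e n *\<^sub>R b) * cis (- (w \<bullet> (y + e n *\<^sub>R b))))"
      by (rule integrable_lborel_translate[OF fi])
    then have i2: "integrable lborel (\<lambda>y. F (y + e n *\<^sub>R b) * cis (- (w \<bullet> y)))"
      unfolding sh by (intro integrable_mult_right)
    have "(LINT y|lborel. F (y + e n *\<^sub>R b) * cis (- (w \<bullet> y))) =
       cis (e n * (w \<bullet> b)) * (LINT y|lborel. F (y + e n *\<^sub>R b) * cis (- (w \<bullet> (y + e n *\<^sub>R b))))"
      unfolding sh by (rule integral_mult_right_zero)
    also have "(LINT y|lborel. F (y + e n *\<^sub>R b) * cis (- (w \<bullet> (y + e n *\<^sub>R b)))) = (LINT y|lborel. F y * cis (- (w \<bullet> y)))"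
      by (rule integral_lborel_translate) measurable
    finally have s: "(LINT y|lborel. F (y + e n *\<^sub>R b) * cis (- (w \<bullet> y))) = cis (e n * (w \<bullet> b)) * ambiguity f g u w"
      by (simp add: ambiguity_def F_def)
    have "(LINT y|lborel. ((F (y + e n *\<^sub>R b) - F y) /\<^sub>R e n) * cis (- (w \<bullet> y))) =
       (LINT y|lborel. (F (y + e n *\<^sub>R b) * cis (- (w \<bullet> y)) - F y * cis (- (w \<bullet> y))) /\<^sub>R e n)"
      by (intro Bochner_Integration.integral_cong) (simp_all add: left_diff_distrib)
    also have "\<dots> = (cis (e n * (w \<bullet> b)) * ambiguity f g u w - ambiguity f g u w) /\<^sub>R e n"
      by (subst integral_scaleR_right, subst Bochner_Integration.integral_diff[OF i2 fi], subst s)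
         (simp add: ambiguity_def F_def)
    finally show ?thesis by (simp only: left_diff_distrib mult_scaleR_left mult_1_left)
  qed
  have "(\<lambda>n. LINT y|lborel. ((F (y + e n *\<^sub>R b) - F y) /\<^sub>R e n) * cis (- (w \<bullet> y))) \<longlonglongrightarrow> (LINT y|lborel. F' y * cis (- (w \<bullet> y)))"
  proof (rule integral_dominated_convergence[where w="\<lambda>y. D * (1 / (1 + norm y) ^ (2 * DIM('a)))"])
    have "dir_deriv b f \<in> borel_measurable borel" "dir_deriv b g \<in> borel_measurable borel"
      using f' g' by (auto intro: schwartz_measurable)
    note [measurable] = this
    show "(\<lambda>y. F' y * cis (- (w \<bullet> y))) \<in> borel_measurable lborel" unfolding F'_def by measurable
    show "integrable lborel (\<lambda>y::'a. D * (1 / (1 + norm y) ^ (2 * DIM('a))))"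
      by (intro integrable_mult_right integrable_inverse_power_norm) auto
    show "AE y in lborel. (\<lambda>n. ((F (y + e n *\<^sub>R b) - F y) /\<^sub>R e n) * cis (- (w \<bullet> y))) \<longlonglongrightarrow> F' y * cis (- (w \<bullet> y))"
    proof (intro AE_I2 tendsto_mult tendsto_const)
      fix y
      have "((\<lambda>s. (F (y + s *\<^sub>R b) - F (y + 0 *\<^sub>R b)) /\<^sub>R s) \<longlongrightarrow> F' (y + 0 *\<^sub>R b)) (at 0)"
        by (rule has_vector_derivative_quotient[OF deriv])
      from filterlim_compose[OF this efl] show "(\<lambda>n. (F (y + e n *\<^sub>R b) - F y) /\<^sub>R e n) \<longlonglongrightarrow> F' y"
        by simp
    qed
    show "AE y in lborel. norm (((F (y + e n *\<^sub>R b) - F y) /\<^sub>R e n) * cis (- (w \<bullet> y))) \<le> D * (1 / (1 + norm y) ^ (2 * DIM('a)))" for n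
    proof (intro AE_I2)
      fix y
      show "norm (((F (y + e n *\<^sub>R b) - F y) /\<^sub>R e n) * cis (- (w \<bullet> y))) \<le> D * (1 / (1 + norm y) ^ (2 * DIM('a)))"
        using D[OF e0[of n], of y] e0[of n] unfolding norm_mult norm_cis norm_scaleR
        by (simp add: inverse_eq_divide divide_le_eq mult.commute)
    qed
  qed measurable
  moreover have "(LINT y|lborel. F' y * cis (- (w \<bullet> y))) = ambiguity ?f g u w + ambiguity f ?g u w"
    unfolding F'_def ambiguity_def distrib_right
    by (intro Bochner_Integration.integral_add schwartz_pair_integrable f g f' g')
  ultimately have 1: "(\<lambda>n. ((cis (e n * (w \<bullet> b)) - 1) /\<^sub>R e n) * ambiguity f g u w) \<longlonglongrightarrow> ambiguity ?f g u w + ambiguity f ?g u w"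
    by (simp only: eq)
  have "((\<lambda>s. exp (\<i> * of_real (s * (w \<bullet> b)))) has_vector_derivative \<i> * (w \<bullet> b)) (at (0::real))"
    by (auto intro!: derivative_eq_intros has_vector_derivative_real_field)
  from filterlim_compose[OF has_vector_derivative_quotient[OF this] efl]
  have "(\<lambda>n. (cis (e n * (w \<bullet> b)) - 1) /\<^sub>R e n) \<longlonglongrightarrow> \<i> * (w \<bullet> b)"
    by (simp add: cis_conv_exp)
  from LIMSEQ_unique[OF tendsto_mult[OF this tendsto_const] 1] show ?thesis .
qed

text \<open>By \<open>ambiguity_by_parts\<close> each factor \<open>w \<bullet> b\<close> becomes a
  derivative of \<open>f\<close> or of \<open>g\<close>. Both derivatives are Schwartz functions, so
  the induction runs with \<open>f\<close> and \<open>g\<close> arbitrary.\<close>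

lemma ambiguity_decay_modulation:
  fixes f g :: "'a::euclidean_space \<Rightarrow> complex"
  assumes "set bs \<subseteq> Basis" and "f \<in> schwartz" and "g \<in> schwartz"
  shows "\<exists>C\<ge>0. \<forall>u w. (\<Prod>b\<leftarrow>bs. \<bar>w \<bullet> b\<bar>) * norm (ambiguity f g u w) \<le> C / (1 + norm u) ^ k"
  using assms
proof (induction bs arbitrary: f g)
  case Nil
  then show ?case using ambiguity_decay_translation[of f g k] by (simp, metis)
next
  case (Cons b bs)
  have b: "b \<in> Basis" using Cons.prems by simp
  obtain C1 where C1: "C1 \<ge> 0" "\<And>u w. (\<Prod>b\<leftarrow>bs. \<bar>w \<bullet> b\<bar>) * norm (ambiguity (dir_deriv b f) g u w) \<le> C1 / (1 + norm u) ^ k"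
    using Cons.IH[of "dir_deriv b f" g] Cons.prems schwartz_dir_deriv[of f b] by auto
  obtain C2 where C2: "C2 \<ge> 0" "\<And>u w. (\<Prod>b\<leftarrow>bs. \<bar>w \<bullet> b\<bar>) * norm (ambiguity f (dir_deriv b g) u w) \<le> C2 / (1 + norm u) ^ k"
    using Cons.IH[of f "dir_deriv b g"] Cons.prems schwartz_dir_deriv[of g b] by auto
  have "(\<Prod>b\<leftarrow>b # bs. \<bar>w \<bullet> b\<bar>) * norm (ambiguity f g u w) \<le> (C1 + C2) / (1 + norm u) ^ k" for u w
  proof -
    have p0: "0 \<le> (\<Prod>b\<leftarrow>bs. \<bar>w \<bullet> b\<bar>)" by (induction bs) auto
    have "\<bar>w \<bullet> b\<bar> * norm (ambiguity f g u w) = norm (\<i> * (w \<bullet> b) * ambiguity f g u w)"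
      by (simp add: norm_mult)
    also have "\<dots> \<le> norm (ambiguity (dir_deriv b f) g u w) + norm (ambiguity f (dir_deriv b g) u w)"
      unfolding ambiguity_by_parts[OF Cons.prems(2,3) b] by (rule norm_triangle_ineq)
    finally have "(\<Prod>b\<leftarrow>bs. \<bar>w \<bullet> b\<bar>) * (\<bar>w \<bullet> b\<bar> * norm (ambiguity f g u w)) \<le>
       (\<Prod>b\<leftarrow>bs. \<bar>w \<bullet> b\<bar>) * (norm (ambiguity (dir_deriv b f) g u w) + norm (ambiguity f (dir_deriv b g) u w))"
      using p0 by (rule mult_left_mono)
    also have "\<dots> \<le> C1 / (1 + norm u) ^ k + C2 / (1 + norm u) ^ k"
      unfolding distrib_left by (intro add_mono C1 C2)
    finally show ?thesis by (simp add: add_divide_distrib mult_ac)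
  qed
  then show ?case using C1(1) C2(1) by (intro exI[of _ "C1 + C2"]) auto
qed

text \<open>The largest coordinate dominates. Pure powers of single coordinates therefore control
  the norm, and \<open>ambiguity_decay_modulation\<close> has to be applied to
  \<open>replicate k b\<close> only.\<close>

lemma norm_power_le_sum_Basis:
  fixes w :: "'a::euclidean_space"
  shows "norm w ^ k \<le> real DIM('a) ^ k * (\<Sum>b\<in>Basis. \<bar>w \<bullet> b\<bar> ^ k)"
proof -
  let ?S = "(\<lambda>c. \<bar>w \<bullet> c\<bar>) ` Basis"
  have "Max ?S \<in> ?S" by (rule Max_in) auto
  then obtain b where "Max ?S = \<bar>w \<bullet> b\<bar>" and b: "b \<in> Basis" by (rule imageE)
  then have max: "\<bar>w \<bullet> c\<bar> \<le> \<bar>w \<bullet> b\<bar>" if "c \<in> Basis" for c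
    using Max_ge[of ?S "\<bar>w \<bullet> c\<bar>"] that by simp
  have "norm w \<le> (\<Sum>c\<in>Basis. \<bar>w \<bullet> c\<bar>)" by (rule norm_le_l1)
  also have "\<dots> \<le> real DIM('a) * \<bar>w \<bullet> b\<bar>" using max by (intro sum_bounded_above) auto
  finally have "norm w ^ k \<le> (real DIM('a) * \<bar>w \<bullet> b\<bar>) ^ k" by (intro power_mono) auto
  also have "\<dots> = real DIM('a) ^ k * \<bar>w \<bullet> b\<bar> ^ k" by (rule power_mult_distrib)
  also have "\<bar>w \<bullet> b\<bar> ^ k \<le> (\<Sum>b\<in>Basis. \<bar>w \<bullet> b\<bar> ^ k)"
    using b by (intro member_le_sum) auto
  finally show ?thesis by (simp add: mult_left_mono)
qed

text \<open>Decay in \<open>w\<close> comes together with decay in \<open>u\<close>, so the product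
  weight \<open>(1 + norm u) * (1 + norm w)\<close> is available; it dominates
  \<open>1 + norm (u, w)\<close>.\<close>

lemma ambiguity_decay:
  fixes f g :: "'a::euclidean_space \<Rightarrow> complex"
  assumes "f \<in> schwartz" and "g \<in> schwartz"
  obtains C where "0 \<le> C"
    and "\<And>u w. norm (ambiguity f g u w) \<le> C / (1 + norm (u, w)) ^ k"
proof -
  have "\<exists>C\<ge>0. \<forall>u w. \<bar>w \<bullet> b\<bar> ^ k * norm (ambiguity f g u w) \<le> C / (1 + norm u) ^ k" if "b \<in> Basis" for b
  proof -
    have "set (replicate k b) \<subseteq> Basis" using that by auto
    from ambiguity_decay_modulation[OF this assms, of k] show ?thesis by simp
  qed
  then obtain B where B: "\<And>b. b \<in> Basis \<Longrightarrow> 0 \<le> B b"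
      "\<And>b u w. b \<in> Basis \<Longrightarrow> \<bar>w \<bullet> b\<bar> ^ k * norm (ambiguity f g u w) \<le> B b / (1 + norm u) ^ k"
    by metis
  obtain A where A: "0 \<le> A" "\<And>u w. norm (ambiguity f g u w) \<le> A / (1 + norm u) ^ k"
    using ambiguity_decay_translation[OF assms, of k] by metis
  define C where "C = 2 ^ k * (A + real DIM('a) ^ k * (\<Sum>b\<in>Basis. B b))"
  show ?thesis
  proof (rule that[of C])
    show "0 \<le> C" unfolding C_def using A(1) B(1) by (auto intro!: mult_nonneg_nonneg add_nonneg_nonneg sum_nonneg)
    fix u w :: 'a
    let ?n = "norm (ambiguity f g u w)"
    have "(1 + norm w) ^ k * ?n \<le> 2 ^ k * (1 + real DIM('a) ^ k * (\<Sum>b\<in>Basis. \<bar>w \<bullet> b\<bar> ^ k)) * ?n"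
      using norm_power_le_sum_Basis[of w k]
      by (intro mult_right_mono order_trans[OF power_one_plus_le]) auto
    also have "\<dots> = 2 ^ k * (?n + real DIM('a) ^ k * (\<Sum>b\<in>Basis. \<bar>w \<bullet> b\<bar> ^ k * ?n))"
      by (simp add: sum_distrib_right[symmetric] algebra_simps)
    also have "\<dots> \<le> 2 ^ k * (A / (1 + norm u) ^ k + real DIM('a) ^ k * (\<Sum>b\<in>Basis. B b / (1 + norm u) ^ k))"
      by (intro mult_left_mono add_mono sum_mono A B) auto
    also have "\<dots> = C / (1 + norm u) ^ k"
      by (simp add: C_def sum_divide_distrib[symmetric] add_divide_distrib distrib_left)
    finally have 1: "(1 + norm w) ^ k * ?n \<le> C / (1 + norm u) ^ k" .
    have pu: "0 < (1 + norm u) ^ k" and pw: "0 < (1 + norm w) ^ k" and pz: "0 < (1 + norm (u, w)) ^ k"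
      by (auto intro!: zero_less_power add_pos_nonneg)
    have "1 + norm (u, w) \<le> (1 + norm u) * (1 + norm w)"
      using norm_Pair_le[of u w] mult_nonneg_nonneg[OF norm_ge_zero[of u] norm_ge_zero[of w]]
      unfolding distrib_left distrib_right by linarith
    then have "(1 + norm (u, w)) ^ k \<le> (1 + norm u) ^ k * (1 + norm w) ^ k"
      unfolding power_mult_distrib[symmetric] by (intro power_mono) auto
    then have "(1 + norm (u, w)) ^ k * ?n \<le> (1 + norm u) ^ k * ((1 + norm w) ^ k * ?n)"
      unfolding mult.assoc[symmetric] by (intro mult_right_mono) auto
    also have "\<dots> \<le> (1 + norm u) ^ k * (C / (1 + norm u) ^ k)"
      using 1 pu by (intro mult_left_mono) auto
    also have "\<dots> = C"
      unfolding times_divide_eq_right by (rule nonzero_mult_div_cancel_left) (use pu in linarith)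
    finally show "?n \<le> C / (1 + norm (u, w)) ^ k"
      using pz by (simp add: pos_le_divide_eq mult.commute)
  qed
qed

section \<open>Coherent states and the isometry of the phase space transform\<close>

lemma coherent_state_eq:
  fixes \<phi> :: "'a::euclidean_space \<Rightarrow> complex"
  assumes "0 < h"
  shows "coherent_state \<phi> h (x0, w0) x =
    complex_of_real (h powr (- real DIM('a) / 4)) * cis ((w0 \<bullet> x) / h) * \<phi> ((x - x0) /\<^sub>R sqrt h)"
proof -
  have "h powr (- 1 / 2) = inverse (sqrt h)"
    using assms by (simp add: powr_minus powr_half_sqrt)
  then show ?thesis
    by (simp add: coherent_state_def cis_conv_exp)
qed

text \<open>The squared normalization of the coherent states cancels the Jacobian of the dilation by
  \<open>sqrt h\<close> in dimension \<open>n\<close>.\<close>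

lemma coherent_state_prefactor:
  assumes "0 < h"
  shows "(h powr (- real n / 4))\<^sup>2 * sqrt h ^ n = 1"
proof -
  have "(h powr (- real n / 4))\<^sup>2 = h powr (- real n / 2)"
    using assms by (simp add: power2_eq_square flip: powr_add)
  moreover have "sqrt h ^ n = h powr (real n / 2)"
    using assms by (simp add: powr_half_sqrt[symmetric] powr_realpow[symmetric] powr_powr)
  ultimately show ?thesis
    using assms by (simp flip: powr_add)
qed

context
  fixes \<phi> :: "'a::euclidean_space \<Rightarrow> complex" and h :: real
  assumes phi: "\<phi> \<in> schwartz" and phi1: "l2_norm \<phi> = 1" and h: "0 < h"
begin

lemma coherent_state_measurable [measurable]:
  "(\<lambda>(z, x). coherent_state \<phi> h z x) \<in> borel_measurable (borel \<Otimes>\<^sub>M borel)"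
proof -
  have [measurable]: "\<phi> \<in> borel_measurable borel" using phi by (rule schwartz_measurable)
  have "(\<lambda>(z, x). coherent_state \<phi> h z x) = (\<lambda>(z, x).
    complex_of_real (h powr (- real DIM('a) / 4)) * cis ((snd z \<bullet> x) / h) * \<phi> ((x - fst z) /\<^sub>R sqrt h))"
    by (intro ext, clarify) (simp only: coherent_state_eq[OF h] fst_conv snd_conv)
  also have "\<dots> \<in> borel_measurable (borel \<Otimes>\<^sub>M borel)"
  proof -
    have [measurable]: "(fst :: 'a \<times> 'a \<Rightarrow> 'a) \<in> borel_measurable borel" "(snd :: 'a \<times> 'a \<Rightarrow> 'a) \<in> borel_measurable borel"
      by (auto intro!: borel_measurable_continuous_onI continuous_intros)
    show ?thesis unfolding case_prod_beta by measurable
  qed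
  finally show ?thesis .
qed

lemma coherent_state_borel: "coherent_state \<phi> h z \<in> borel_measurable borel"
  using measurable_compose[OF measurable_Pair1'[of z borel borel] coherent_state_measurable] by simp

text \<open>Rescaling about \<open>x1\<close> by \<open>sqrt h\<close> leaves the window at unit
  scale and splits off a phase, which the norm removes. Decay constants of the overlaps are thus
  independent of \<open>h\<close>.\<close>

lemma l2_inner_coherent_states:
  "norm (l2_inner (coherent_state \<phi> h (x0, w0)) (coherent_state \<phi> h (x1, w1))) =
    norm (ambiguity \<phi> \<phi> ((x0 - x1) /\<^sub>R sqrt h) ((w1 - w0) /\<^sub>R sqrt h))"
proof -
  have [measurable]: "\<phi> \<in> borel_measurable borel" using phi by (rule schwartz_measurable)
  let ?K = "complex_of_real ((h powr (- real DIM('a) / 4))\<^sup>2)"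
  define F where "F = (\<lambda>x. ?K * (\<phi> ((x - x0) /\<^sub>R sqrt h) * cnj (\<phi> ((x - x1) /\<^sub>R sqrt h)) * cis (((w0 - w1) \<bullet> x) / h)))"
  have [measurable]: "F \<in> borel_measurable borel" unfolding F_def by measurable
  have "l2_inner (coherent_state \<phi> h (x0, w0)) (coherent_state \<phi> h (x1, w1)) = (LINT x|lborel. F x)"
    unfolding l2_inner_def
  proof (intro Bochner_Integration.integral_cong refl)
    fix x
    have "cis (((w0 - w1) \<bullet> x) / h) = cis ((w0 \<bullet> x) / h) * cnj (cis ((w1 \<bullet> x) / h))"
      by (simp add: cis_cnj cis_mult inner_diff_left diff_divide_distrib)
    then show "coherent_state \<phi> h (x0, w0) x * cnj (coherent_state \<phi> h (x1, w1) x) = F x"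
      by (simp add: F_def coherent_state_eq[OF h] power2_eq_square mult_ac)
  qed
  also have "\<dots> = \<bar>sqrt h\<bar> ^ DIM('a) *\<^sub>R (LINT y|lborel. F (x1 + sqrt h *\<^sub>R y))"
    using h by (intro integral_lborel_affine) auto
  also have "(LINT y|lborel. F (x1 + sqrt h *\<^sub>R y)) = (LINT y|lborel. ?K * cis (((w0 - w1) \<bullet> x1) / h) *
      (\<phi> (y - (x0 - x1) /\<^sub>R sqrt h) * cnj (\<phi> y) * cis (- (((w1 - w0) /\<^sub>R sqrt h) \<bullet> y))))"
  proof (intro Bochner_Integration.integral_cong refl)
    fix y
    have "(x1 + sqrt h *\<^sub>R y - x0) /\<^sub>R sqrt h = y - (x0 - x1) /\<^sub>R sqrt h"
      using h by (simp add: scaleR_diff_right scaleR_add_right)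
    moreover have "(x1 + sqrt h *\<^sub>R y - x1) /\<^sub>R sqrt h = y" using h by simp
    moreover have "cis (((w0 - w1) \<bullet> (x1 + sqrt h *\<^sub>R y)) / h) =
       cis (((w0 - w1) \<bullet> x1) / h) * cis (- (((w1 - w0) /\<^sub>R sqrt h) \<bullet> y))"
    proof -
      have "(sqrt h * t) / h = inverse (sqrt h) * t" for t
        using h by (simp add: field_simps)
      then show ?thesis
        by (simp add: cis_mult inner_add_right add_divide_distrib diff_divide_distrib inner_diff_left right_diff_distrib)
    qed
    ultimately show "F (x1 + sqrt h *\<^sub>R y) = ?K * cis (((w0 - w1) \<bullet> x1) / h) *
      (\<phi> (y - (x0 - x1) /\<^sub>R sqrt h) * cnj (\<phi> y) * cis (- (((w1 - w0) /\<^sub>R sqrt h) \<bullet> y)))"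
      unfolding F_def by (simp only: mult_ac)
  qed
  also have "\<dots> = ?K * cis (((w0 - w1) \<bullet> x1) / h) * ambiguity \<phi> \<phi> ((x0 - x1) /\<^sub>R sqrt h) ((w1 - w0) /\<^sub>R sqrt h)"
    unfolding ambiguity_def by (rule integral_mult_right_zero)
  finally have "norm (l2_inner (coherent_state \<phi> h (x0, w0)) (coherent_state \<phi> h (x1, w1))) =
     (h powr (- real DIM('a) / 4))\<^sup>2 * sqrt h ^ DIM('a) * norm (ambiguity \<phi> \<phi> ((x0 - x1) /\<^sub>R sqrt h) ((w1 - w0) /\<^sub>R sqrt h))"
    using h by (simp add: norm_mult norm_power)
  then show ?thesis by (simp only: coherent_state_prefactor[OF h] mult_1_left)
qed

lemma nn_integral_coherent_state:
  "(\<integral>\<^sup>+x. ennreal ((norm (coherent_state \<phi> h z x))\<^sup>2) \<partial>lborel) = 1"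
proof (cases z)
  case (Pair x0 w0)
  have [measurable]: "\<phi> \<in> borel_measurable borel" using phi by (rule schwartz_measurable)
  have "(\<integral>\<^sup>+x. ennreal ((norm (coherent_state \<phi> h z x))\<^sup>2) \<partial>lborel) =
     ennreal (\<bar>sqrt h\<bar> ^ DIM('a)) * (\<integral>\<^sup>+y. ennreal ((norm (coherent_state \<phi> h z (x0 + sqrt h *\<^sub>R y)))\<^sup>2) \<partial>lborel)"
    using h coherent_state_borel[of z] by (intro nn_integral_lborel_affine) auto
  also have "\<dots> = ennreal (sqrt h ^ DIM('a)) * (\<integral>\<^sup>+y. ennreal ((h powr (- real DIM('a) / 4))\<^sup>2) * ennreal ((norm (\<phi> y))\<^sup>2) \<partial>lborel)"
    using h by (simp add: Pair coherent_state_eq norm_mult power_mult_distrib ennreal_mult)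
  also have "\<dots> = ennreal (sqrt h ^ DIM('a)) * ennreal ((h powr (- real DIM('a) / 4))\<^sup>2)"
    by (simp add: nn_integral_cmult nn_integral_L2[OF schwartz_L2[OF phi]] phi1)
  also have "\<dots> = ennreal ((h powr (- real DIM('a) / 4))\<^sup>2 * sqrt h ^ DIM('a))"
    using h by (subst ennreal_mult[symmetric]) (auto simp: mult.commute)
  also have "\<dots> = 1" by (simp only: coherent_state_prefactor[OF h] ennreal_1)
  finally show ?thesis .
qed

lemma coherent_state_L2: "coherent_state \<phi> h z \<in> L2"
  by (rule L2I[OF coherent_state_borel]) (simp add: nn_integral_coherent_state)

lemma l2_norm_coherent_state: "l2_norm (coherent_state \<phi> h z) = 1"
proof -
  have "ennreal ((l2_norm (coherent_state \<phi> h z))\<^sup>2) = ennreal 1"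
    unfolding nn_integral_L2[OF coherent_state_L2, symmetric] nn_integral_coherent_state by simp
  then have "(l2_norm (coherent_state \<phi> h z))\<^sup>2 = 1" by (subst (asm) ennreal_inj) auto
  then show ?thesis using l2_norm_nonneg[of "coherent_state \<phi> h z"] by (simp add: power2_eq_1_iff)
qed

lemma transform_measurable:
  assumes [measurable]: "f \<in> borel_measurable borel"
  shows "(\<lambda>z. l2_inner f (coherent_state \<phi> h z)) \<in> borel_measurable borel"
  unfolding l2_inner_def by measurable

text \<open>For a fixed position the transform is, in the frequency variable, the Fourier transform
  of \<open>f\<close> times a translated window, evaluated at \<open>w /\<^sub>R h\<close>. The
  Plancherel formula in frequency and Tonelli's theorem in position leave the norm of the window,
  which is 1.\<close>

lemma transform_isometry:
  assumes f: "f \<in> L2"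
  shows "(\<integral>\<^sup>+z. ennreal ((norm (l2_inner f (coherent_state \<phi> h z)))\<^sup>2) \<partial>lborel) =
    ennreal ((2 * pi * h) ^ DIM('a) * (l2_norm f)\<^sup>2)"
proof -
  have [measurable]: "\<phi> \<in> borel_measurable borel" using phi by (rule schwartz_measurable)
  have fm[measurable]: "f \<in> borel_measurable borel" using f by (rule L2_measurable)
  let ?k = "h powr (- real DIM('a) / 4)"
  define g where "g = (\<lambda>x y. f y * (complex_of_real ?k * cnj (\<phi> ((y - x) /\<^sub>R sqrt h))))"
  have gm[measurable]: "(\<lambda>(x, y). g x y) \<in> borel_measurable (borel \<Otimes>\<^sub>M borel)" unfolding g_def by measurable
  \<comment> \<open>The bound on the window puts \<open>g x\<close> into \<open>L2\<close>, and
    integrability comes from a product of two \<open>L2\<close> functions; \<open>plancherel\<close>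
    asks for both.\<close>
  obtain B where B: "0 \<le> B" "\<And>x. norm (\<phi> x) \<le> B"
    using schwartz_decay[OF phi, of 0] by (metis power_0 div_by_1)
  have gL: "g x \<in> L2" for x
  proof (rule L2I)
    have "(\<integral>\<^sup>+y. ennreal ((norm (g x y))\<^sup>2) \<partial>lborel) \<le> (\<integral>\<^sup>+y. ennreal ((?k * B)\<^sup>2) * ennreal ((norm (f y))\<^sup>2) \<partial>lborel)"
    proof (rule nn_integral_mono)
      fix y
      have "(norm (g x y))\<^sup>2 \<le> (norm (f y) * (?k * B))\<^sup>2"
        unfolding g_def using B(2)[of "(y - x) /\<^sub>R sqrt h"] by (intro power_mono) (auto simp: norm_mult intro!: mult_left_mono)
      then show "ennreal ((norm (g x y))\<^sup>2) \<le> ennreal ((?k * B)\<^sup>2) * ennreal ((norm (f y))\<^sup>2)"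
        by (subst ennreal_mult[symmetric]) (auto intro!: ennreal_leI simp: power_mult_distrib mult_ac)
    qed
    also have "\<dots> < \<infinity>" by (simp add: nn_integral_cmult nn_integral_L2 f ennreal_mult_less_top)
    finally show "(\<integral>\<^sup>+y. ennreal ((norm (g x y))\<^sup>2) \<partial>lborel) < \<infinity>" .
    show "g x \<in> borel_measurable borel" unfolding g_def by measurable
  qed
  have gi: "integrable lborel (g x)" for x
  proof -
    have "integrable lborel (\<lambda>y. f y * cnj (coherent_state \<phi> h (x, 0) y))"
      by (rule l2_inner_integrable[OF f coherent_state_L2])
    then show ?thesis by (simp add: g_def coherent_state_eq[OF h])
  qed
  have tr: "l2_inner f (coherent_state \<phi> h (x, w)) = (LINT y|lborel. g x y * cis (- ((w /\<^sub>R h) \<bullet> y)))" for x w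
    unfolding l2_inner_def
  proof (intro Bochner_Integration.integral_cong refl)
    fix y
    have "(w /\<^sub>R h) \<bullet> y = (w \<bullet> y) / h" by (simp add: divide_inverse mult.commute)
    then show "f y * cnj (coherent_state \<phi> h (x, w) y) = g x y * cis (- ((w /\<^sub>R h) \<bullet> y))"
      unfolding g_def coherent_state_eq[OF h]
      by (simp only: complex_cnj_mult complex_cnj_complex_of_real cis_cnj mult_ac)
  qed
  have m: "(\<lambda>w. l2_inner f (coherent_state \<phi> h (x, w))) \<in> borel_measurable borel" for x
    unfolding tr by measurable
  have "(\<integral>\<^sup>+z. ennreal ((norm (l2_inner f (coherent_state \<phi> h z)))\<^sup>2) \<partial>lborel) =
     (\<integral>\<^sup>+z. ennreal ((norm (l2_inner f (coherent_state \<phi> h z)))\<^sup>2) \<partial>(lborel \<Otimes>\<^sub>M lborel))"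
    by (simp only: lborel_prod)
  also have "\<dots> = (\<integral>\<^sup>+x. \<integral>\<^sup>+w. ennreal ((norm (l2_inner f (coherent_state \<phi> h (x, w))))\<^sup>2) \<partial>lborel \<partial>lborel)"
    using transform_measurable[OF fm]
    by (intro lborel.nn_integral_fst[symmetric]) (simp add: borel_prod[symmetric] cong: measurable_cong_sets)
  also have "\<dots> = (\<integral>\<^sup>+x. ennreal ((2 * pi * h) ^ DIM('a)) * (\<integral>\<^sup>+y. ennreal ((norm (g x y))\<^sup>2) \<partial>lborel) \<partial>lborel)"
  proof (rule nn_integral_cong)
    fix x :: 'a
    have "(\<integral>\<^sup>+w. ennreal ((norm (l2_inner f (coherent_state \<phi> h (x, w))))\<^sup>2) \<partial>lborel) =
       ennreal (\<bar>h\<bar> ^ DIM('a)) * (\<integral>\<^sup>+w. ennreal ((norm (l2_inner f (coherent_state \<phi> h (x, 0 + h *\<^sub>R w))))\<^sup>2) \<partial>lborel)"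
      using h m[of x] by (intro nn_integral_lborel_affine) auto
    also have "\<dots> = ennreal (\<bar>h\<bar> ^ DIM('a)) * ennreal ((2 * pi) ^ DIM('a) * (l2_norm (g x))\<^sup>2)"
      unfolding tr using h by (simp add: plancherel[OF gi gL])
    also have "\<dots> = ennreal ((2 * pi * h) ^ DIM('a)) * ennreal ((l2_norm (g x))\<^sup>2)"
      using h by (simp add: ennreal_mult[symmetric] power_mult_distrib mult_ac)
    also have "ennreal ((l2_norm (g x))\<^sup>2) = (\<integral>\<^sup>+y. ennreal ((norm (g x y))\<^sup>2) \<partial>lborel)"
      by (rule nn_integral_L2[OF gL, symmetric])
    finally show "(\<integral>\<^sup>+w. ennreal ((norm (l2_inner f (coherent_state \<phi> h (x, w))))\<^sup>2) \<partial>lborel) =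
      ennreal ((2 * pi * h) ^ DIM('a)) * (\<integral>\<^sup>+y. ennreal ((norm (g x y))\<^sup>2) \<partial>lborel)" .
  qed
  also have "\<dots> = ennreal ((2 * pi * h) ^ DIM('a)) * (\<integral>\<^sup>+x. \<integral>\<^sup>+y. ennreal ((norm (g x y))\<^sup>2) \<partial>lborel \<partial>lborel)"
    by (rule nn_integral_cmult) measurable
  also have "(\<integral>\<^sup>+x. \<integral>\<^sup>+y. ennreal ((norm (g x y))\<^sup>2) \<partial>lborel \<partial>lborel) = (\<integral>\<^sup>+y. \<integral>\<^sup>+x. ennreal ((norm (g x y))\<^sup>2) \<partial>lborel \<partial>lborel)"
    by (rule lborel_pair.Fubini'[symmetric]) measurable
  also have "\<dots> = (\<integral>\<^sup>+y. ennreal ((norm (f y))\<^sup>2) \<partial>lborel)"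
  proof (rule nn_integral_cong)
    fix y :: 'a
    \<comment> \<open>The window is evaluated at \<open>(y - x) /\<^sub>R sqrt h\<close>, hence the
      dilation by the negative number \<open>- sqrt h\<close>.\<close>
    have "(\<integral>\<^sup>+x. ennreal ((norm (g x y))\<^sup>2) \<partial>lborel) =
       ennreal (\<bar>- sqrt h\<bar> ^ DIM('a)) * (\<integral>\<^sup>+x. ennreal ((norm (g (y + (- sqrt h) *\<^sub>R x) y))\<^sup>2) \<partial>lborel)"
      using h by (intro nn_integral_lborel_affine) auto
    also have "\<dots> = ennreal (sqrt h ^ DIM('a)) * (\<integral>\<^sup>+x. ennreal (?k\<^sup>2 * (norm (f y))\<^sup>2) * ennreal ((norm (\<phi> x))\<^sup>2) \<partial>lborel)"
      using h by (simp add: g_def norm_mult power_mult_distrib ennreal_mult[symmetric] mult_ac)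
    also have "\<dots> = ennreal (sqrt h ^ DIM('a)) * ennreal (?k\<^sup>2 * (norm (f y))\<^sup>2)"
      by (simp add: nn_integral_cmult nn_integral_L2[OF schwartz_L2[OF phi]] phi1)
    also have "\<dots> = ennreal (?k\<^sup>2 * sqrt h ^ DIM('a) * (norm (f y))\<^sup>2)"
      using h by (simp add: ennreal_mult[symmetric] mult_ac)
    finally show "(\<integral>\<^sup>+x. ennreal ((norm (g x y))\<^sup>2) \<partial>lborel) = ennreal ((norm (f y))\<^sup>2)"
      by (simp only: coherent_state_prefactor[OF h] mult_1_left)
  qed
  also have "\<dots> = ennreal ((l2_norm f)\<^sup>2)" by (rule nn_integral_L2[OF f])
  finally show ?thesis using h by (simp add: ennreal_mult)
qed

lemma transform_L2:
  assumes "f \<in> L2"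
  shows "(\<lambda>z. l2_inner f (coherent_state \<phi> h z)) \<in> L2"
  by (rule L2I[OF transform_measurable[OF L2_measurable[OF assms]]]) (simp add: transform_isometry[OF assms])

lemma l2_norm_transform:
  assumes "f \<in> L2"
  shows "(l2_norm (\<lambda>z. l2_inner f (coherent_state \<phi> h z)))\<^sup>2 = (2 * pi * h) ^ DIM('a) * (l2_norm f)\<^sup>2"
  using transform_isometry[OF assms] nn_integral_L2[OF transform_L2[OF assms]] h
  by (simp add: ennreal_inj)

end

lemma l2_inner_polarization:
  assumes f: "f \<in> L2" and g: "g \<in> L2"
  shows "4 * l2_inner f g = complex_of_real ((l2_norm (\<lambda>x. f x + g x))\<^sup>2) - complex_of_real ((l2_norm (\<lambda>x. f x + (-1) * g x))\<^sup>2)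
    + \<i> * (complex_of_real ((l2_norm (\<lambda>x. f x + \<i> * g x))\<^sup>2) - complex_of_real ((l2_norm (\<lambda>x. f x + (-\<i>) * g x))\<^sup>2))"
proof -
  have e: "complex_of_real ((l2_norm (\<lambda>x. f x + c * g x))\<^sup>2) =
     l2_inner f f + c * cnj c * l2_inner g g + cnj c * l2_inner f g + c * cnj (l2_inner f g)" for c
  proof -
    have cg: "(\<lambda>x. c * g x) \<in> L2" using g by (rule L2_scale)
    have s: "(\<lambda>x. f x + c * g x) \<in> L2" using f cg by (rule L2_add)
    have 1: "l2_inner k (\<lambda>x. f x + c * g x) = l2_inner k f + cnj c * l2_inner k g" if k: "k \<in> L2" for k
    proof -
      have "l2_inner k (\<lambda>x. f x + c * g x) = cnj (l2_inner f k + c * l2_inner g k)"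
        by (subst l2_inner_commute) (simp only: l2_inner_add[OF f cg k] l2_inner_scale)
      also have "\<dots> = l2_inner k f + cnj c * l2_inner k g"
        unfolding complex_cnj_add complex_cnj_mult l2_inner_commute[symmetric] ..
      finally show ?thesis .
    qed
    have "complex_of_real ((l2_norm (\<lambda>x. f x + c * g x))\<^sup>2) = l2_inner f (\<lambda>x. f x + c * g x) + c * l2_inner g (\<lambda>x. f x + c * g x)"
      unfolding l2_inner_self[symmetric] l2_inner_add[OF f cg s] l2_inner_scale ..
    also have "\<dots> = l2_inner f f + cnj c * l2_inner f g + c * (l2_inner g f + cnj c * l2_inner g g)"
      by (simp only: 1[OF f] 1[OF g])
    finally show ?thesis by (simp add: l2_inner_commute[of g f] algebra_simps)
  qed
  have e1: "complex_of_real ((l2_norm (\<lambda>x. f x + g x))\<^sup>2) = l2_inner f f + l2_inner g g + l2_inner f g + cnj (l2_inner f g)"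
    using e[of 1] by simp
  show ?thesis unfolding e e1 by (simp add: algebra_simps)
qed

text \<open>Polarization of the isometry. With a coherent state in place of \<open>g\<close> it
  becomes the reproducing formula for the transform.\<close>

lemma transform_inner:
  fixes \<phi> :: "'a::euclidean_space \<Rightarrow> complex"
  assumes phi: "\<phi> \<in> schwartz" "l2_norm \<phi> = 1" and h: "0 < h" and f: "f \<in> L2" and g: "g \<in> L2"
  shows "l2_inner (\<lambda>z. l2_inner f (coherent_state \<phi> h z)) (\<lambda>z. l2_inner g (coherent_state \<phi> h z)) =
    (2 * pi * h) ^ DIM('a) * l2_inner f g"
proof -
  let ?V = "\<lambda>f z. l2_inner f (coherent_state \<phi> h z)"
  note V = transform_L2[OF phi h]
  have lin: "(\<lambda>z. ?V f z + c * ?V g z) = ?V (\<lambda>x. f x + c * g x)" for c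
    by (rule ext) (simp add: l2_inner_add f L2_scale g coherent_state_L2 phi h l2_inner_scale)
  have lin1: "(\<lambda>z. ?V f z + ?V g z) = ?V (\<lambda>x. f x + g x)"
    using lin[of 1] by simp
  have n: "complex_of_real ((l2_norm (?V k))\<^sup>2) = (2 * pi * h) ^ DIM('a) * complex_of_real ((l2_norm k)\<^sup>2)" if "k \<in> L2" for k
    by (subst l2_norm_transform[OF phi h that]) simp
  have "4 * l2_inner (?V f) (?V g) = (2 * pi * h) ^ DIM('a) * (4 * l2_inner f g)"
    unfolding l2_inner_polarization[OF V[OF f] V[OF g]] l2_inner_polarization[OF f g] lin lin1
      n[OF L2_add[OF f g]] n[OF L2_add[OF f L2_scale[OF g]]]
    by (simp only: algebra_simps)
  then show ?thesis by simp
qed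

section \<open>Self-adjoint operators of closed forms\<close>

text \<open>Functions that agree almost everywhere are not identified, so the form may vanish on
  nonzero elements; definiteness is replaced by statements modulo null sets.\<close>

locale semi_inner =
  fixes V :: "('a \<Rightarrow> complex) set" and B :: "('a \<Rightarrow> complex) \<Rightarrow> ('a \<Rightarrow> complex) \<Rightarrow> complex"
  assumes zero: "(\<lambda>x. 0) \<in> V"
    and add: "\<And>f g. f \<in> V \<Longrightarrow> g \<in> V \<Longrightarrow> (\<lambda>x. f x + g x) \<in> V"
    and scale: "\<And>f c. f \<in> V \<Longrightarrow> (\<lambda>x. c * f x) \<in> V"
    and B_add: "\<And>f g k. f \<in> V \<Longrightarrow> g \<in> V \<Longrightarrow> k \<in> V \<Longrightarrow> B (\<lambda>x. f x + g x) k = B f k + B g k"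
    and B_scale: "\<And>f k c. f \<in> V \<Longrightarrow> k \<in> V \<Longrightarrow> B (\<lambda>x. c * f x) k = c * B f k"
    and B_herm: "\<And>f k. f \<in> V \<Longrightarrow> k \<in> V \<Longrightarrow> B k f = cnj (B f k)"
    and B_pos: "\<And>f. f \<in> V \<Longrightarrow> 0 \<le> Re (B f f)"
begin

lemma diff: "f \<in> V \<Longrightarrow> g \<in> V \<Longrightarrow> (\<lambda>x. f x - g x) \<in> V"
  using add[OF _ scale[of g "-1"], of f] by simp

lemma B_diff: "f \<in> V \<Longrightarrow> g \<in> V \<Longrightarrow> k \<in> V \<Longrightarrow> B (\<lambda>x. f x - g x) k = B f k - B g k"
  using B_add[OF _ scale[of g "-1"], of f k] B_scale[of g k "-1"] by simp

lemma B_add_right: "f \<in> V \<Longrightarrow> g \<in> V \<Longrightarrow> k \<in> V \<Longrightarrow> B k (\<lambda>x. f x + g x) = B k f + B k g"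
  using B_herm[of "\<lambda>x. f x + g x" k] B_herm[of f k] B_herm[of g k] by (simp add: B_add add)

lemma B_scale_right: "f \<in> V \<Longrightarrow> k \<in> V \<Longrightarrow> B k (\<lambda>x. c * f x) = cnj c * B k f"
  using B_herm[of "\<lambda>x. c * f x" k] B_herm[of f k] by (simp add: B_scale scale)

lemma expand:
  assumes "f \<in> V" and "g \<in> V"
  shows "Re (B (\<lambda>x. f x + c * g x) (\<lambda>x. f x + c * g x)) =
    Re (B f f) + (norm c)\<^sup>2 * Re (B g g) + 2 * Re (cnj c * B f g)"
proof -
  have "B (\<lambda>x. f x + c * g x) (\<lambda>x. f x + c * g x) = B f f + cnj c * B f g + c * (B g f + cnj c * B g g)"
    using assms by (simp add: B_add B_add_right B_scale B_scale_right add scale distrib_left)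
  also have "\<dots> = B f f + (cnj c * B f g + cnj (cnj c * B f g)) + (c * cnj c) * B g g"
    using B_herm[of f g] assms by (simp add: algebra_simps)
  also have "Re \<dots> = Re (B f f) + 2 * Re (cnj c * B f g) + (norm c)\<^sup>2 * Re (B g g)"
    by (simp add: complex_norm_square[symmetric] Re_complex_of_real)
  finally show ?thesis by simp
qed

text \<open>The discriminant argument, with the degenerate case apart: if \<open>B g g\<close> has
  real part 0, a large \<open>t\<close> makes the quadratic expression negative unless
  \<open>B f g\<close> vanishes.\<close>

lemma cauchy_schwarz:
  assumes f: "f \<in> V" and g: "g \<in> V"
  shows "(norm (B f g))\<^sup>2 \<le> Re (B f f) * Re (B g g)"
proof -
  let ?d = "norm (B f g)" and ?F = "Re (B f f)" and ?G = "Re (B g g)"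
  have q: "0 \<le> ?F + t\<^sup>2 * ?d\<^sup>2 * ?G - 2 * t * ?d\<^sup>2" for t :: real
  proof -
    let ?c = "- complex_of_real t * B f g"
    have "0 \<le> Re (B (\<lambda>x. f x + ?c * g x) (\<lambda>x. f x + ?c * g x))"
      by (intro B_pos add scale f g)
    also have "\<dots> = ?F + (norm ?c)\<^sup>2 * ?G + 2 * Re (cnj ?c * B f g)" by (rule expand[OF f g])
    also have "cnj ?c * B f g = complex_of_real (- t * ?d\<^sup>2)"
      by (simp add: complex_norm_square mult_ac del: of_real_power)
    finally show ?thesis by (simp add: norm_mult power_mult_distrib)
  qed
  show ?thesis
  proof (cases "?G = 0")
    case True
    have "?d\<^sup>2 \<le> 0"
    proof (rule ccontr)
      assume "\<not> ?d\<^sup>2 \<le> 0"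
      \<comment> \<open>With this \<open>t\<close> the expression equals \<open>- 1\<close>.\<close>
      then show False using q[of "(?F + 1) / (2 * ?d\<^sup>2)"] True by simp
    qed
    then show ?thesis using True by simp
  next
    case False
    then have G: "?G > 0" using B_pos[OF g] by simp
    have "0 \<le> ?F + (1 / ?G)\<^sup>2 * ?d\<^sup>2 * ?G - 2 * (1 / ?G) * ?d\<^sup>2" by (rule q)
    also have "\<dots> = ?F - ?d\<^sup>2 / ?G" using G by (simp add: power2_eq_square)
    finally show ?thesis using G by (simp add: pos_divide_le_eq)
  qed
qed

text \<open>The functional \<open>w \<mapsto> B w w - 2 Re (l w)\<close> is minimized over \<open>W\<close>. For \<open>W = V\<close> this is
  the Riesz representation theorem, for \<open>l = B _ g\<close> the orthogonal projection of \<open>g\<close> to the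
  closure of \<open>W\<close>.\<close>

lemma minimizer:
  fixes l :: "('a \<Rightarrow> complex) \<Rightarrow> complex"
  assumes complete: "\<And>F. (\<And>n. F n \<in> V) \<Longrightarrow>
      (\<And>e. 0 < e \<Longrightarrow> \<exists>n0. \<forall>m\<ge>n0. \<forall>n\<ge>n0. Re (B (\<lambda>x. F m x - F n x) (\<lambda>x. F m x - F n x)) < e) \<Longrightarrow>
      \<exists>f\<in>V. (\<lambda>n::nat. Re (B (\<lambda>x. F n x - f x) (\<lambda>x. F n x - f x))) \<longlonglongrightarrow> 0"
    and W: "W \<subseteq> V" and W0: "(\<lambda>x. 0) \<in> W"
    and Wadd: "\<And>f g. f \<in> W \<Longrightarrow> g \<in> W \<Longrightarrow> (\<lambda>x. f x + g x) \<in> W"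
    and Wscale: "\<And>f c. f \<in> W \<Longrightarrow> (\<lambda>x. c * f x) \<in> W"
    and l_add: "\<And>f g. f \<in> W \<Longrightarrow> g \<in> W \<Longrightarrow> l (\<lambda>x. f x + g x) = l f + l g"
    and l_scale: "\<And>f c. f \<in> W \<Longrightarrow> l (\<lambda>x. c * f x) = c * l f"
    and l_bound: "\<And>f. f \<in> W \<Longrightarrow> norm (l f) \<le> K * sqrt (Re (B f f))"
  shows "\<exists>v\<in>V. (\<forall>w\<in>W. B w v = l w) \<and>
    (\<exists>F. (\<forall>n. F n \<in> W) \<and> (\<lambda>n::nat. Re (B (\<lambda>x. F n x - v x) (\<lambda>x. F n x - v x))) \<longlonglongrightarrow> 0)"
proof -
  \<comment> \<open>If \<open>v\<close> represents \<open>l\<close>, then \<open>P w\<close> is the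
    squared distance from \<open>w\<close> to \<open>v\<close> minus a constant, so minimizing
    \<open>P\<close> approximates \<open>v\<close>.\<close>
  define P where "P = (\<lambda>w. Re (B w w) - 2 * Re (l w))"
  have Pb: "- K\<^sup>2 \<le> P w" if w: "w \<in> W" for w
  proof -
    define s where "s = sqrt (Re (B w w))"
    have "Re (B w w) = s\<^sup>2" using B_pos[of w] w W by (auto simp: s_def)
    moreover have "Re (l w) \<le> K * s"
      using l_bound[OF w] complex_Re_le_cmod[of "l w"] by (simp add: s_def)
    moreover have "2 * (K * s) \<le> s\<^sup>2 + K\<^sup>2"
      using zero_le_power2[of "s - K"] by (simp add: power2_diff mult_ac)
    ultimately show ?thesis unfolding P_def by linarith
  qed
  define m where "m = Inf (P ` W)"
  have bdd: "bdd_below (P ` W)" using Pb by (auto intro!: bdd_belowI[of _ "- K\<^sup>2"])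
  have mP: "m \<le> P w" if "w \<in> W" for w unfolding m_def using that bdd by (intro cInf_lower) auto
  have "\<exists>w\<in>W. P w < m + 1 / real (Suc n)" for n
    using cInf_lessD[of "P ` W" "m + 1 / real (Suc n)"] W0 by (auto simp: m_def[symmetric])
  then obtain F where FW: "\<And>n. F n \<in> W" and FP: "\<And>n. P (F n) < m + 1 / real (Suc n)" by metis
  \<comment> \<open>By the parallelogram law the left side is \<open>2 * P u + 2 * P v\<close> minus
    four times the value of \<open>P\<close> at the midpoint, which is at least \<open>m\<close>. A
    minimizing sequence is therefore Cauchy.\<close>
  have par: "Re (B (\<lambda>x. u x - v x) (\<lambda>x. u x - v x)) \<le> 2 * (P u - m) + 2 * (P v - m)" if u: "u \<in> W" and v: "v \<in> W" for u v
  proof -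
    have uv: "u \<in> V" "v \<in> V" using u v W by auto
    have hW: "(\<lambda>x. (1/2) * (u x + v x)) \<in> W" using u v Wadd Wscale by blast
    have uvV: "(\<lambda>x. u x + v x) \<in> V" using uv add by auto
    have "Re (B (\<lambda>x. u x - v x) (\<lambda>x. u x - v x)) = Re (B u u) + Re (B v v) - 2 * Re (B u v)"
      using expand[OF uv, of "-1"] by simp
    moreover have "Re (B (\<lambda>x. u x + v x) (\<lambda>x. u x + v x)) = Re (B u u) + Re (B v v) + 2 * Re (B u v)"
      using expand[OF uv, of 1] by simp
    moreover have "4 * P (\<lambda>x. (1/2) * (u x + v x)) = Re (B (\<lambda>x. u x + v x) (\<lambda>x. u x + v x)) - 4 * Re (l u) - 4 * Re (l v)"
      unfolding P_def l_scale[OF Wadd[OF u v]] l_add[OF u v] B_scale[OF uvV scale[OF uvV]] B_scale_right[OF uvV uvV]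
      by (simp add: field_simps)
    moreover have "m \<le> P (\<lambda>x. (1/2) * (u x + v x))" by (rule mP[OF hW])
    ultimately show ?thesis by (simp add: P_def)
  qed
  have "\<exists>v\<in>V. (\<lambda>n::nat. Re (B (\<lambda>x. F n x - v x) (\<lambda>x. F n x - v x))) \<longlonglongrightarrow> 0"
  proof (rule complete)
    fix e :: real assume "0 < e"
    then obtain n0 where n0: "1 / real (Suc n0) < e / 4" using nat_approx_posE[of "e / 4"] by auto
    show "\<exists>n0. \<forall>m\<ge>n0. \<forall>n\<ge>n0. Re (B (\<lambda>x. F m x - F n x) (\<lambda>x. F m x - F n x)) < e"
    proof (intro exI allI impI)
      fix i j assume ij: "n0 \<le> i" "n0 \<le> j"
      have "P (F k) < m + e / 4" if "n0 \<le> k" for k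
      proof -
        have "1 / real (Suc k) \<le> 1 / real (Suc n0)"
          using that by (intro divide_left_mono) auto
        with n0 have "m + 1 / real (Suc k) < m + e / 4" by (intro add_strict_left_mono) (rule le_less_trans)
        with FP[of k] show ?thesis by (rule less_trans)
      qed
      from this[OF ij(1)] this[OF ij(2)] have "2 * (P (F i) - m) + 2 * (P (F j) - m) < e"
        by simp
      with par[OF FW FW] show "Re (B (\<lambda>x. F i x - F j x) (\<lambda>x. F i x - F j x)) < e"
        by (rule le_less_trans)
    qed
  qed (use FW W in auto)
  then obtain v where v: "v \<in> V" and lim: "(\<lambda>n. Re (B (\<lambda>x. F n x - v x) (\<lambda>x. F n x - v x))) \<longlonglongrightarrow> 0" by blast
  \<comment> \<open>\<open>v\<close> need not lie in \<open>W\<close>, so the variation is carried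
    out at the points \<open>F n\<close> of \<open>W\<close> and then passed to the limit.\<close>
  have Bw: "B w v = l w" if w: "w \<in> W" for w
  proof (rule ccontr)
    assume "B w v \<noteq> l w"
    define d where "d = B w v - l w"
    have d: "norm d > 0" using \<open>B w v \<noteq> l w\<close> by (simp add: d_def)
    have wV: "w \<in> V" using w W by auto
    have FV: "F n \<in> V" for n using FW W by auto
    have "(\<lambda>n. B (F n) w) \<longlonglongrightarrow> B v w"
    proof -
      have "(\<lambda>n. norm (B (F n) w - B v w)) \<longlonglongrightarrow> 0"
      proof (rule tendsto_sandwich[OF _ _ tendsto_const])
        show "\<forall>\<^sub>F n in sequentially. norm (B (F n) w - B v w) \<le>
           sqrt (Re (B (\<lambda>x. F n x - v x) (\<lambda>x. F n x - v x)) * Re (B w w))"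
        proof (intro always_eventually allI)
          fix n
          have "(norm (B (F n) w - B v w))\<^sup>2 \<le> Re (B (\<lambda>x. F n x - v x) (\<lambda>x. F n x - v x)) * Re (B w w)"
            using cauchy_schwarz[OF diff[OF FV v] wV, of n] by (simp add: B_diff FV v wV)
          then show "norm (B (F n) w - B v w) \<le> sqrt (Re (B (\<lambda>x. F n x - v x) (\<lambda>x. F n x - v x)) * Re (B w w))"
            by (rule real_le_rsqrt)
        qed
        have "(\<lambda>n. sqrt (Re (B (\<lambda>x. F n x - v x) (\<lambda>x. F n x - v x)) * Re (B w w))) \<longlonglongrightarrow> sqrt (0 * Re (B w w))"
          by (intro tendsto_intros lim)
        then show "(\<lambda>n. sqrt (Re (B (\<lambda>x. F n x - v x) (\<lambda>x. F n x - v x)) * Re (B w w))) \<longlonglongrightarrow> 0" by simp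
      qed simp
      then show ?thesis by (simp only: tendsto_norm_zero_iff flip: Lim_null)
    qed
    \<comment> \<open>Small enough for the linear gain in the direction \<open>c\<close> to outweigh
      the quadratic term; the summand 1 covers \<open>Re (B w w) = 0\<close>.\<close>
    define t where "t = 1 / (1 + Re (B w w))"
    have t: "t > 0" "t * Re (B w w) < 1" using B_pos[OF wV] by (auto simp: t_def divide_simps)
    define c where "c = - complex_of_real t * cnj d"
    have ineq: "- (1 / real (Suc n)) \<le> (norm c)\<^sup>2 * Re (B w w) + 2 * Re (cnj c * B (F n) w) - 2 * Re (c * l w)" for n
    proof -
      have cw: "(\<lambda>x. c * w x) \<in> W" by (rule Wscale[OF w])
      have "m \<le> P (\<lambda>x. F n x + c * w x)" by (rule mP[OF Wadd[OF FW cw]])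
      then show ?thesis
        using FP[of n] unfolding P_def l_add[OF FW cw] l_scale[OF w] expand[OF FV wV] by simp
    qed
    have "(\<lambda>n. - (1 / real (Suc n))) \<longlonglongrightarrow> - 0" by (intro tendsto_minus LIMSEQ_Suc[OF lim_1_over_n])
    moreover have "(\<lambda>n. (norm c)\<^sup>2 * Re (B w w) + 2 * Re (cnj c * B (F n) w) - 2 * Re (c * l w)) \<longlonglongrightarrow>
       (norm c)\<^sup>2 * Re (B w w) + 2 * Re (cnj c * B v w) - 2 * Re (c * l w)"
      by (intro tendsto_intros \<open>(\<lambda>n. B (F n) w) \<longlonglongrightarrow> B v w\<close>)
    ultimately have "- 0 \<le> (norm c)\<^sup>2 * Re (B w w) + 2 * Re (cnj c * B v w) - 2 * Re (c * l w)"
      by (rule LIMSEQ_le) (use ineq in auto)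
    also have "Re (cnj c * B v w) = Re (c * B w v)"
      using B_herm[OF v wV] by (metis complex_cnj_cnj complex_cnj_mult complex_cnj_cnj cnj.simps(1))
    finally have "0 \<le> (norm c)\<^sup>2 * Re (B w w) + 2 * Re (c * d)"
      by (simp add: d_def right_diff_distrib)
    also have "c * d = complex_of_real (- t * (norm d)\<^sup>2)"
      by (simp add: c_def complex_norm_square mult_ac del: of_real_power)
    also have "(norm c)\<^sup>2 = t\<^sup>2 * (norm d)\<^sup>2" by (simp add: c_def norm_mult power_mult_distrib)
    finally have "0 \<le> t * (norm d)\<^sup>2 * (t * Re (B w w) - 2)"
      by (simp add: power2_eq_square algebra_simps)
    moreover have "t * (norm d)\<^sup>2 * (t * Re (B w w) - 2) < 0"
      using t d by (intro mult_pos_neg) auto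
    ultimately show False by simp
  qed
  show ?thesis using v Bw FW lim by blast
qed

end

section \<open>From a closed form to its operator and the bottom of its spectrum\<close>

interpretation L2: semi_inner "L2 :: ('a::euclidean_space \<Rightarrow> complex) set" l2_inner
proof
  show "0 \<le> Re (l2_inner f f)" for f :: "'a \<Rightarrow> complex" by (simp add: l2_inner_self)
qed (auto intro: L2_zero L2_add L2_scale l2_inner_add l2_inner_commute simp: l2_inner_scale)

text \<open>\<open>closed\<close> is completeness of \<open>D\<close> for the form norm,
  \<open>total\<close> expresses density of \<open>D\<close> through its orthogonal complement, and
  \<open>nontrivial\<close> makes the set of unit vectors, over which the form is minimized,
  nonempty.\<close>

locale closed_form =
  fixes D :: "('a::euclidean_space \<Rightarrow> complex) set" and q :: "('a \<Rightarrow> complex) \<Rightarrow> ('a \<Rightarrow> complex) \<Rightarrow> complex"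
  assumes semi: "semi_inner D q"
    and D_L2: "D \<subseteq> L2"
    and D_AE: "\<And>f f'. f \<in> D \<Longrightarrow> f' \<in> L2 \<Longrightarrow> (AE x in lborel. f' x = f x) \<Longrightarrow> f' \<in> D"
    and q_AE: "\<And>f f' g. f \<in> D \<Longrightarrow> f' \<in> D \<Longrightarrow> g \<in> D \<Longrightarrow> (AE x in lborel. f' x = f x) \<Longrightarrow> q f' g = q f g"
    and closed: "\<And>F. (\<And>n. F n \<in> D) \<Longrightarrow>
      (\<And>e. 0 < e \<Longrightarrow> \<exists>n0. \<forall>m\<ge>n0. \<forall>n\<ge>n0.
         Re (q (\<lambda>x. F m x - F n x) (\<lambda>x. F m x - F n x)) + (l2_norm (\<lambda>x. F m x - F n x))\<^sup>2 < e) \<Longrightarrow>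
      \<exists>f\<in>D. (\<lambda>n::nat. Re (q (\<lambda>x. F n x - f x) (\<lambda>x. F n x - f x)) + (l2_norm (\<lambda>x. F n x - f x))\<^sup>2) \<longlonglongrightarrow> 0"
    and total: "\<And>u. u \<in> L2 \<Longrightarrow> (\<And>g. g \<in> D \<Longrightarrow> l2_inner u g = 0) \<Longrightarrow> AE x in lborel. u x = 0"
    and nontrivial: "\<exists>f\<in>D. l2_norm f = 1"
begin

sublocale D: semi_inner D q by (rule semi)

lemma DL: "f \<in> D \<Longrightarrow> f \<in> L2" using D_L2 by auto

text \<open>The operator of the first representation theorem. Collecting all pairs compatible with
  \<open>q\<close> makes it the largest candidate, on which uniqueness in
  \<open>the_assoc_op\<close> rests.\<close>

definition assoc_op :: "'a l2_op" where
  "assoc_op = {(f, u). f \<in> D \<and> u \<in> L2 \<and> (\<forall>g\<in>D. l2_inner u g = q f g)}"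

text \<open>The shift takes both signs: 1 for the resolvent at -1, and minus the spectral parameter
  for points at or below the bottom of the form.\<close>

lemma shifted_semi_inner:
  assumes "\<And>f. f \<in> D \<Longrightarrow> 0 \<le> Re (q f f) + s * (l2_norm f)\<^sup>2"
  shows "semi_inner D (\<lambda>f g. q f g + complex_of_real s * l2_inner f g)"
proof
  show "(\<lambda>x. 0) \<in> D" by (rule D.zero)
  fix f g k :: "'a \<Rightarrow> complex" and c :: complex
  assume f: "f \<in> D"
  show "(\<lambda>x. c * f x) \<in> D" by (rule D.scale[OF f])
  show "0 \<le> Re (q f f + complex_of_real s * l2_inner f f)"
    using assms[OF f] by (simp add: l2_inner_self)
  {
    assume k: "k \<in> D"
    show "q (\<lambda>x. c * f x) k + complex_of_real s * l2_inner (\<lambda>x. c * f x) k = c * (q f k + complex_of_real s * l2_inner f k)"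
      by (simp add: D.B_scale f k l2_inner_scale algebra_simps)
    show "q k f + complex_of_real s * l2_inner k f = cnj (q f k + complex_of_real s * l2_inner f k)"
      using D.B_herm[OF f k] l2_inner_commute[of k f] by simp
  }
  assume g: "g \<in> D"
  show "(\<lambda>x. f x + g x) \<in> D" by (rule D.add[OF f g])
  assume k: "k \<in> D"
  show "q (\<lambda>x. f x + g x) k + complex_of_real s * l2_inner (\<lambda>x. f x + g x) k =
     q f k + complex_of_real s * l2_inner f k + (q g k + complex_of_real s * l2_inner g k)"
    by (simp add: D.B_add f g k l2_inner_add DL algebra_simps)
qed

text \<open>Riesz representation for the shifted form, which solves \<open>(A + s) f = k\<close>.
  Coercivity makes the shifted norm equivalent to the form norm, and so \<open>D\<close> complete
  for it; \<open>up\<close> and \<open>down\<close> are the two halves of the equivalence.\<close>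

lemma solve:
  assumes kap: "0 < \<kappa>" and coercive: "\<And>f. f \<in> D \<Longrightarrow> \<kappa> * (l2_norm f)\<^sup>2 \<le> Re (q f f) + s * (l2_norm f)\<^sup>2"
    and k: "k \<in> L2"
  shows "\<exists>f. (f, \<lambda>x. k x - complex_of_real s * f x) \<in> assoc_op"
proof -
  let ?B = "\<lambda>f g. q f g + complex_of_real s * l2_inner f g"
  interpret S: semi_inner D ?B
  proof (rule shifted_semi_inner)
    fix f assume "f \<in> D"
    then show "0 \<le> Re (q f f) + s * (l2_norm f)\<^sup>2"
      using order_trans[OF mult_nonneg_nonneg[OF less_imp_le[OF kap] zero_le_power2] coercive] by blast
  qed
  have n: "Re (?B f f) = Re (q f f) + s * (l2_norm f)\<^sup>2" for f by (simp add: l2_inner_self)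
  \<comment> \<open>The form norm exceeds the shifted form by \<open>1 - s\<close> times the squared
    norm, and coercivity bounds the squared norm by the shifted form divided by
    \<open>\<kappa>\<close>.\<close>
  define K where "K = 1 + (\<bar>s\<bar> + 1) / \<kappa>"
  have K: "K > 0" using kap by (simp add: K_def add_pos_nonneg)
  have up: "Re (q f f) + (l2_norm f)\<^sup>2 \<le> K * Re (?B f f)" if f: "f \<in> D" for f
  proof -
    have 1: "(l2_norm f)\<^sup>2 \<le> Re (?B f f) / \<kappa>"
      using coercive[OF f] kap unfolding n by (simp add: pos_le_divide_eq mult.commute)
    have "Re (q f f) + (l2_norm f)\<^sup>2 = Re (?B f f) + (1 - s) * (l2_norm f)\<^sup>2" unfolding n by (simp add: algebra_simps)
    also have "\<dots> \<le> Re (?B f f) + (\<bar>s\<bar> + 1) * (l2_norm f)\<^sup>2" by (intro add_left_mono mult_right_mono) auto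
    also have "\<dots> \<le> Re (?B f f) + (\<bar>s\<bar> + 1) * (Re (?B f f) / \<kappa>)" by (intro add_left_mono mult_left_mono 1) auto
    also have "\<dots> = K * Re (?B f f)" by (simp add: K_def distrib_right)
    finally show ?thesis .
  qed
  have down: "Re (?B f f) \<le> (1 + \<bar>s\<bar>) * (Re (q f f) + (l2_norm f)\<^sup>2)" if f: "f \<in> D" for f
  proof -
    have "0 \<le> Re (q f f)" by (rule D.B_pos[OF f])
    then have "Re (q f f) \<le> (1 + \<bar>s\<bar>) * Re (q f f)" by (simp add: distrib_right)
    moreover have "s * (l2_norm f)\<^sup>2 \<le> (1 + \<bar>s\<bar>) * (l2_norm f)\<^sup>2" by (intro mult_right_mono) auto
    ultimately show ?thesis unfolding n distrib_left by linarith
  qed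
  have "\<exists>v\<in>D. (\<forall>w\<in>D. ?B w v = l2_inner w k) \<and>
    (\<exists>F. (\<forall>n. F n \<in> D) \<and> (\<lambda>n::nat. Re (?B (\<lambda>x. F n x - v x) (\<lambda>x. F n x - v x))) \<longlonglongrightarrow> 0)"
  proof (rule S.minimizer[where K="l2_norm k / sqrt \<kappa>"])
    fix F :: "nat \<Rightarrow> 'a \<Rightarrow> complex"
    assume FD: "\<And>n. F n \<in> D"
      and C: "\<And>e. 0 < e \<Longrightarrow> \<exists>n0. \<forall>m\<ge>n0. \<forall>n\<ge>n0. Re (?B (\<lambda>x. F m x - F n x) (\<lambda>x. F m x - F n x)) < e"
    have "\<exists>f\<in>D. (\<lambda>n::nat. Re (q (\<lambda>x. F n x - f x) (\<lambda>x. F n x - f x)) + (l2_norm (\<lambda>x. F n x - f x))\<^sup>2) \<longlonglongrightarrow> 0"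
    proof (rule closed[OF FD])
      fix e :: real assume "0 < e"
      then have "0 < e / K" using K by simp
      from C[OF this] obtain n0 where n0: "\<And>i j. i \<ge> n0 \<Longrightarrow> j \<ge> n0 \<Longrightarrow> Re (?B (\<lambda>x. F i x - F j x) (\<lambda>x. F i x - F j x)) < e / K"
        by blast
      show "\<exists>n0. \<forall>m\<ge>n0. \<forall>n\<ge>n0. Re (q (\<lambda>x. F m x - F n x) (\<lambda>x. F m x - F n x)) + (l2_norm (\<lambda>x. F m x - F n x))\<^sup>2 < e"
      proof (intro exI allI impI)
        fix i j assume "n0 \<le> i" "n0 \<le> j"
        then have "K * Re (?B (\<lambda>x. F i x - F j x) (\<lambda>x. F i x - F j x)) < e"
          using n0[of i j] K by (simp add: pos_less_divide_eq mult.commute)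
        then show "Re (q (\<lambda>x. F i x - F j x) (\<lambda>x. F i x - F j x)) + (l2_norm (\<lambda>x. F i x - F j x))\<^sup>2 < e"
          using up[OF D.diff[OF FD FD], of i j] by linarith
      qed
    qed
    then obtain f where f: "f \<in> D" and lim: "(\<lambda>n. Re (q (\<lambda>x. F n x - f x) (\<lambda>x. F n x - f x)) + (l2_norm (\<lambda>x. F n x - f x))\<^sup>2) \<longlonglongrightarrow> 0"
      by blast
    have "(\<lambda>n. Re (?B (\<lambda>x. F n x - f x) (\<lambda>x. F n x - f x))) \<longlonglongrightarrow> 0"
    proof (rule tendsto_sandwich[OF _ _ tendsto_const])
      show "\<forall>\<^sub>F n in sequentially. 0 \<le> Re (?B (\<lambda>x. F n x - f x) (\<lambda>x. F n x - f x))"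
        by (intro always_eventually allI S.B_pos D.diff FD f)
      show "\<forall>\<^sub>F n in sequentially. Re (?B (\<lambda>x. F n x - f x) (\<lambda>x. F n x - f x)) \<le>
         (1 + \<bar>s\<bar>) * (Re (q (\<lambda>x. F n x - f x) (\<lambda>x. F n x - f x)) + (l2_norm (\<lambda>x. F n x - f x))\<^sup>2)"
        by (intro always_eventually allI down D.diff FD f)
      show "(\<lambda>n. (1 + \<bar>s\<bar>) * (Re (q (\<lambda>x. F n x - f x) (\<lambda>x. F n x - f x)) + (l2_norm (\<lambda>x. F n x - f x))\<^sup>2)) \<longlonglongrightarrow> 0"
        using tendsto_mult_left[OF lim, of "1 + \<bar>s\<bar>"] by simp
    qed
    then show "\<exists>f\<in>D. (\<lambda>n. Re (?B (\<lambda>x. F n x - f x) (\<lambda>x. F n x - f x))) \<longlonglongrightarrow> 0" using f by blast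
  next
    fix f assume f: "f \<in> D"
    have "norm (l2_inner f k) \<le> l2_norm k * l2_norm f"
      using l2_cauchy_schwarz[OF DL[OF f] k] by (simp add: mult.commute)
    also have "l2_norm f \<le> sqrt (Re (?B f f) / \<kappa>)"
      using coercive[OF f] kap unfolding n by (intro real_le_rsqrt) (simp add: pos_le_divide_eq mult.commute)
    finally show "norm (l2_inner f k) \<le> l2_norm k / sqrt \<kappa> * sqrt (Re (?B f f))"
      by (simp add: real_sqrt_divide mult_left_mono l2_norm_nonneg)
  qed (auto intro: D.zero D.add D.scale l2_inner_add DL k simp: l2_inner_scale)
  then obtain f where f: "f \<in> D" and fB: "\<And>w. w \<in> D \<Longrightarrow> ?B w f = l2_inner w k" by blast
  have "l2_inner (\<lambda>x. k x - complex_of_real s * f x) g = q f g" if g: "g \<in> D" for g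
  proof -
    have "?B f g = cnj (?B g f)" by (rule S.B_herm[OF g f])
    also have "\<dots> = l2_inner k g" unfolding fB[OF g] by (rule l2_inner_commute[symmetric])
    finally show ?thesis
      by (simp add: l2_inner_diff k L2_scale DL f g l2_inner_scale algebra_simps)
  qed
  then have "(f, \<lambda>x. k x - complex_of_real s * f x) \<in> assoc_op"
    using f L2_diff[OF k L2_scale[OF DL[OF f]]] by (simp add: assoc_op_def)
  then show ?thesis by (intro exI)
qed

lemma assoc_opD:
  assumes "(f, u) \<in> assoc_op"
  shows "f \<in> D" "u \<in> L2" "\<And>g. g \<in> D \<Longrightarrow> l2_inner u g = q f g"
  using assms by (auto simp: assoc_op_def)

lemma assoc_op_linear: "linear_operator assoc_op"
  unfolding linear_operator_def
proof (intro conjI allI impI)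
  show "assoc_op \<subseteq> L2 \<times> L2" using DL by (auto simp: assoc_op_def)
  show "((\<lambda>x. 0), (\<lambda>x. 0)) \<in> assoc_op"
    using D.zero L2_zero D.B_scale[of "\<lambda>x. 0" _ 0] by (auto simp: assoc_op_def l2_inner_def)
next
  fix f u f' u'
  assume a: "(f, u) \<in> assoc_op \<and> f' \<in> L2 \<and> u' \<in> L2 \<and> (AE x in lborel. f' x = f x) \<and> (AE x in lborel. u' x = u x)"
  note A = assoc_opD[of f u]
  have f': "f' \<in> D" using D_AE[of f f'] a A by auto
  have "l2_inner u' g = q f' g" if g: "g \<in> D" for g
  proof -
    have "l2_inner u' g = l2_inner u g"
      by (rule l2_inner_cong_AE) (use a A DL g in auto)
    also have "\<dots> = q f' g" using q_AE[of f f' g] a A g f' by auto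
    finally show ?thesis .
  qed
  then show "(f', u') \<in> assoc_op" using f' a by (auto simp: assoc_op_def)
next
  fix f u v assume a: "(f, u) \<in> assoc_op \<and> (f, v) \<in> assoc_op"
  then have L: "u \<in> L2" "v \<in> L2" by (auto dest: assoc_opD)
  have "AE x in lborel. u x - v x = 0"
  proof (rule total[OF L2_diff[OF L]])
    fix g assume g: "g \<in> D"
    then show "l2_inner (\<lambda>x. u x - v x) g = 0"
      using a assoc_opD(3)[of f u g] assoc_opD(3)[of f v g] by (simp add: l2_inner_diff L DL)
  qed
  then show "AE x in lborel. u x = v x" by eventually_elim simp
next
  fix f u g v assume a: "(f, u) \<in> assoc_op \<and> (g, v) \<in> assoc_op"
  then show "(\<lambda>x. f x + g x, \<lambda>x. u x + v x) \<in> assoc_op"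
    by (auto simp: assoc_op_def D.add L2_add l2_inner_add DL D.B_add)
next
  fix c f u assume a: "(f, u) \<in> assoc_op"
  then show "(\<lambda>x. c * f x, \<lambda>x. c * u x) \<in> assoc_op"
    by (auto simp: assoc_op_def D.scale L2_scale l2_inner_scale D.B_scale)
qed

lemma assoc_op_symmetric:
  assumes "(f, u) \<in> assoc_op" and "(g, v) \<in> assoc_op"
  shows "l2_inner u g = l2_inner f v"
proof -
  have "l2_inner u g = cnj (q g f)"
    using assoc_opD[OF assms(1)] assoc_opD[OF assms(2)] D.B_herm[of g f] by auto
  also have "q g f = l2_inner v f" using assoc_opD[OF assms(1)] assoc_opD[OF assms(2)] by auto
  finally show ?thesis by (simp only: l2_inner_commute[of f v])
qed

lemma resolvent_minus_one:
  assumes "k \<in> L2"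
  obtains f u where "(f, u) \<in> assoc_op" and "\<And>x. u x + f x = k x"
proof -
  have "1 * (l2_norm f)\<^sup>2 \<le> Re (q f f) + 1 * (l2_norm f)\<^sup>2" if "f \<in> D" for f
    using D.B_pos[OF that] by simp
  from solve[OF zero_less_one this assms] show ?thesis using that by fastforce
qed

text \<open>With \<open>k = (A + 1) f\<close>, pairing with \<open>f\<close> gives
  \<open>q f f + l2_inner f f = 0\<close>, so both terms vanish; then \<open>A f\<close> is null by
  Cauchy-Schwarz for \<open>q\<close> and \<open>total\<close>. This is the step towards density:
  only null functions are orthogonal to the domain.\<close>

lemma assoc_op_range_orthogonal:
  assumes k: "k \<in> L2" and orth: "\<And>f u. (f, u) \<in> assoc_op \<Longrightarrow> l2_inner f k = 0"
  shows "AE x in lborel. k x = 0"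
proof -
  obtain f u where fu: "(f, u) \<in> assoc_op" and kx: "\<And>x. u x + f x = k x"
    using resolvent_minus_one[OF k] by metis
  note A = assoc_opD[OF fu]
  have "l2_inner k f = 0" using orth[OF fu] l2_inner_commute[of k f] by simp
  moreover have "l2_inner k f = q f f + l2_inner f f"
    using l2_inner_add[of u f f] A DL[of f] by (simp add: kx)
  ultimately have "q f f + l2_inner f f = 0" by simp
  then have "Re (q f f + l2_inner f f) = 0" by simp
  then have "Re (q f f) + (l2_norm f)\<^sup>2 = 0" by (simp add: l2_inner_self)
  then have 0: "Re (q f f) = 0" "l2_norm f = 0"
    using D.B_pos[OF A(1)] by (auto simp: add_nonneg_eq_0_iff)
  have "AE x in lborel. u x = 0"
  proof (rule total[OF A(2)])
    fix g assume g: "g \<in> D"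
    show "l2_inner u g = 0" using D.cauchy_schwarz[OF A(1) g] 0 A(3)[OF g] by simp
  qed
  moreover have "AE x in lborel. f x = 0" using 0 DL[OF A(1)] by (intro l2_norm_eq_0_AE)
  ultimately show ?thesis by eventually_elim (simp flip: kx)
qed

text \<open>The projection \<open>v\<close> of \<open>g\<close> to the closure of the domain differs
  from \<open>g\<close> by an element orthogonal to the domain, which is null. The sequence that
  approximates \<open>v\<close> therefore approximates \<open>g\<close>.\<close>

lemma assoc_op_dense: "densely_defined assoc_op"
  unfolding densely_defined_def
proof (intro ballI allI impI)
  fix g :: "'a \<Rightarrow> complex" and e :: real assume g: "g \<in> L2" and e: "0 < e"
  let ?W = "Domain assoc_op"
  have lin: "\<And>f u f' u'. (f, u) \<in> assoc_op \<Longrightarrow> (f', u') \<in> assoc_op \<Longrightarrow> (\<lambda>x. f x + f' x, \<lambda>x. u x + u' x) \<in> assoc_op"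
    "\<And>c f u. (f, u) \<in> assoc_op \<Longrightarrow> (\<lambda>x. c * f x, \<lambda>x. c * u x) \<in> assoc_op"
    "((\<lambda>x. 0), (\<lambda>x. 0)) \<in> assoc_op"
    using assoc_op_linear unfolding linear_operator_def by blast+
  have WL: "?W \<subseteq> L2" using DL by (auto dest: assoc_opD)
  have "\<exists>v\<in>L2. (\<forall>w\<in>?W. l2_inner w v = l2_inner w g) \<and>
    (\<exists>F. (\<forall>n. F n \<in> ?W) \<and> (\<lambda>n::nat. Re (l2_inner (\<lambda>x. F n x - v x) (\<lambda>x. F n x - v x))) \<longlonglongrightarrow> 0)"
  proof (rule L2.minimizer[where K="l2_norm g"])
    fix F :: "nat \<Rightarrow> 'a \<Rightarrow> complex"
    assume FL: "\<And>n. F n \<in> L2"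
      and C: "\<And>e. 0 < e \<Longrightarrow> \<exists>n0. \<forall>m\<ge>n0. \<forall>n\<ge>n0. Re (l2_inner (\<lambda>x. F m x - F n x) (\<lambda>x. F m x - F n x)) < e"
    have "\<exists>f\<in>L2. (\<lambda>n. l2_norm (\<lambda>x. F n x - f x)) \<longlonglongrightarrow> 0"
    proof (rule L2_complete[OF FL])
      fix e :: real assume e: "0 < e"
      then have "0 < e\<^sup>2" by simp
      from C[OF this] obtain n0 where n0: "\<And>m n. n0 \<le> m \<Longrightarrow> n0 \<le> n \<Longrightarrow> (l2_norm (\<lambda>x. F m x - F n x))\<^sup>2 < e\<^sup>2"
        by (auto simp: l2_inner_self)
      show "\<exists>n0. \<forall>m\<ge>n0. \<forall>n\<ge>n0. l2_norm (\<lambda>x. F m x - F n x) < e"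
        using n0 e by (intro exI[of _ n0] allI impI power2_less_imp_less[OF n0]) auto
    qed
    then obtain f where f: "f \<in> L2" "(\<lambda>n. l2_norm (\<lambda>x. F n x - f x)) \<longlonglongrightarrow> 0" by blast
    from tendsto_power[OF f(2), of 2] have "(\<lambda>n. Re (l2_inner (\<lambda>x. F n x - f x) (\<lambda>x. F n x - f x))) \<longlonglongrightarrow> 0"
      by (simp add: l2_inner_self)
    then show "\<exists>f\<in>L2. (\<lambda>n. Re (l2_inner (\<lambda>x. F n x - f x) (\<lambda>x. F n x - f x))) \<longlonglongrightarrow> 0" using f by blast
  next
    fix f assume "f \<in> ?W"
    then have "f \<in> L2" using WL by auto
    then show "norm (l2_inner f g) \<le> l2_norm g * sqrt (Re (l2_inner f f))"
      using l2_cauchy_schwarz[of f g] g l2_norm_nonneg[of f] by (simp add: l2_inner_self mult.commute)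
  next
    fix f f' assume "f \<in> ?W" "f' \<in> ?W"
    then show "(\<lambda>x. f x + f' x) \<in> ?W" "l2_inner (\<lambda>x. f x + f' x) g = l2_inner f g + l2_inner f' g"
      using lin(1) WL g by (blast, blast intro: l2_inner_add)
  next
    fix f c assume "f \<in> ?W"
    then show "(\<lambda>x. c * f x) \<in> ?W" using lin(2) by blast
  qed (use WL lin(3) in \<open>auto simp: l2_inner_scale\<close>)
  then obtain v F where v: "v \<in> L2" and vW: "\<And>w. w \<in> ?W \<Longrightarrow> l2_inner w v = l2_inner w g"
    and FW: "\<And>n. F n \<in> ?W" and lim: "(\<lambda>n::nat. Re (l2_inner (\<lambda>x. F n x - v x) (\<lambda>x. F n x - v x))) \<longlonglongrightarrow> 0"
    by blast
  have "AE x in lborel. g x - v x = 0"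
  proof (rule assoc_op_range_orthogonal[OF L2_diff[OF g v]])
    fix f u assume fu: "(f, u) \<in> assoc_op"
    then have f: "f \<in> L2" using DL by (auto dest: assoc_opD)
    have "l2_inner f v = l2_inner f g" using vW fu by blast
    then have "l2_inner (\<lambda>x. g x - v x) f = 0"
      using l2_inner_commute[of f v] l2_inner_commute[of f g] by (simp add: l2_inner_diff g v f)
    then show "l2_inner f (\<lambda>x. g x - v x) = 0" by (subst l2_inner_commute) simp
  qed
  then have gv: "AE x in lborel. F n x - g x = F n x - v x" for n by eventually_elim simp
  have FL: "F n \<in> L2" for n using FW WL by auto
  have "l2_norm (\<lambda>x. F n x - g x) = l2_norm (\<lambda>x. F n x - v x)" for n
    by (rule l2_norm_cong_AE[OF _ _ gv]) (intro L2_diff FL g v)+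
  then have "(\<lambda>n. (l2_norm (\<lambda>x. F n x - g x))\<^sup>2) \<longlonglongrightarrow> 0" using lim by (simp add: l2_inner_self)
  from LIMSEQ_D[OF this, of "e\<^sup>2"] e obtain n where "(l2_norm (\<lambda>x. F n x - g x))\<^sup>2 < e\<^sup>2" by auto
  then have "l2_norm (\<lambda>x. F n x - g x) < e" by (rule power2_less_imp_less) (use e in simp)
  then show "\<exists>f\<in>?W. l2_norm (\<lambda>x. f x - g x) < e" using FW by blast
qed

text \<open>A symmetric operator \<open>A\<close> with \<open>A + 1\<close> onto is self-adjoint: an
  element \<open>(g, w)\<close> of the adjoint is compared with the solution \<open>f0\<close> of
  \<open>(A + 1) f0 = w + g\<close>.\<close>

lemma assoc_op_self_adjoint: "self_adjoint assoc_op"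
  unfolding self_adjoint_def
proof (intro conjI assoc_op_linear assoc_op_dense equalityI subsetI)
  fix p assume "p \<in> assoc_op"
  then show "p \<in> adjoint_op assoc_op"
    using DL by (cases p) (auto simp: adjoint_op_def assoc_op_symmetric dest: assoc_opD)
next
  fix p assume "p \<in> adjoint_op assoc_op"
  then obtain g w where p: "p = (g, w)" and g: "g \<in> L2" and w: "w \<in> L2"
    and "\<forall>(f, u)\<in>assoc_op. l2_inner u g = l2_inner f w"
    by (auto simp: adjoint_op_def)
  then have adj: "l2_inner u g = l2_inner f w" if "(f, u) \<in> assoc_op" for f u using that by auto
  obtain f0 u0 where 0: "(f0, u0) \<in> assoc_op" and eq: "\<And>x. u0 x + f0 x = w x + g x"
    using resolvent_minus_one[OF L2_add[OF w g]] by metis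
  have f0: "f0 \<in> L2" and u0: "u0 \<in> L2" using 0 DL by (auto dest: assoc_opD)
  have diff: "(\<lambda>x. g x - f0 x) \<in> L2" by (rule L2_diff[OF g f0])
  \<comment> \<open>Writing \<open>g - f0\<close> itself as \<open>(A + 1) f\<close> makes its
    squared norm computable from the adjoint relation and the symmetry of \<open>A\<close>; it is
    0.\<close>
  obtain f u where fu: "(f, u) \<in> assoc_op" and fux: "\<And>x. u x + f x = g x - f0 x"
    using resolvent_minus_one[OF diff] by metis
  have f: "f \<in> L2" and u: "u \<in> L2" using fu DL by (auto dest: assoc_opD)
  have right: "l2_inner f (\<lambda>x. a x + b x) = l2_inner f a + l2_inner f b" if "a \<in> L2" "b \<in> L2" for a b
    using L2.B_add_right[OF that f] .
  have "l2_inner (\<lambda>x. u x + f x) g = l2_inner (\<lambda>x. u x + f x) f0"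
  proof -
    have "l2_inner (\<lambda>x. u x + f x) g = l2_inner f (\<lambda>x. w x + g x)"
      by (simp add: l2_inner_add u f g right w adj[OF fu])
    also have "\<dots> = l2_inner f (\<lambda>x. u0 x + f0 x)" by (simp only: eq)
    also have "\<dots> = l2_inner (\<lambda>x. u x + f x) f0"
      by (simp add: l2_inner_add u f f0 right u0 assoc_op_symmetric[OF fu 0])
    finally show ?thesis .
  qed
  then have "l2_inner g (\<lambda>x. g x - f0 x) = l2_inner f0 (\<lambda>x. g x - f0 x)"
    using l2_inner_commute[of g "\<lambda>x. g x - f0 x"] l2_inner_commute[of f0 "\<lambda>x. g x - f0 x"] by (simp add: fux)
  then have "l2_inner (\<lambda>x. g x - f0 x) (\<lambda>x. g x - f0 x) = 0"
    by (simp add: l2_inner_diff g f0 diff)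
  then have "l2_norm (\<lambda>x. g x - f0 x) = 0" by (simp add: l2_inner_self)
  from l2_norm_eq_0_AE[OF diff this] have ae: "AE x in lborel. g x = f0 x" by eventually_elim simp
  moreover from this have "AE x in lborel. w x = u0 x"
  proof eventually_elim
    case (elim x)
    then show ?case using eq[of x] by simp
  qed
  ultimately show "p \<in> assoc_op"
    using assoc_op_linear 0 g w unfolding linear_operator_def p by blast
qed

text \<open>A competitor is contained in \<open>assoc_op\<close>. Passing to adjoints reverses the
  inclusion, and both operators are their own adjoints.\<close>

lemma the_assoc_op:
  "(THE A. self_adjoint A \<and> Domain A \<subseteq> D \<and> (\<forall>(f, u)\<in>A. \<forall>g\<in>D. l2_inner u g = q f g)) = assoc_op"
proof (rule the_equality)
  show "self_adjoint assoc_op \<and> Domain assoc_op \<subseteq> D \<and> (\<forall>(f, u)\<in>assoc_op. \<forall>g\<in>D. l2_inner u g = q f g)"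
    using assoc_op_self_adjoint by (auto simp: assoc_op_def)
next
  fix A assume A: "self_adjoint A \<and> Domain A \<subseteq> D \<and> (\<forall>(f, u)\<in>A. \<forall>g\<in>D. l2_inner u g = q f g)"
  then have "A \<subseteq> L2 \<times> L2" by (simp add: self_adjoint_def linear_operator_def)
  then have sub: "A \<subseteq> assoc_op" using A by (fastforce simp: assoc_op_def)
  then have "adjoint_op assoc_op \<subseteq> adjoint_op A" by (fastforce simp: adjoint_op_def)
  then have "assoc_op \<subseteq> A" using A assoc_op_self_adjoint by (simp add: self_adjoint_def)
  with sub show "A = assoc_op" by blast
qed

text \<open>The form shifted by \<open>- t\<close> is still coercive, with constant
  \<open>c - t\<close>: \<open>solve\<close> gives surjectivity and Cauchy-Schwarz the bound of the
  inverse.\<close>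

lemma below_resolvent:
  assumes lower: "\<And>f. f \<in> D \<Longrightarrow> c * (l2_norm f)\<^sup>2 \<le> Re (q f f)" and t: "t < c"
  shows "complex_of_real t \<in> resolvent_set assoc_op"
  unfolding resolvent_set_def
proof (intro CollectI conjI ballI)
  fix g :: "'a \<Rightarrow> complex" assume g: "g \<in> L2"
  have "(c - t) * (l2_norm f)\<^sup>2 \<le> Re (q f f) + (- t) * (l2_norm f)\<^sup>2" if "f \<in> D" for f
    using lower[OF that] by (simp add: left_diff_distrib)
  from solve[OF _ this g] t obtain f where "(f, \<lambda>x. g x - complex_of_real (- t) * f x) \<in> assoc_op" by auto
  then show "\<exists>(f, u)\<in>assoc_op. AE x in lborel. u x - complex_of_real t * f x = g x"
    by (intro bexI[of _ "(f, \<lambda>x. g x - complex_of_real (- t) * f x)"]) auto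
next
  show "\<exists>C. \<forall>(f, u)\<in>assoc_op. l2_norm f \<le> C * l2_norm (\<lambda>x. u x - complex_of_real t * f x)"
  proof (intro exI ballI, clarify)
    fix f u assume fu: "(f, u) \<in> assoc_op"
    note A = assoc_opD[OF fu]
    let ?r = "\<lambda>x. u x - complex_of_real t * f x"
    have r: "?r \<in> L2" using A DL by (intro L2_diff L2_scale) auto
    have "l2_inner ?r f = q f f - complex_of_real t * l2_inner f f"
      using A DL[OF A(1)] by (simp add: l2_inner_diff L2_scale l2_inner_scale)
    then have "Re (l2_inner ?r f) = Re (q f f) - t * (l2_norm f)\<^sup>2" by (simp add: l2_inner_self)
    then have "(c - t) * (l2_norm f)\<^sup>2 \<le> Re (l2_inner ?r f)"
      using lower[OF A(1)] by (simp add: left_diff_distrib)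
    also have "\<dots> \<le> l2_norm ?r * l2_norm f"
      using l2_cauchy_schwarz[OF r DL[OF A(1)]] complex_Re_le_cmod order_trans by blast
    finally have "((c - t) * l2_norm f) * l2_norm f \<le> l2_norm ?r * l2_norm f" by (simp add: power2_eq_square mult_ac)
    then have "(c - t) * l2_norm f \<le> l2_norm ?r \<or> l2_norm f = 0"
      using l2_norm_nonneg[of f] by (auto simp: mult_le_cancel_right)
    then show "l2_norm f \<le> (1 / (c - t)) * l2_norm ?r"
      using t l2_norm_nonneg[of ?r] by (auto simp: pos_le_divide_eq mult.commute)
  qed
qed

text \<open>A bounded inverse at \<open>c\<close> contradicts the existence of almost minimizers
  \<open>f\<close>: with \<open>(A - c) g = f\<close>, Cauchy-Schwarz for the nonnegative form
  \<open>q - c\<close> bounds 1 by a fixed multiple of \<open>Re (q f f) - c\<close>.\<close>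

lemma bottom_in_spectrum:
  assumes lower: "\<And>f. f \<in> D \<Longrightarrow> c * (l2_norm f)\<^sup>2 \<le> Re (q f f)"
    and sharp: "\<And>e. 0 < e \<Longrightarrow> \<exists>f\<in>D. l2_norm f = 1 \<and> Re (q f f) < c + e"
  shows "complex_of_real c \<in> spectrum assoc_op"
proof (rule ccontr)
  assume "complex_of_real c \<notin> spectrum assoc_op"
  then have res: "complex_of_real c \<in> resolvent_set assoc_op" by (simp add: spectrum_def)
  then obtain C where "\<forall>(f, u)\<in>assoc_op. l2_norm f \<le> C * l2_norm (\<lambda>x. u x - complex_of_real c * f x)"
    by (auto simp: resolvent_set_def)
  then have C: "l2_norm f \<le> C * l2_norm (\<lambda>x. u x - complex_of_real c * f x)" if "(f, u) \<in> assoc_op" for f u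
    using that by auto
  let ?B = "\<lambda>f g. q f g + complex_of_real (- c) * l2_inner f g"
  interpret S: semi_inner D ?B
    by (rule shifted_semi_inner) (use lower in auto)
  \<comment> \<open>The resolvent bound \<open>C\<close> may be any real number; the maximum is
    positive and can be divided by.\<close>
  define K where "K = max C 1"
  have K: "K > 0" by (simp add: K_def)
  obtain f where f: "f \<in> D" and f1: "l2_norm f = 1" and fq: "Re (q f f) < c + 1 / K"
    using sharp[of "1 / K"] K by auto
  have fL: "f \<in> L2" by (rule DL[OF f])
  obtain g u where gu: "(g, u) \<in> assoc_op" and eq: "AE x in lborel. u x - complex_of_real c * g x = f x"
    using res fL unfolding resolvent_set_def by blast
  note A = assoc_opD[OF gu]
  let ?r = "\<lambda>x. u x - complex_of_real c * g x"
  have gL: "g \<in> L2" by (rule DL[OF A(1)])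
  have r: "?r \<in> L2" using A gL by (intro L2_diff L2_scale) auto
  have B: "?B g k = l2_inner f k" if k: "k \<in> D" for k
  proof -
    have "?B g k = l2_inner ?r k"
      using A DL[OF k] k gL by (simp add: l2_inner_diff L2_scale l2_inner_scale)
    also have "\<dots> = l2_inner f k"
      by (rule l2_inner_cong_AE) (use r fL DL[OF k] eq in auto)
    finally show ?thesis .
  qed
  have "l2_norm ?r = l2_norm f" by (rule l2_norm_cong_AE[OF r fL eq])
  then have "l2_norm g \<le> C" using C[OF gu] f1 by simp
  then have gK: "l2_norm g \<le> K" by (simp add: K_def)
  have "1 = (norm (?B g f))\<^sup>2" by (simp only: B[OF f] l2_inner_self f1) simp
  also have "\<dots> \<le> Re (?B g g) * Re (?B f f)" by (rule S.cauchy_schwarz[OF A(1) f])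
  also have "\<dots> \<le> K * Re (?B f f)"
  proof (rule mult_right_mono)
    have "Re (?B g g) \<le> norm (l2_inner f g)" unfolding B[OF A(1)] by (rule complex_Re_le_cmod)
    also have "\<dots> \<le> l2_norm f * l2_norm g" by (rule l2_cauchy_schwarz[OF fL gL])
    finally show "Re (?B g g) \<le> K" using gK f1 by simp
  qed (rule S.B_pos[OF f])
  also have "Re (?B f f) = Re (q f f) - c" by (simp add: l2_inner_self f1)
  also have "K * (Re (q f f) - c) < K * (1 / K)" using fq K by (intro mult_strict_left_mono) auto
  also have "\<dots> = 1" using K by simp
  finally show False by simp
qed

text \<open>The infimum of the form over unit vectors lies in the spectrum and no smaller real
  number does. The \<open>Inf\<close> in \<open>inf_spectrum\<close> is thus a minimum, and no
  convention for empty or unbounded sets enters.\<close>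

lemma inf_spectrum_eq:
  obtains c where "inf_spectrum assoc_op = c"
    and "\<And>f. f \<in> D \<Longrightarrow> c * (l2_norm f)\<^sup>2 \<le> Re (q f f)"
    and "\<And>e. 0 < e \<Longrightarrow> \<exists>f\<in>D. l2_norm f = 1 \<and> Re (q f f) < c + e"
proof -
  define R where "R = {Re (q f f) | f. f \<in> D \<and> l2_norm f = 1}"
  define c where "c = Inf R"
  have ne: "R \<noteq> {}" using nontrivial by (auto simp: R_def)
  have bdd: "bdd_below R" using D.B_pos by (auto simp: R_def intro!: bdd_belowI[of _ 0])
  have lower: "c * (l2_norm f)\<^sup>2 \<le> Re (q f f)" if f: "f \<in> D" for f
  proof (cases "l2_norm f = 0")
    case True
    then show ?thesis using D.B_pos[OF f] by simp
  next
    case False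
    then have n: "l2_norm f > 0" using l2_norm_nonneg[of f] by simp
    let ?k = "complex_of_real (1 / l2_norm f)"
    have kf: "(\<lambda>x. ?k * f x) \<in> D" by (rule D.scale[OF f])
    have "l2_norm (\<lambda>x. ?k * f x) = 1" unfolding l2_norm_scale using n by (simp add: norm_divide)
    then have "Re (q (\<lambda>x. ?k * f x) (\<lambda>x. ?k * f x)) \<in> R" using kf by (auto simp: R_def)
    then have "c \<le> Re (q (\<lambda>x. ?k * f x) (\<lambda>x. ?k * f x))" unfolding c_def by (intro cInf_lower bdd)
    also have "\<dots> = Re (q f f) / (l2_norm f)\<^sup>2"
      unfolding D.B_scale[OF f kf] D.B_scale_right[OF f f] by (simp add: power2_eq_square)
    finally show ?thesis using n by (simp add: pos_le_divide_eq)
  qed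
  have sharp: "\<exists>f\<in>D. l2_norm f = 1 \<and> Re (q f f) < c + e" if "0 < e" for e
    using cInf_lessD[OF ne, of "c + e"] that by (auto simp: R_def c_def)
  have "inf_spectrum assoc_op = c"
    unfolding inf_spectrum_def
  proof (rule cInf_eq_minimum)
    show "c \<in> {t. complex_of_real t \<in> spectrum assoc_op}"
      using bottom_in_spectrum[OF lower sharp] by simp
    fix t assume "t \<in> {t. complex_of_real t \<in> spectrum assoc_op}"
    then show "c \<le> t" using below_resolvent[OF lower, of t] by (force simp: spectrum_def)
  qed
  then show ?thesis using lower sharp by (rule that)
qed

lemma inf_spectrum_le: "f \<in> D \<Longrightarrow> inf_spectrum assoc_op * (l2_norm f)\<^sup>2 \<le> Re (q f f)"
  using inf_spectrum_eq by metis

lemma le_inf_spectrum: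
  assumes "\<And>f. f \<in> D \<Longrightarrow> l2_norm f = 1 \<Longrightarrow> c \<le> Re (q f f)"
  shows "c \<le> inf_spectrum assoc_op"
proof (rule field_le_epsilon)
  fix e :: real assume "0 < e"
  then obtain f where "f \<in> D" "l2_norm f = 1" "Re (q f f) < inf_spectrum assoc_op + e"
    using inf_spectrum_eq by metis
  with assms[of f] show "c \<le> inf_spectrum assoc_op + e" by simp
qed

end

section \<open>The anti-Wick form\<close>

text \<open>Fatou's lemma identifies the pointwise limit with the norm limit. This is how closedness
  of the anti-Wick form is reached.\<close>

lemma L2_limit_unique:
  fixes F :: "nat \<Rightarrow> 'b::euclidean_space \<Rightarrow> complex"
  assumes F: "\<And>n. F n \<in> L2" and W: "W \<in> L2" and lim: "(\<lambda>n. l2_norm (\<lambda>x. F n x - W x)) \<longlonglongrightarrow> 0"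
    and pt: "\<And>x. (\<lambda>n. F n x) \<longlonglongrightarrow> g x"
  shows "AE x in lborel. g x = W x"
proof -
  have [measurable]: "F n \<in> borel_measurable borel" "W \<in> borel_measurable borel" for n
    using F W by (auto intro: L2_measurable)
  have [measurable]: "g \<in> borel_measurable borel"
    by (rule borel_measurable_LIMSEQ_metric[of F]) (use pt in auto)
  have "(\<integral>\<^sup>+x. ennreal ((norm (g x - W x))\<^sup>2) \<partial>lborel) = (\<integral>\<^sup>+x. liminf (\<lambda>n. ennreal ((norm (F n x - W x))\<^sup>2)) \<partial>lborel)"
  proof (rule nn_integral_cong)
    fix x
    have "(\<lambda>n. ennreal ((norm (F n x - W x))\<^sup>2)) \<longlonglongrightarrow> ennreal ((norm (g x - W x))\<^sup>2)"
      by (intro tendsto_ennrealI tendsto_intros pt)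
    then show "ennreal ((norm (g x - W x))\<^sup>2) = liminf (\<lambda>n. ennreal ((norm (F n x - W x))\<^sup>2))"
      by (metis lim_imp_Liminf sequentially_bot)
  qed
  also have "\<dots> \<le> liminf (\<lambda>n. \<integral>\<^sup>+x. ennreal ((norm (F n x - W x))\<^sup>2) \<partial>lborel)"
    by (rule nn_integral_liminf) auto
  also have "\<dots> = liminf (\<lambda>n. ennreal ((l2_norm (\<lambda>x. F n x - W x))\<^sup>2))"
    by (simp add: nn_integral_L2 L2_diff F W)
  also have "\<dots> = 0"
  proof -
    have "(\<lambda>n. ennreal ((l2_norm (\<lambda>x. F n x - W x))\<^sup>2)) \<longlonglongrightarrow> ennreal (0\<^sup>2)"
      by (intro tendsto_ennrealI tendsto_power lim)
    from lim_imp_Liminf[OF sequentially_bot this] show ?thesis by simp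
  qed
  finally have "(\<integral>\<^sup>+x. ennreal ((norm (g x - W x))\<^sup>2) \<partial>lborel) = 0" by simp
  then have "AE x in lborel. ennreal ((norm (g x - W x))\<^sup>2) = 0"
    by (subst (asm) nn_integral_0_iff_AE) auto
  then show ?thesis by eventually_elim auto
qed

text \<open>Polynomial growth of the symbol places the coherent states in the form domain.
  \<open>Ca\<close> may depend on \<open>h\<close>, since only this membership is deduced from
  it.\<close>

locale antiwick =
  fixes \<phi> :: "'a::euclidean_space \<Rightarrow> complex" and a :: "'a \<times> 'a \<Rightarrow> real \<Rightarrow> real" and h :: real
    and Ca :: real and M :: nat
  assumes phi: "\<phi> \<in> schwartz" and phi1: "l2_norm \<phi> = 1" and h: "0 < h" and h1: "h \<le> 1"
    and a_measurable: "(\<lambda>z. a z h) \<in> borel_measurable borel"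
    and a_nonneg: "\<And>z. 0 \<le> a z h"
    and a_growth: "\<And>z. a z h \<le> Ca * (1 + norm z) ^ M"
begin

abbreviation V :: "('a \<Rightarrow> complex) \<Rightarrow> 'a \<times> 'a \<Rightarrow> complex" where
  "V f z \<equiv> l2_inner f (coherent_state \<phi> h z)"

text \<open>The square root of the symbol factorizes the form as
  \<open>\<kappa> * l2_inner (U f) (U g)\<close>, which reduces closedness of the form to closedness
  of the operator \<open>U\<close>.\<close>

definition U :: "('a \<Rightarrow> complex) \<Rightarrow> 'a \<times> 'a \<Rightarrow> complex" where
  "U f z = complex_of_real (sqrt (a z h)) * V f z"

definition \<kappa> :: real where
  "\<kappa> = 1 / (2 * pi * h) ^ DIM('a)"

abbreviation D :: "('a \<Rightarrow> complex) set" where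
  "D \<equiv> antiwick_dom \<phi> a h"

abbreviation q :: "('a \<Rightarrow> complex) \<Rightarrow> ('a \<Rightarrow> complex) \<Rightarrow> complex" where
  "q \<equiv> antiwick_form \<phi> a h"

lemma kappa_pos: "0 < \<kappa>"
  using h by (simp add: \<kappa>_def)

lemma kappa_transform: "f \<in> L2 \<Longrightarrow> ennreal \<kappa> * (\<integral>\<^sup>+z. ennreal ((norm (V f z))\<^sup>2) \<partial>lborel) = ennreal ((l2_norm f)\<^sup>2)"
  using h by (subst transform_isometry[OF phi phi1 h]) (simp_all add: \<kappa>_def flip: ennreal_mult)

lemma coherent_L2: "coherent_state \<phi> h z \<in> L2"
  by (rule coherent_state_L2[OF phi phi1 h])

lemma U_measurable [measurable]: "f \<in> L2 \<Longrightarrow> U f \<in> borel_measurable borel"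
  unfolding U_def using a_measurable transform_measurable[OF phi phi1 h L2_measurable[of f]] by measurable

lemma norm_U: "(norm (U f z))\<^sup>2 = a z h * (norm (V f z))\<^sup>2"
  using a_nonneg[of z] by (simp add: U_def norm_mult power_mult_distrib)

lemma quad_eq: "antiwick_quad \<phi> a h f = ennreal \<kappa> * (\<integral>\<^sup>+z. ennreal ((norm (U f z))\<^sup>2) \<partial>lborel)"
  by (simp add: antiwick_quad_def \<kappa>_def norm_U)

lemma dom_iff: "f \<in> D \<longleftrightarrow> f \<in> L2 \<and> U f \<in> L2"
proof (cases "f \<in> L2")
  case True
  have "antiwick_quad \<phi> a h f < \<infinity> \<longleftrightarrow> (\<integral>\<^sup>+z. ennreal ((norm (U f z))\<^sup>2) \<partial>lborel) < \<infinity>"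
    unfolding quad_eq using kappa_pos by (auto simp: ennreal_mult_less_top)
  also have "\<dots> \<longleftrightarrow> U f \<in> L2"
    using True by (auto intro: L2I simp: nn_integral_L2)
  finally show ?thesis using True by (simp add: antiwick_dom_def)
qed (simp add: antiwick_dom_def)

lemma form_eq: "q f g = complex_of_real \<kappa> * l2_inner (U f) (U g)"
proof -
  have "l2_inner (U f) (U g) = (LINT z|lborel. complex_of_real (a z h) * V f z * cnj (V g z))"
    unfolding l2_inner_def[of "U f" "U g"]
  proof (intro Bochner_Integration.integral_cong refl)
    fix z
    have "complex_of_real (sqrt (a z h)) * complex_of_real (sqrt (a z h)) = complex_of_real (a z h)"
      using a_nonneg[of z] by (simp flip: of_real_mult)
    then show "U f z * cnj (U g z) = complex_of_real (a z h) * V f z * cnj (V g z)"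
      by (simp add: U_def mult_ac)
  qed
  then show ?thesis by (simp add: antiwick_form_def \<kappa>_def)
qed

lemma form_self: "Re (q f f) = \<kappa> * (l2_norm (U f))\<^sup>2"
  by (simp add: form_eq l2_inner_self)

lemma form_self_quad: "f \<in> D \<Longrightarrow> ennreal (Re (q f f)) = antiwick_quad \<phi> a h f"
  using kappa_pos by (simp add: form_self quad_eq dom_iff nn_integral_L2 ennreal_mult)

lemma U_add: "f \<in> L2 \<Longrightarrow> g \<in> L2 \<Longrightarrow> U (\<lambda>x. f x + g x) = (\<lambda>z. U f z + U g z)"
  by (rule ext) (simp add: U_def l2_inner_add coherent_L2 distrib_left)

lemma U_diff: "f \<in> L2 \<Longrightarrow> g \<in> L2 \<Longrightarrow> U (\<lambda>x. f x - g x) = (\<lambda>z. U f z - U g z)"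
  by (rule ext) (simp add: U_def l2_inner_diff coherent_L2 right_diff_distrib)

lemma U_scale: "U (\<lambda>x. c * f x) = (\<lambda>z. c * U f z)"
  by (rule ext) (simp add: U_def l2_inner_scale)

lemma semi_inner_form: "semi_inner D q"
proof
  show "(\<lambda>x. 0) \<in> D"
    using U_scale[of 0 "\<lambda>x. 0"] by (simp add: dom_iff L2_zero)
  show "0 \<le> Re (q f f)" for f
    using kappa_pos by (simp add: form_self)
qed (auto simp: dom_iff L2_add L2_scale U_add U_scale form_eq l2_inner_add l2_inner_scale distrib_left
      intro: l2_inner_commute)

lemma l2_inner_coherent_bound:
  assumes C: "0 \<le> C" "\<And>u w. norm (ambiguity \<phi> \<phi> u w) \<le> C / (1 + norm (u, w)) ^ k"
  shows "norm (l2_inner (coherent_state \<phi> h z) (coherent_state \<phi> h z')) \<le> C / (1 + norm (z' - z) / sqrt h) ^ k"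
proof -
  obtain x0 w0 x1 w1 where z: "z = (x0, w0)" "z' = (x1, w1)" by (cases z, cases z')
  have "norm ((x0 - x1) /\<^sub>R sqrt h, (w1 - w0) /\<^sub>R sqrt h) = norm ((x1 - x0) /\<^sub>R sqrt h, (w1 - w0) /\<^sub>R sqrt h)"
    by (simp add: norm_Pair norm_minus_commute)
  also have "((x1 - x0) /\<^sub>R sqrt h, (w1 - w0) /\<^sub>R sqrt h) = (z' - z) /\<^sub>R sqrt h" by (simp add: z)
  also have "norm \<dots> = norm (z' - z) / sqrt h" using h by (simp add: divide_inverse_commute)
  finally show ?thesis
    unfolding z l2_inner_coherent_states[OF phi phi1 h] using C(2) by metis
qed

text \<open>The width \<open>sqrt h\<close> is coarsened to 1 by \<open>h \<le> 1\<close>, which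
  suffices for membership in the form domain.\<close>

lemma l2_inner_coherent_decay:
  obtains C where "0 \<le> C"
    and "\<And>z z'. norm (l2_inner (coherent_state \<phi> h z) (coherent_state \<phi> h z')) \<le> C / (1 + norm (z' - z)) ^ k"
proof -
  obtain C where C: "0 \<le> C" "\<And>u w. norm (ambiguity \<phi> \<phi> u w) \<le> C / (1 + norm (u, w)) ^ k"
    using ambiguity_decay[OF phi phi, of k] by metis
  show ?thesis
  proof (rule that[OF C(1)])
    fix z z' :: "'a \<times> 'a"
    have "norm (l2_inner (coherent_state \<phi> h z) (coherent_state \<phi> h z')) \<le> C / (1 + norm (z' - z) / sqrt h) ^ k"
      by (rule l2_inner_coherent_bound[OF C])
    also have "C / (1 + norm (z' - z) / sqrt h) ^ k \<le> C / (1 + norm (z' - z)) ^ k"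
    proof (intro divide_left_mono C power_mono add_left_mono mult_pos_pos zero_less_power add_pos_nonneg)
      have "sqrt h \<le> 1" using h1 by simp
      then show "norm (z' - z) \<le> norm (z' - z) / sqrt h"
        using h by (simp add: pos_le_divide_eq mult_left_le)
    qed (use h in auto)
    finally show "norm (l2_inner (coherent_state \<phi> h z) (coherent_state \<phi> h z')) \<le> C / (1 + norm (z' - z)) ^ k" .
  qed
qed

text \<open>The overlaps decay faster than the symbol grows: \<open>M\<close> powers absorb the
  growth and \<open>2 * DIM('a \<times> 'a)\<close> make the rest integrable. The coherent states
  then provide both totality and a unit vector in the form domain.\<close>

lemma coherent_state_dom: "coherent_state \<phi> h z \<in> D"
proof -
  let ?n = "2 * DIM('a \<times> 'a)" and ?p = "coherent_state \<phi> h z"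
  obtain C where C: "0 \<le> C"
    "\<And>z z'. norm (l2_inner (coherent_state \<phi> h z) (coherent_state \<phi> h z')) \<le> C / (1 + norm (z' - z)) ^ (?n + M)"
    using l2_inner_coherent_decay[of "?n + M"] by metis
  have Ca: "0 \<le> Ca"
    using order_trans[OF a_nonneg[of 0] a_growth[of 0]] by simp
  have bd: "(norm (U ?p z'))\<^sup>2 \<le> Ca * (1 + norm z) ^ M * C\<^sup>2 * (1 / (1 + norm (z' - z)) ^ ?n)" for z'
  proof -
    let ?t = "1 + norm (z' - z)"
    have t: "1 \<le> ?t" by simp
    have "(1 + norm z') ^ M \<le> (1 + norm z) ^ M * ?t ^ M"
      unfolding power_mult_distrib[symmetric] using one_plus_norm_le[of z "z' - z"] by (intro power_mono) auto
    then have "a z' h \<le> Ca * ((1 + norm z) ^ M * ?t ^ M)"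
      using a_growth[of z'] Ca by (meson mult_left_mono order_trans)
    moreover have "(norm (V ?p z'))\<^sup>2 \<le> (C / ?t ^ (?n + M))\<^sup>2" by (intro power_mono C) auto
    ultimately have "(norm (U ?p z'))\<^sup>2 \<le> (Ca * ((1 + norm z) ^ M * ?t ^ M)) * (C / ?t ^ (?n + M))\<^sup>2"
      unfolding norm_U using a_nonneg[of z'] Ca by (intro mult_mono) auto
    also have "\<dots> = Ca * (1 + norm z) ^ M * C\<^sup>2 * (1 / ?t ^ ?n) * (1 / ?t ^ (?n + M))"
      using t by (simp add: power_add power_divide power2_eq_square)
    also have "\<dots> \<le> Ca * (1 + norm z) ^ M * C\<^sup>2 * (1 / ?t ^ ?n) * 1"
    proof (rule mult_left_mono)
      have "1 \<le> ?t ^ (?n + M)" by (rule one_le_power[OF t])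
      then show "1 / ?t ^ (?n + M) \<le> 1" by (subst divide_le_eq_1) linarith
    qed (use Ca in simp)
    finally show ?thesis by simp
  qed
  have i: "integrable lborel (\<lambda>z'. Ca * (1 + norm z) ^ M * C\<^sup>2 * (1 / (1 + norm (z' - z)) ^ ?n))"
    using integrable_lborel_translate[OF integrable_inverse_power_norm[where ?'a = "'a \<times> 'a", OF order_refl], of "- z"]
    by (intro integrable_mult_right) simp
  have "integrable lborel (\<lambda>z'. (norm (U ?p z'))\<^sup>2)"
  proof (rule Bochner_Integration.integrable_bound[OF i])
    show "AE z' in lborel. norm ((norm (U ?p z'))\<^sup>2) \<le> norm (Ca * (1 + norm z) ^ M * C\<^sup>2 * (1 / (1 + norm (z' - z)) ^ ?n))"
      using order_trans[OF bd abs_ge_self] by (intro AE_I2) (simp only: real_norm_def abs_of_nonneg[OF zero_le_power2])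
  qed (use U_measurable[OF coherent_L2[of z]] in simp)
  then have "U ?p \<in> L2" using U_measurable[OF coherent_L2[of z]] by (simp add: L2_def)
  then show ?thesis by (simp add: dom_iff coherent_L2)
qed

text \<open>If \<open>F n\<close> converges to \<open>f\<close> and \<open>U (F n)\<close> to
  \<open>W\<close> in norm, then \<open>U (F n)\<close> converges to \<open>U f\<close> at every
  point as well, because evaluating the transform at a point is an inner product. Hence
  \<open>W\<close> is \<open>U f\<close> almost everywhere.\<close>

lemma closed_form: "closed_form D q"
proof
  interpret semi_inner D q by (rule semi_inner_form)
  show "(\<lambda>x. 0) \<in> D" by (rule zero)
  show "(\<lambda>x. f x + g x) \<in> D" if "f \<in> D" "g \<in> D" for f g using that by (rule add)
  show "(\<lambda>x. c * f x) \<in> D" if "f \<in> D" for f c using that by (rule scale)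
  show "q (\<lambda>x. f x + g x) k = q f k + q g k" if "f \<in> D" "g \<in> D" "k \<in> D" for f g k using that by (rule B_add)
  show "q (\<lambda>x. c * f x) k = c * q f k" if "f \<in> D" "k \<in> D" for f k c using that by (rule B_scale)
  show "q k f = cnj (q f k)" if "f \<in> D" "k \<in> D" for f k using that by (rule B_herm)
  show "0 \<le> Re (q f f)" if "f \<in> D" for f using that by (rule B_pos)
  show "D \<subseteq> L2" by (auto simp: dom_iff)
  have UAE: "U f' = U f" if "f \<in> L2" "f' \<in> L2" "AE x in lborel. f' x = f x" for f f'
  proof (rule ext)
    fix z
    have "V f' z = V f z" by (rule l2_inner_cong_AE) (use that coherent_L2 in auto)
    then show "U f' z = U f z" by (simp add: U_def)
  qed
  show "f' \<in> D" if "f \<in> D" "f' \<in> L2" "AE x in lborel. f' x = f x" for f f'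
    using that UAE[of f f'] by (simp add: dom_iff)
  show "q f' g = q f g" if "f \<in> D" "f' \<in> D" "g \<in> D" "AE x in lborel. f' x = f x" for f f' g
    using that UAE[of f f'] by (simp add: dom_iff form_eq)
  show "\<exists>f\<in>D. l2_norm f = 1"
    using coherent_state_dom l2_norm_coherent_state[OF phi phi1 h] by blast
  show "AE x in lborel. u x = 0" if u: "u \<in> L2" and orth: "\<And>g. g \<in> D \<Longrightarrow> l2_inner u g = 0" for u
  proof -
    \<comment> \<open>An element orthogonal to all coherent states has zero transform, hence zero
      norm by the isometry.\<close>
    have "V u z = 0" for z using orth[OF coherent_state_dom] .
    then have "ennreal ((l2_norm u)\<^sup>2) = 0" using kappa_transform[OF u] by simp
    then have "l2_norm u = 0" by (simp add: ennreal_eq_0_iff)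
    then show ?thesis by (rule l2_norm_eq_0_AE[OF u])
  qed
  show "\<exists>f\<in>D. (\<lambda>n::nat. Re (q (\<lambda>x. F n x - f x) (\<lambda>x. F n x - f x)) + (l2_norm (\<lambda>x. F n x - f x))\<^sup>2) \<longlonglongrightarrow> 0"
    if FD: "\<And>n. F n \<in> D" and C: "\<And>e. 0 < e \<Longrightarrow> \<exists>n0. \<forall>m\<ge>n0. \<forall>n\<ge>n0.
         Re (q (\<lambda>x. F m x - F n x) (\<lambda>x. F m x - F n x)) + (l2_norm (\<lambda>x. F m x - F n x))\<^sup>2 < e" for F
  proof -
    have FL: "F n \<in> L2" and UL: "U (F n) \<in> L2" for n using FD[of n] by (auto simp: dom_iff)
    have est: "\<exists>n0. \<forall>m\<ge>n0. \<forall>n\<ge>n0. l2_norm (\<lambda>x. F m x - F n x) < e \<and> l2_norm (\<lambda>z. U (F m) z - U (F n) z) < e" if e: "0 < e" for e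
    proof -
      \<comment> \<open>One entry controls the norm of the difference of \<open>F m\<close> and
        \<open>F n\<close>, the other, after division by \<open>\<kappa>\<close>, that of their
        images under \<open>U\<close>.\<close>
      have "0 < min (e\<^sup>2) (\<kappa> * e\<^sup>2)" using e kappa_pos by simp
      from C[OF this] obtain n0 where n0: "\<And>m n. n0 \<le> m \<Longrightarrow> n0 \<le> n \<Longrightarrow>
          Re (q (\<lambda>x. F m x - F n x) (\<lambda>x. F m x - F n x)) + (l2_norm (\<lambda>x. F m x - F n x))\<^sup>2 < min (e\<^sup>2) (\<kappa> * e\<^sup>2)"
        by blast
      have "l2_norm (\<lambda>x. F m x - F n x) < e \<and> l2_norm (\<lambda>z. U (F m) z - U (F n) z) < e" if "n0 \<le> m" "n0 \<le> n" for m n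
      proof -
        have 1: "\<kappa> * (l2_norm (\<lambda>z. U (F m) z - U (F n) z))\<^sup>2 + (l2_norm (\<lambda>x. F m x - F n x))\<^sup>2 < min (e\<^sup>2) (\<kappa> * e\<^sup>2)"
          using n0[OF that] by (simp only: form_self U_diff[OF FL FL])
        have "0 \<le> \<kappa> * (l2_norm (\<lambda>z. U (F m) z - U (F n) z))\<^sup>2" using kappa_pos by simp
        then have "(l2_norm (\<lambda>x. F m x - F n x))\<^sup>2 < e\<^sup>2" using 1 by linarith
        moreover have "\<kappa> * (l2_norm (\<lambda>z. U (F m) z - U (F n) z))\<^sup>2 < \<kappa> * e\<^sup>2"
          using 1 zero_le_power2[of "l2_norm (\<lambda>x. F m x - F n x)"] by linarith
        then have "(l2_norm (\<lambda>z. U (F m) z - U (F n) z))\<^sup>2 < e\<^sup>2" using kappa_pos by simp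
        ultimately show ?thesis using e by (auto intro: power2_less_imp_less[of _ e])
      qed
      then show ?thesis by blast
    qed
    have est1: "\<exists>n0. \<forall>m\<ge>n0. \<forall>n\<ge>n0. l2_norm (\<lambda>x. F m x - F n x) < e"
      and est2: "\<exists>n0. \<forall>m\<ge>n0. \<forall>n\<ge>n0. l2_norm (\<lambda>z. U (F m) z - U (F n) z) < e" if "0 < e" for e
      using est[OF that] by blast+
    obtain f where f: "f \<in> L2" and flim: "(\<lambda>n. l2_norm (\<lambda>x. F n x - f x)) \<longlonglongrightarrow> 0"
      using L2_complete[OF FL est1] by auto
    obtain W where W: "W \<in> L2" and Wlim: "(\<lambda>n. l2_norm (\<lambda>z. U (F n) z - W z)) \<longlonglongrightarrow> 0"
      using L2_complete[OF UL est2] by auto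
    have pt: "(\<lambda>n. U (F n) z) \<longlonglongrightarrow> U f z" for z
    proof -
      have "(\<lambda>n. norm (U (F n) z - U f z)) \<longlonglongrightarrow> 0"
      proof (rule tendsto_sandwich[OF _ _ tendsto_const])
        show "\<forall>\<^sub>F n in sequentially. norm (U (F n) z - U f z) \<le> sqrt (a z h) * l2_norm (\<lambda>x. F n x - f x)"
        proof (intro always_eventually allI)
          fix n
          have "U (F n) z - U f z = U (\<lambda>x. F n x - f x) z" by (simp add: U_diff FL f)
          moreover have "norm (V (\<lambda>x. F n x - f x) z) \<le> l2_norm (\<lambda>x. F n x - f x) * 1"
            using l2_cauchy_schwarz[OF L2_diff[OF FL f] coherent_L2, of n z]
            by (simp add: l2_norm_coherent_state[OF phi phi1 h])
          ultimately show "norm (U (F n) z - U f z) \<le> sqrt (a z h) * l2_norm (\<lambda>x. F n x - f x)"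
            using a_nonneg[of z] by (simp add: U_def norm_mult mult_left_mono)
        qed
        show "(\<lambda>n. sqrt (a z h) * l2_norm (\<lambda>x. F n x - f x)) \<longlonglongrightarrow> 0"
          by (rule tendsto_mult_right_zero[OF flim])
      qed simp
      then show ?thesis by (simp only: tendsto_norm_zero_iff flip: Lim_null)
    qed
    have ae: "AE z in lborel. U f z = W z"
      by (rule L2_limit_unique[OF UL W Wlim pt])
    have "(\<integral>\<^sup>+z. ennreal ((norm (U f z))\<^sup>2) \<partial>lborel) = (\<integral>\<^sup>+z. ennreal ((norm (W z))\<^sup>2) \<partial>lborel)"
      by (rule nn_integral_cong_AE) (use ae in eventually_elim, simp)
    then have "U f \<in> L2" using W by (intro L2I U_measurable f) (simp add: nn_integral_L2)
    then have fD: "f \<in> D" using f by (simp add: dom_iff)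
    have "l2_norm (\<lambda>z. U (F n) z - U f z) = l2_norm (\<lambda>z. U (F n) z - W z)" for n
    proof (rule l2_norm_cong_AE)
      show "AE z in lborel. U (F n) z - U f z = U (F n) z - W z" using ae by eventually_elim simp
    qed (intro L2_diff UL W \<open>U f \<in> L2\<close>)+
    then have Ulim: "(\<lambda>n. l2_norm (\<lambda>z. U (F n) z - U f z)) \<longlonglongrightarrow> 0" using Wlim by simp
    have "(\<lambda>n. \<kappa> * (l2_norm (\<lambda>z. U (F n) z - U f z))\<^sup>2 + (l2_norm (\<lambda>x. F n x - f x))\<^sup>2) \<longlonglongrightarrow> \<kappa> * 0\<^sup>2 + 0\<^sup>2"
      by (intro tendsto_intros Ulim flim)
    then have "(\<lambda>n. Re (q (\<lambda>x. F n x - f x) (\<lambda>x. F n x - f x)) + (l2_norm (\<lambda>x. F n x - f x))\<^sup>2) \<longlonglongrightarrow> 0"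
      by (simp add: form_self U_diff[OF FL f])
    with fD show ?thesis by blast
  qed
qed

sublocale form: closed_form D q by (rule closed_form)

lemma antiwick_op_eq: "antiwick_op \<phi> a h = form.assoc_op"
  unfolding antiwick_op_def by (rule form.the_assoc_op)

lemma inf_spectrum_le:
  assumes "f \<in> D" and "l2_norm f = 1"
  shows "ennreal (inf_spectrum (antiwick_op \<phi> a h)) \<le> antiwick_quad \<phi> a h f"
  using form.inf_spectrum_le[OF assms(1)] assms(2)
  by (simp add: antiwick_op_eq form_self_quad[OF assms(1), symmetric] ennreal_leI)

text \<open>Outside the form domain \<open>antiwick_quad\<close> is infinite, so testing all of
  \<open>L2\<close> asks nothing more. A negative \<open>c\<close> is sent to 0 by
  \<open>ennreal\<close>; the conclusion then rests on the nonnegativity of the form.\<close>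

lemma le_inf_spectrum:
  assumes "\<And>f. f \<in> L2 \<Longrightarrow> l2_norm f = 1 \<Longrightarrow> ennreal c \<le> antiwick_quad \<phi> a h f"
  shows "c \<le> inf_spectrum (antiwick_op \<phi> a h)"
  unfolding antiwick_op_eq
proof (rule form.le_inf_spectrum)
  fix f assume f: "f \<in> D" "l2_norm f = 1"
  have "ennreal c \<le> ennreal (Re (q f f))"
    using assms[of f] f by (simp add: form_self_quad dom_iff)
  moreover have "0 \<le> Re (q f f)" using kappa_pos by (simp add: form_self)
  ultimately show "c \<le> Re (q f f)" by (auto simp: ennreal_le_iff2)
qed

end

section \<open>Symbols along rays\<close>

text \<open>Interpolation at \<open>card T\<close> nodes is exact for degrees below
  \<open>card T\<close>, and nodes at mutual distance \<open>r\<close> bound each of the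
  \<open>card T - 1\<close> factors of a basis polynomial by \<open>(1 + x) / r\<close>.\<close>

lemma lagrange_bound:
  fixes p :: "real poly"
  assumes T: "finite T" "T \<subseteq> {0..1}" and deg: "degree p < card T"
    and sep: "\<And>s t. s \<in> T \<Longrightarrow> t \<in> T \<Longrightarrow> s \<noteq> t \<Longrightarrow> r \<le> \<bar>s - t\<bar>" and r: "0 < r" "r \<le> 1"
    and A: "\<And>s. s \<in> T \<Longrightarrow> \<bar>poly p s\<bar> \<le> A" and x: "0 \<le> x"
  shows "\<bar>poly p x\<bar> \<le> real (card T) * A * ((1 + x) / r) ^ card T"
proof -
  define L where "L = (\<lambda>s. \<Prod>t\<in>T - {s}. smult (1 / (s - t)) [:- t, 1:])"
  define P where "P = (\<Sum>s\<in>T. smult (poly p s) (L s))"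
  have Lx: "poly (L s) y = (\<Prod>t\<in>T - {s}. (y - t) / (s - t))" for s y
    by (simp add: L_def poly_prod diff_divide_distrib)
  have Ls: "poly (L s) t = (if t = s then 1 else 0)" if "s \<in> T" "t \<in> T" for s t
  proof (cases "t = s")
    case True
    then show ?thesis unfolding Lx by (auto intro!: prod.neutral)
  next
    case False
    then have "\<exists>u\<in>T - {s}. (t - u) / (s - u) = 0" using that by (intro bexI[of _ t]) auto
    then show ?thesis unfolding Lx using False T by (auto simp: prod_zero_iff)
  qed
  have "p = P"
  proof (rule poly_eqI_degree[of T])
    show "poly p x = poly P x" if "x \<in> T" for x
    proof -
      have "poly P x = (\<Sum>s\<in>T. poly p s * (if x = s then 1 else 0))"
        unfolding P_def poly_sum by (intro sum.cong refl) (simp add: Ls that)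
      also have "\<dots> = poly p x" using that T by (simp add: if_distrib cong: if_cong)
      finally show ?thesis by simp
    qed
    show "degree P < card T"
      unfolding P_def
    proof (rule degree_sum_less)
      fix s assume s: "s \<in> T"
      have "degree (L s) \<le> (\<Sum>t\<in>T - {s}. degree (smult (1 / (s - t)) [:- t, 1:]))"
        using degree_prod_sum_le[of "T - {s}" "\<lambda>t. smult (1 / (s - t)) [:- t, 1:]"] T by (simp add: L_def o_def)
      also have "\<dots> \<le> (\<Sum>t\<in>T - {s}. 1)" by (intro sum_mono) (simp add: degree_smult_eq)
      also have "\<dots> = card (T - {s})" by simp
      also have "\<dots> < card T" by (rule card_Diff1_less[OF T(1) s])
      finally have "degree (L s) < card T" .
      then show "degree (smult (poly p s) (L s)) < card T" using degree_smult_le le_less_trans by blast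
    qed (use deg in simp)
  qed (rule deg)
  have A0: "0 \<le> A" if "s \<in> T" for s using A[OF that] by simp
  have Lb: "\<bar>poly (L s) x\<bar> \<le> ((1 + x) / r) ^ card T" if s: "s \<in> T" for s
  proof -
    have "\<bar>poly (L s) x\<bar> = (\<Prod>t\<in>T - {s}. \<bar>(x - t) / (s - t)\<bar>)" unfolding Lx by (rule abs_prod)
    also have "\<dots> \<le> (\<Prod>t\<in>T - {s}. (1 + x) / r)"
    proof (rule prod_mono, intro conjI)
      fix t assume t: "t \<in> T - {s}"
      have "0 \<le> t" "t \<le> 1" using t T(2) by auto
      then have "\<bar>x - t\<bar> \<le> 1 + x" using x by linarith
      moreover have "r \<le> \<bar>s - t\<bar>" using sep[of s t] s t by auto
      ultimately show "\<bar>(x - t) / (s - t)\<bar> \<le> (1 + x) / r"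
        unfolding abs_divide using r by (intro frac_le) auto
    qed simp
    also have "\<dots> = ((1 + x) / r) ^ card (T - {s})" by simp
    also have "\<dots> \<le> ((1 + x) / r) ^ card T"
    proof (rule power_increasing)
      \<comment> \<open>This allows the exponent \<open>card T - 1\<close> to be rounded up to
        \<open>card T\<close>.\<close>
      show "1 \<le> (1 + x) / r" using r x by (simp add: pos_le_divide_eq)
    qed (use T in \<open>auto intro: card_mono\<close>)
    finally show ?thesis .
  qed
  have "\<bar>poly p x\<bar> = \<bar>\<Sum>s\<in>T. poly p s * poly (L s) x\<bar>"
    by (subst \<open>p = P\<close>) (simp add: P_def poly_sum)
  also have "\<dots> \<le> (\<Sum>s\<in>T. \<bar>poly p s * poly (L s) x\<bar>)" by (rule sum_abs)
  also have "\<dots> \<le> (\<Sum>s\<in>T. A * ((1 + x) / r) ^ card T)"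
    unfolding abs_mult using A Lb A0 by (intro sum_mono mult_mono) auto
  finally show ?thesis by simp
qed

text \<open>Equidistant nodes of spacing \<open>1 / M\<close> bound the polynomial by its values on
  the unit interval; the term \<open>+ 1\<close> of the constant pays for the remainder at
  \<open>x\<close>.\<close>

lemma almost_polynomial_growth:
  fixes g :: "real \<Rightarrow> real"
  assumes deg: "degree p < M" and p: "\<And>t. 0 \<le> t \<Longrightarrow> \<bar>g t - poly p t\<bar> \<le> E * t ^ M"
    and S: "\<And>t. 0 \<le> t \<Longrightarrow> t < 1 \<Longrightarrow> \<bar>g t\<bar> \<le> S" and x: "0 \<le> x"
  shows "\<bar>g x\<bar> \<le> (real M * real M ^ M + 1) * (S + E) * (1 + x) ^ M"
proof -
  \<comment> \<open>The node 1 is avoided, since \<open>S\<close> bounds \<open>g\<close> for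
    \<open>t < 1\<close> only; this fits the open balls in \<open>lambda'\<close>.\<close>
  define T where "T = (\<lambda>i. real i / real M) ` {..<M}"
  have M: "0 < M" using deg by simp
  have inj: "inj_on (\<lambda>i. real i / real M) {..<M}" using M by (auto simp: inj_on_def)
  have card: "card T = M" unfolding T_def by (simp add: card_image inj)
  have E: "0 \<le> E" using p[of 1] by simp
  have S0: "0 \<le> S" using S[of 0] by simp
  have "\<bar>poly p x\<bar> \<le> real (card T) * (S + E) * ((1 + x) / (1 / real M)) ^ card T"
  proof (rule lagrange_bound)
    show "1 / real M \<le> \<bar>s - t\<bar>" if "s \<in> T" "t \<in> T" "s \<noteq> t" for s t
    proof -
      obtain i j where ij: "s = real i / real M" "t = real j / real M" using \<open>s \<in> T\<close> \<open>t \<in> T\<close> by (auto simp: T_def)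
      then have "i \<noteq> j" using \<open>s \<noteq> t\<close> by auto
      then have "1 \<le> \<bar>real i - real j\<bar>" by linarith
      moreover have "\<bar>s - t\<bar> = \<bar>real i - real j\<bar> / real M" using M by (simp add: ij diff_divide_distrib[symmetric])
      ultimately show ?thesis using M by (simp add: divide_right_mono)
    qed
    show "\<bar>poly p s\<bar> \<le> S + E" if "s \<in> T" for s
    proof -
      have s: "0 \<le> s" "s < 1" using that M by (auto simp: T_def divide_simps)
      have "E * s ^ M \<le> E * 1" using s E by (intro mult_left_mono power_le_one) auto
      then show ?thesis using S[OF s] p[OF s(1)] by linarith
    qed
  qed (use M deg x card in \<open>auto simp: T_def divide_simps\<close>)
  also have "\<dots> = real M * real M ^ M * (S + E) * (1 + x) ^ M"
    using M by (simp add: card power_mult_distrib mult_ac)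
  finally have 1: "\<bar>poly p x\<bar> \<le> real M * real M ^ M * (S + E) * (1 + x) ^ M" .
  have "E * x ^ M \<le> (S + E) * (1 + x) ^ M"
    using x E S0 by (intro mult_mono power_mono) auto
  then have "\<bar>g x\<bar> \<le> real M * real M ^ M * (S + E) * (1 + x) ^ M + (S + E) * (1 + x) ^ M"
    using 1 p[OF x] by linarith
  then show ?thesis by (simp add: distrib_right)
qed

text \<open>Greedy choice: intervals of radius \<open>r\<close> about \<open>k\<close> points have
  total length at most \<open>2 * r * k\<close> and cannot cover \<open>X\<close>.\<close>

lemma separated_points:
  fixes X :: "real set"
  assumes X: "X \<in> sets borel" and r: "0 < r" and m: "ennreal (2 * r * real k) < emeasure lborel X"
  shows "\<exists>T. finite T \<and> card T = k \<and> T \<subseteq> X \<and> (\<forall>s\<in>T. \<forall>t\<in>T. s \<noteq> t \<longrightarrow> r \<le> \<bar>s - t\<bar>)"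
  using m
proof (induction k)
  case 0
  then show ?case by (intro exI[of _ "{}"]) auto
next
  case (Suc k)
  have "ennreal (2 * r * real k) \<le> ennreal (2 * r * real (Suc k))"
    using r by (intro ennreal_leI mult_left_mono) auto
  then have "ennreal (2 * r * real k) < emeasure lborel X" using Suc.prems by (rule le_less_trans)
  from Suc.IH[OF this] obtain T where T: "finite T" "card T = k" "T \<subseteq> X" "\<And>s t. s \<in> T \<Longrightarrow> t \<in> T \<Longrightarrow> s \<noteq> t \<Longrightarrow> r \<le> \<bar>s - t\<bar>"
    by blast
  define Y where "Y = (\<Union>t\<in>T. {t - r..t + r})"
  have "emeasure lborel Y \<le> (\<Sum>t\<in>T. emeasure lborel {t - r..t + r})"
    unfolding Y_def using T(1) by (intro emeasure_subadditive_finite) auto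
  also have "\<dots> = (\<Sum>t\<in>T. ennreal (2 * r))" using r by (intro sum.cong refl) simp
  also have "\<dots> = ennreal (2 * r * real k)"
    using r T(2) by (simp add: ennreal_of_nat_eq_real_of_nat ennreal_mult'[symmetric] mult_ac)
  also have "\<dots> < emeasure lborel X" by fact
  finally have "emeasure lborel Y < emeasure lborel X" .
  then have "\<not> X \<subseteq> Y"
  proof -
    have "Y \<in> sets lborel" using T(1) unfolding Y_def by (intro sets.finite_UN) auto
    then show ?thesis using emeasure_mono[of X Y lborel] \<open>emeasure lborel Y < emeasure lborel X\<close> by (meson not_le)
  qed
  then obtain x where x: "x \<in> X" "x \<notin> Y" by blast
  then have d: "r \<le> \<bar>x - t\<bar>" if "t \<in> T" for t using that by (auto simp: Y_def abs_if not_le)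
  then have "x \<notin> T" using r by fastforce
  show ?case
  proof (intro exI[of _ "insert x T"] conjI ballI impI)
    show "card (insert x T) = Suc k" using T \<open>x \<notin> T\<close> by simp
    fix s t assume "s \<in> insert x T" "t \<in> insert x T" "s \<noteq> t"
    then show "r \<le> \<bar>s - t\<bar>" using d[of s] d[of t] T(4)[of s t] by (auto simp: abs_minus_commute)
  qed (use T x in auto)
qed

text \<open>An estimate of Remez type: a set longer than \<open>\<delta>\<close> contains enough
  separated nodes to recover the value at 0, at the cost of a power of \<open>1 / \<delta>\<close>.
  The interval \<open>{1/2..1}\<close> is that of the dilations in
  \<open>dilation_average\<close>.\<close>

lemma almost_polynomial_sublevel:
  fixes g :: "real \<Rightarrow> real"
  assumes deg: "degree p < M" and p: "\<And>t. 0 \<le> t \<Longrightarrow> \<bar>g t - poly p t\<bar> \<le> E * t ^ M"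
    and X: "X \<in> sets borel" "X \<subseteq> {1/2..1}" and \<delta>: "0 < \<delta>" "\<delta> \<le> 1" "ennreal \<delta> < emeasure lborel X"
    and small: "\<And>t. t \<in> X \<Longrightarrow> \<bar>g t\<bar> \<le> e"
  shows "\<bar>g 0\<bar> \<le> real M * (2 * real M / \<delta>) ^ M * (e + E)"
proof -
  have M: "0 < M" using deg by simp
  \<comment> \<open>With this separation \<open>M\<close> points ask for the length
    \<open>2 * r * M = \<delta>\<close>.\<close>
  define r where "r = \<delta> / (2 * real M)"
  have r: "0 < r" "r \<le> 1" using M \<delta> by (auto simp: r_def divide_simps)
  have "2 * r * real M = \<delta>" using M by (simp add: r_def)
  then obtain T where T: "finite T" "card T = M" "T \<subseteq> X" "\<And>s t. s \<in> T \<Longrightarrow> t \<in> T \<Longrightarrow> s \<noteq> t \<Longrightarrow> r \<le> \<bar>s - t\<bar>"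
    using separated_points[OF X(1) r(1), of M] \<delta>(3) by auto
  have E: "0 \<le> E" using p[of 1] by simp
  have "\<bar>poly p 0\<bar> \<le> real (card T) * (e + E) * ((1 + 0) / r) ^ card T"
  proof (rule lagrange_bound[OF T(1)])
    show "T \<subseteq> {0..1}" using T(3) X(2) by force
    show "\<bar>poly p s\<bar> \<le> e + E" if "s \<in> T" for s
    proof -
      have s: "s \<in> X" "0 \<le> s" "s \<le> 1" using that T(3) X(2) by force+
      have "E * s ^ M \<le> E * 1" using s E by (intro mult_left_mono power_le_one) auto
      then show ?thesis using small[OF s(1)] p[OF s(2)] by linarith
    qed
  qed (use T r deg in auto)
  \<comment> \<open>The remainder \<open>E * t ^ M\<close> vanishes at 0 because \<open>M\<close> is
    positive.\<close>
  moreover have "g 0 = poly p 0" using p[of 0] M by (simp add: power_0_left)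
  moreover have "(1 + 0) / r = 2 * real M / \<delta>" using M \<delta>(1) by (simp add: r_def)
  ultimately show ?thesis by (simp only: T(2) mult_ac)
qed

section \<open>Taylor expansion of the symbol along rays\<close>

lemma taylor_polynomial:
  fixes G :: "nat \<Rightarrow> real \<Rightarrow> real"
  assumes M: "0 < M" and G: "\<And>k t. k < M \<Longrightarrow> (G k has_real_derivative G (Suc k) t) (at t)"
    and E: "\<And>t. \<bar>G M t\<bar> \<le> E"
  shows "\<exists>p. degree p < M \<and> (\<forall>t\<ge>0. \<bar>G 0 t - poly p t\<bar> \<le> E * t ^ M)"
proof (intro exI conjI allI impI)
  let ?p = "\<Sum>m<M. monom (G m 0 / fact m) m"
  show "degree ?p < M"
    using M by (intro degree_sum_less) (auto intro: le_less_trans[OF degree_monom_le])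
  fix t :: real assume t: "0 \<le> t"
  show "\<bar>G 0 t - poly ?p t\<bar> \<le> E * t ^ M"
  proof (cases "t = 0")
    case True
    have "(\<Sum>m<M. G m 0 / fact m * 0 ^ m) = G 0 0"
      using M by (subst sum.remove[of _ 0]) auto
    then show ?thesis using True M by (simp add: poly_sum poly_monom power_0_left)
  next
    case False
    then obtain s where "G 0 t = (\<Sum>m<M. G m 0 / fact m * t ^ m) + G M s / fact M * t ^ M"
      using Maclaurin[of t M G "G 0"] G M t by auto
    then have "G 0 t - poly ?p t = G M s / fact M * t ^ M" by (simp add: poly_sum poly_monom)
    moreover have "\<bar>G M s / fact M\<bar> \<le> E"
    proof -
      have "\<bar>G M s\<bar> / fact M \<le> \<bar>G M s\<bar> / 1" by (intro divide_left_mono) (auto simp: fact_ge_1)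
      then show ?thesis using E[of s] by (simp add: abs_divide)
    qed
    ultimately show ?thesis
      using mult_right_mono[of "\<bar>G M s / fact M\<bar>" E "t ^ M"] t by (simp only: abs_mult abs_of_nonneg zero_le_power)
  qed
qed

text \<open>Indexing by ordered lists keeps multinomial coefficients out of the iterated directional
  derivative: one more derivative prepends one more basis direction.\<close>

lemma iterated_line_derivative:
  fixes f :: "'a::euclidean_space \<Rightarrow> real"
  assumes f: "smooth f"
  defines "G \<equiv> \<lambda>v k z. \<Sum>bs\<in>{bs. set bs \<subseteq> Basis \<and> length bs = k}. (\<Prod>b\<leftarrow>bs. v \<bullet> b) * partials bs f z"
  shows "((\<lambda>t. G v k (z + t *\<^sub>R v)) has_real_derivative G v (Suc k) (z + t *\<^sub>R v)) (at t)"
proof -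
  let ?L = "\<lambda>k. {bs. set bs \<subseteq> (Basis :: 'a set) \<and> length bs = k}"
  have d: "((\<lambda>t. partials bs f (z + t *\<^sub>R v)) has_real_derivative dir_deriv v (partials bs f) (z + t *\<^sub>R v)) (at t)"
    if "bs \<in> ?L k" for bs
    using dir_deriv_line[of "partials bs f" z t v] smooth_partials_differentiable[OF f, of bs] that
    by (simp add: has_real_derivative_iff_has_vector_derivative)
  have "((\<lambda>t. G v k (z + t *\<^sub>R v)) has_real_derivative
     (\<Sum>bs\<in>?L k. (\<Prod>b\<leftarrow>bs. v \<bullet> b) * dir_deriv v (partials bs f) (z + t *\<^sub>R v))) (at t)"
    unfolding G_def by (intro DERIV_sum DERIV_cmult d)
  also have "(\<Sum>bs\<in>?L k. (\<Prod>b\<leftarrow>bs. v \<bullet> b) * dir_deriv v (partials bs f) (z + t *\<^sub>R v)) =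
     (\<Sum>bs\<in>?L k. \<Sum>c\<in>Basis. (\<Prod>b\<leftarrow>c # bs. v \<bullet> b) * partials (c # bs) f (z + t *\<^sub>R v))"
  proof (rule sum.cong[OF refl])
    fix bs assume "bs \<in> ?L k"
    then have "dir_deriv v (partials bs f) (z + t *\<^sub>R v) = (\<Sum>b\<in>Basis. (v \<bullet> b) *\<^sub>R dir_deriv b (partials bs f) (z + t *\<^sub>R v))"
      by (intro dir_deriv_basis smooth_partials_differentiable f) auto
    then show "(\<Prod>b\<leftarrow>bs. v \<bullet> b) * dir_deriv v (partials bs f) (z + t *\<^sub>R v) =
       (\<Sum>c\<in>Basis. (\<Prod>b\<leftarrow>c # bs. v \<bullet> b) * partials (c # bs) f (z + t *\<^sub>R v))"
      by (simp add: partials_Cons sum_distrib_left mult_ac)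
  qed
  also have "\<dots> = (\<Sum>(bs, c)\<in>?L k \<times> Basis. (\<Prod>b\<leftarrow>c # bs. v \<bullet> b) * partials (c # bs) f (z + t *\<^sub>R v))"
    by (rule sum.cartesian_product)
  also have "\<dots> = G v (Suc k) (z + t *\<^sub>R v)"
    unfolding G_def
    by (rule sum.reindex_bij_witness[where i="\<lambda>bs. (tl bs, hd bs)" and j="\<lambda>(bs, c). c # bs"])
       (auto simp: length_Suc_conv)
  finally show ?thesis .
qed

lemma prod_list_inner_bound:
  assumes "set bs \<subseteq> Basis"
  shows "\<bar>\<Prod>b\<leftarrow>bs. v \<bullet> b\<bar> \<le> norm v ^ length bs"
  using assms by (induction bs) (auto simp: abs_mult Basis_le_norm intro!: mult_mono)

text \<open>The order \<open>M\<close> exceeds the threshold \<open>N0\<close> of the symbol class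
  and makes the net power of \<open>h\<close> at least \<open>N\<close>. \<open>M\<close> and
  \<open>E\<close> depend on \<open>N\<close>, but not on \<open>h\<close>, \<open>z\<close> or
  \<open>w\<close>.\<close>

lemma symbol_almost_polynomial:
  fixes a :: "'a::euclidean_space \<times> 'a \<Rightarrow> real \<Rightarrow> real"
  assumes a: "a \<in> symbol_class m \<rho>" and \<rho>: "\<rho> < 1 / 2"
  obtains M :: nat and E :: real where "0 < M" and "0 \<le> E"
    and "\<And>h z w. h \<in> {0<..1} \<Longrightarrow> \<exists>p. degree p < M \<and>
      (\<forall>t\<ge>0. \<bar>a (z + (t * sqrt h) *\<^sub>R w) h - poly p t\<bar> \<le> (E * norm w ^ M * h ^ N) * t ^ M)"
proof -
  obtain N0 where N0': "\<forall>bs. set bs \<subseteq> Basis \<and> length bs \<ge> N0 \<longrightarrow>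
    bdd_above ((\<lambda>(z, h). norm (partials bs (\<lambda>w. a w h) z) * h powr (m + \<rho> * real (length bs))) ` (UNIV \<times> {0<..1}))"
    using a unfolding symbol_class_def by blast
  have N0: "bdd_above ((\<lambda>(z, h). norm (partials bs (\<lambda>w. a w h) z) * h powr (m + \<rho> * real (length bs))) ` (UNIV \<times> {0<..1}))"
    if "set bs \<subseteq> Basis" "length bs \<ge> N0" for bs by (rule N0'[rule_format, OF conjI[OF that]])
  have smooth: "smooth (\<lambda>z. a z h)" if "h \<in> {0<..1}" for h
    using a that unfolding symbol_class_def by blast
  \<comment> \<open>For every \<open>M \<ge> n1\<close> the product
    \<open>M * (1/2 - \<rho>)\<close> is at least \<open>\<bar>m\<bar> + N\<close>; the absolute
    value serves both signs of \<open>m\<close>.\<close>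
  obtain n1 :: nat where n1: "(\<bar>m\<bar> + real N) / (1 / 2 - \<rho>) \<le> real n1" using real_arch_simple by blast
  define M where "M = Suc (max N0 n1)"
  have MN: "N0 \<le> M" "n1 \<le> M" "0 < M" by (auto simp: M_def)
  have ex: "real N \<le> real M / 2 - (m + \<rho> * real M)"
  proof -
    have "\<bar>m\<bar> + real N \<le> real n1 * (1 / 2 - \<rho>)" using n1 \<rho> by (simp add: pos_divide_le_eq)
    also have "\<dots> \<le> real M * (1 / 2 - \<rho>)" using MN \<rho> by (intro mult_right_mono) auto
    finally show ?thesis by (simp add: algebra_simps)
  qed
  let ?L = "{bs. set bs \<subseteq> (Basis :: ('a \<times> 'a) set) \<and> length bs = M}"
  have "\<forall>bs\<in>?L. \<exists>B. \<forall>z. \<forall>h\<in>{0<..1}. \<bar>partials bs (\<lambda>w. a w h) z\<bar> * h powr (m + \<rho> * real M) \<le> B"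
  proof
    fix bs assume bs: "bs \<in> ?L"
    let ?f = "\<lambda>(z, h). norm (partials bs (\<lambda>w. a w h) z) * h powr (m + \<rho> * real (length bs))"
    have "bdd_above (?f ` (UNIV \<times> {0<..1}))" using N0[of bs] bs MN by auto
    then obtain B where B: "\<forall>y\<in>?f ` (UNIV \<times> {0<..1}). y \<le> B" unfolding bdd_above_def by blast
    have "\<bar>partials bs (\<lambda>w. a w h) z\<bar> * h powr (m + \<rho> * real M) \<le> B" if "h \<in> {0<..1}" for z h
    proof -
      have "?f (z, h) \<in> ?f ` (UNIV \<times> {0<..1})" using that by (intro imageI) auto
      then have "?f (z, h) \<le> B" using B by blast
      then show ?thesis using bs by simp
    qed
    then show "\<exists>B. \<forall>z. \<forall>h\<in>{0<..1}. \<bar>partials bs (\<lambda>w. a w h) z\<bar> * h powr (m + \<rho> * real M) \<le> B"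
      by blast
  qed
  from bchoice[OF this] obtain B where
    B': "\<forall>bs\<in>?L. \<forall>z. \<forall>h\<in>{0<..1}. \<bar>partials bs (\<lambda>w. a w h) z\<bar> * h powr (m + \<rho> * real M) \<le> B bs" ..
  have B: "\<bar>partials bs (\<lambda>w. a w h) z\<bar> * h powr (m + \<rho> * real M) \<le> B bs" if "bs \<in> ?L" "h \<in> {0<..1}" for bs z h
    using bspec[OF spec[OF bspec[OF B' that(1)]] that(2)] .
  define E where "E = (\<Sum>bs\<in>?L. \<bar>B bs\<bar>)"
  show ?thesis
  proof (rule that[OF MN(3)])
    show "0 \<le> E" by (auto simp: E_def intro: sum_nonneg)
    fix h z w assume h: "h \<in> {0<..(1::real)}"
    define G where "G = (\<lambda>k z'. \<Sum>bs\<in>{bs. set bs \<subseteq> (Basis :: ('a \<times> 'a) set) \<and> length bs = k}. (\<Prod>b\<leftarrow>bs. (sqrt h *\<^sub>R w) \<bullet> b) * partials bs (\<lambda>z. a z h) z')"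
    have G0: "G 0 z' = a z' h" for z'
    proof -
      have "{bs. set bs \<subseteq> (Basis :: ('a \<times> 'a) set) \<and> length bs = 0} = {[]}" by auto
      then show ?thesis by (simp add: G_def)
    qed
    have "\<exists>p. degree p < M \<and> (\<forall>t\<ge>0. \<bar>G 0 (z + t *\<^sub>R (sqrt h *\<^sub>R w)) - poly p t\<bar> \<le> (E * norm w ^ M * h ^ N) * t ^ M)"
    proof (rule taylor_polynomial[where G="\<lambda>k t. G k (z + t *\<^sub>R (sqrt h *\<^sub>R w))", OF MN(3)])
      show "((\<lambda>t. G k (z + t *\<^sub>R (sqrt h *\<^sub>R w))) has_real_derivative G (Suc k) (z + t *\<^sub>R (sqrt h *\<^sub>R w))) (at t)" for k t
        unfolding G_def by (rule iterated_line_derivative[OF smooth[OF h]])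
      fix t
      let ?z = "z + t *\<^sub>R (sqrt h *\<^sub>R w)" and ?e = "m + \<rho> * real M"
      have h0: "0 < h" "h \<le> 1" using h by auto
      have "\<bar>G M ?z\<bar> \<le> (\<Sum>bs\<in>?L. \<bar>\<Prod>b\<leftarrow>bs. (sqrt h *\<^sub>R w) \<bullet> b\<bar> * \<bar>partials bs (\<lambda>z. a z h) ?z\<bar>)"
        unfolding G_def abs_mult[symmetric] by (rule sum_abs)
      also have "\<dots> \<le> (\<Sum>bs\<in>?L. norm (sqrt h *\<^sub>R w) ^ M * (\<bar>B bs\<bar> * h powr (- ?e)))"
      proof (intro sum_mono mult_mono)
        fix bs assume bs: "bs \<in> ?L"
        show "\<bar>\<Prod>b\<leftarrow>bs. (sqrt h *\<^sub>R w) \<bullet> b\<bar> \<le> norm (sqrt h *\<^sub>R w) ^ M"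
          using prod_list_inner_bound[of bs "sqrt h *\<^sub>R w"] bs by auto
        have "\<bar>partials bs (\<lambda>z. a z h) ?z\<bar> = (\<bar>partials bs (\<lambda>z. a z h) ?z\<bar> * h powr ?e) * h powr (- ?e)"
          using h0 by (simp add: mult.assoc flip: powr_add)
        also have "\<dots> \<le> \<bar>B bs\<bar> * h powr (- ?e)"
          using B[OF bs h, of ?z] by (intro mult_right_mono) auto
        finally show "\<bar>partials bs (\<lambda>z. a z h) ?z\<bar> \<le> \<bar>B bs\<bar> * h powr (- ?e)" .
      qed auto
      also have "\<dots> = norm (sqrt h *\<^sub>R w) ^ M * (E * h powr (- ?e))"
        unfolding E_def by (simp only: sum_distrib_left sum_distrib_right)
      also have "norm (sqrt h *\<^sub>R w) ^ M = h powr (real M / 2) * norm w ^ M"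
        using h0 by (simp add: power_mult_distrib powr_half_sqrt[symmetric] powr_realpow[symmetric] powr_powr)
      also have "h powr (real M / 2) * norm w ^ M * (E * h powr (- ?e)) = E * norm w ^ M * (h powr (real M / 2) * h powr (- ?e))"
        by (simp only: mult_ac)
      also have "h powr (real M / 2) * h powr (- ?e) = h powr (real M / 2 - ?e)"
        by (subst powr_add[symmetric]) (simp add: algebra_simps)
      also have "E * norm w ^ M * \<dots> \<le> E * norm w ^ M * h powr (real N)"
        using ex h0 \<open>0 \<le> E\<close> by (intro mult_left_mono powr_mono') auto
      also have "h powr (real N) = h ^ N" using h0 by (simp add: powr_realpow)
      finally show "\<bar>G M ?z\<bar> \<le> E * norm w ^ M * h ^ N" .
    qed
    then show "\<exists>p. degree p < M \<and>
      (\<forall>t\<ge>0. \<bar>a (z + (t * sqrt h) *\<^sub>R w) h - poly p t\<bar> \<le> (E * norm w ^ M * h ^ N) * t ^ M)"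
      by (simp only: G0 scaleR_scaleR)
  qed
qed

text \<open>The direction of \<open>w\<close> is normalized, so that the remainder along the ray has
  the constant \<open>E * h ^ N\<close> and the size of \<open>w\<close> enters only as the time
  \<open>norm w\<close> on the ray.\<close>

lemma symbol_growth:
  fixes a :: "'a::euclidean_space \<times> 'a \<Rightarrow> real \<Rightarrow> real"
  assumes M: "\<And>w. \<exists>p. degree p < M \<and>
      (\<forall>t\<ge>0. \<bar>a (z + (t * sqrt h) *\<^sub>R w) h - poly p t\<bar> \<le> (E * norm w ^ M * h ^ N) * t ^ M)"
    and h: "0 < h" and S: "\<And>z'. z' \<in> ball z (sqrt h) \<Longrightarrow> \<bar>a z' h\<bar> \<le> S"
  shows "\<bar>a (z + sqrt h *\<^sub>R w) h\<bar> \<le> (real M * real M ^ M + 1) * (S + E * h ^ N) * (1 + norm w) ^ M"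
proof -
  obtain v where v: "norm v = 1" "w = norm w *\<^sub>R v"
  proof (cases "w = 0")
    case True
    \<comment> \<open>The zero vector has no direction; any unit vector serves, at time 0.\<close>
    obtain b :: "'a \<times> 'a" where "b \<in> Basis" using nonempty_Basis by blast
    then show ?thesis using that[of b] True by simp
  next
    case False
    then show ?thesis using that[of "sgn w"] by (simp add: norm_sgn sgn_div_norm)
  qed
  obtain p where p: "degree p < M"
    "\<And>t. 0 \<le> t \<Longrightarrow> \<bar>a (z + (t * sqrt h) *\<^sub>R v) h - poly p t\<bar> \<le> (E * norm v ^ M * h ^ N) * t ^ M"
    using M[of v] by blast
  have "\<bar>a (z + (norm w * sqrt h) *\<^sub>R v) h\<bar> \<le> (real M * real M ^ M + 1) * (S + E * norm v ^ M * h ^ N) * (1 + norm w) ^ M"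
  proof (rule almost_polynomial_growth[OF p])
    show "\<bar>a (z + (t * sqrt h) *\<^sub>R v) h\<bar> \<le> S" if "0 \<le> t" "t < 1" for t
      using that h v by (intro S) (auto simp: dist_norm)
  qed auto
  moreover have "z + (norm w * sqrt h) *\<^sub>R v = z + sqrt h *\<^sub>R w"
    by (subst (2) v(2)) (simp add: mult.commute)
  ultimately show ?thesis using v by simp
qed

section \<open>Distribution of mass in phase space\<close>

text \<open>The mass of a peak of unit width. It depends on the space alone, hence the argument of
  type \<open>itself\<close>.\<close>

definition peak_mass :: "'b::euclidean_space itself \<Rightarrow> real" where
  "peak_mass _ = (LINT (w::'b)|lborel. 1 / (1 + norm w) ^ (2 * DIM('b)))"

lemma peak_mass_nn_integral:
  "(\<integral>\<^sup>+(w::'b::euclidean_space). ennreal (1 / (1 + norm w) ^ (2 * DIM('b))) \<partial>lborel) = ennreal (peak_mass TYPE('b))"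
  unfolding peak_mass_def
  by (rule nn_integral_eq_integral) (auto intro!: integrable_inverse_power_norm)

lemma peak_mass_nonneg: "0 \<le> peak_mass TYPE('b::euclidean_space)"
  by (simp add: peak_mass_def)

text \<open>Averaging over dilations about \<open>z\<^sub>0\<close> replaces polar coordinates: only the measure of \<open>A\<close>
  along rays enters.\<close>

lemma dilation_average:
  fixes A :: "'b::euclidean_space set" and z0 :: 'b
  assumes A[measurable]: "A \<in> sets borel" and r: "0 < r" and \<delta>: "0 \<le> \<delta>"
    and rays: "\<And>v. emeasure lborel {s \<in> {1/2..1}. z0 + (r * s) *\<^sub>R v \<in> A} \<le> ennreal (\<delta> * (1 + norm v))"
  defines "n \<equiv> 2 * DIM('b)"
  shows "(\<integral>\<^sup>+z. indicator A z * ennreal (1 / (1 + norm (z - z0) / r) ^ (n + 1)) \<partial>lborel) \<le>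
    ennreal (r ^ DIM('b) * 2 ^ (n + 2) * \<delta> * peak_mass TYPE('b))"
proof -
  define w where "w = (\<lambda>v::'b. 1 / (1 + norm v) ^ (n + 1))"
  have [measurable]: "w \<in> borel_measurable borel" unfolding w_def by measurable
  have w0: "0 \<le> w v" for v by (simp add: w_def)
  define T where "T = (\<integral>\<^sup>+u. indicator A (z0 + r *\<^sub>R u) * ennreal (w u) \<partial>lborel)"
  have T_eq: "(\<integral>\<^sup>+z. indicator A z * ennreal (1 / (1 + norm (z - z0) / r) ^ (n + 1)) \<partial>lborel) = ennreal (r ^ DIM('b)) * T"
  proof -
    have "(\<integral>\<^sup>+z. indicator A z * ennreal (1 / (1 + norm (z - z0) / r) ^ (n + 1)) \<partial>lborel) =
      ennreal (\<bar>r\<bar> ^ DIM('b)) * (\<integral>\<^sup>+u. indicator A (z0 + r *\<^sub>R u) * ennreal (1 / (1 + norm (z0 + r *\<^sub>R u - z0) / r) ^ (n + 1)) \<partial>lborel)"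
      using r by (intro nn_integral_lborel_affine) auto
    then show ?thesis using r by (simp add: T_def w_def)
  qed
  \<comment> \<open>The substitution \<open>u = s *\<^sub>R v\<close> has Jacobian at most 1 by
    \<open>s \<le> 1\<close>, and \<open>s \<ge> 1/2\<close> bounds the weight at
    \<open>s *\<^sub>R v\<close> by \<open>2 ^ (n + 1)\<close> times the weight at
    \<open>v\<close>.\<close>
  have dil: "T \<le> ennreal (2 ^ (n + 1)) * (\<integral>\<^sup>+v. indicator A (z0 + (r * s) *\<^sub>R v) * ennreal (w v) \<partial>lborel)"
    if s: "s \<in> {1/2..1}" for s
  proof -
    have "T = ennreal (\<bar>s\<bar> ^ DIM('b)) * (\<integral>\<^sup>+v. indicator A (z0 + r *\<^sub>R (0 + s *\<^sub>R v)) * ennreal (w (0 + s *\<^sub>R v)) \<partial>lborel)"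
      unfolding T_def using s by (intro nn_integral_lborel_affine) auto
    also have "\<dots> \<le> 1 * (\<integral>\<^sup>+v. indicator A (z0 + r *\<^sub>R (0 + s *\<^sub>R v)) * ennreal (w (0 + s *\<^sub>R v)) \<partial>lborel)"
      using s by (intro mult_right_mono) (auto simp: power_le_one ennreal_le_1)
    also have "\<dots> \<le> (\<integral>\<^sup>+v. ennreal (2 ^ (n + 1)) * (indicator A (z0 + (r * s) *\<^sub>R v) * ennreal (w v)) \<partial>lborel)"
      unfolding mult_1_left
    proof (rule nn_integral_mono)
      fix v :: 'b
      have "(1 + norm v) / 2 \<le> 1 + norm (s *\<^sub>R v)"
        using s mult_right_mono[of "1/2" s "norm v"] by auto
      then have "((1 + norm v) / 2) ^ (n + 1) \<le> (1 + norm (s *\<^sub>R v)) ^ (n + 1)"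
        by (intro power_mono) auto
      moreover have "0 < ((1 + norm v) / 2) ^ (n + 1)" by (intro zero_less_power) (simp add: add_pos_nonneg)
      ultimately have "w (s *\<^sub>R v) \<le> 1 / ((1 + norm v) / 2) ^ (n + 1)"
        unfolding w_def by (intro divide_left_mono mult_pos_pos) linarith+
      also have "\<dots> = 2 ^ (n + 1) * w v" by (simp add: w_def power_divide)
      finally have "ennreal (w (s *\<^sub>R v)) \<le> ennreal (2 ^ (n + 1)) * ennreal (w v)"
        using w0 by (simp add: ennreal_leI flip: ennreal_mult)
      then show "indicator A (z0 + r *\<^sub>R (0 + s *\<^sub>R v)) * ennreal (w (0 + s *\<^sub>R v)) \<le>
        ennreal (2 ^ (n + 1)) * (indicator A (z0 + (r * s) *\<^sub>R v) * ennreal (w v))"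
        by (auto simp: indicator_def)
    qed
    also have "\<dots> = ennreal (2 ^ (n + 1)) * (\<integral>\<^sup>+v. indicator A (z0 + (r * s) *\<^sub>R v) * ennreal (w v) \<partial>lborel)"
      by (rule nn_integral_cmult) measurable
    finally show ?thesis .
  qed
  have meas: "{s \<in> {1/2..1}. z0 + (r * s) *\<^sub>R v \<in> A} \<in> sets borel" for v
    by measurable
  \<comment> \<open>The interval of dilations has length 1/2. After exchanging the integrals, the
    inner one is the measure bounded by \<open>rays\<close>.\<close>
  have "T * ennreal (1/2) = (\<integral>\<^sup>+s. T * indicator {1/2..1::real} s \<partial>lborel)"
    by (subst nn_integral_cmult_indicator) auto
  also have "\<dots> \<le> (\<integral>\<^sup>+s. ennreal (2 ^ (n + 1)) * (\<integral>\<^sup>+v. indicator {1/2..1::real} s * (indicator A (z0 + (r * s) *\<^sub>R v) * ennreal (w v)) \<partial>lborel) \<partial>lborel)"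
  proof (rule nn_integral_mono)
    fix s :: real
    show "T * indicator {1/2..1} s \<le> ennreal (2 ^ (n + 1)) * (\<integral>\<^sup>+v. indicator {1/2..1::real} s * (indicator A (z0 + (r * s) *\<^sub>R v) * ennreal (w v)) \<partial>lborel)"
      using dil[of s] by (cases "s \<in> {1/2..1}") auto
  qed
  also have "\<dots> = ennreal (2 ^ (n + 1)) * (\<integral>\<^sup>+s. \<integral>\<^sup>+v. indicator {1/2..1::real} s * (indicator A (z0 + (r * s) *\<^sub>R v) * ennreal (w v)) \<partial>lborel \<partial>lborel)"
    by (rule nn_integral_cmult) measurable
  also have "(\<integral>\<^sup>+s. \<integral>\<^sup>+v. indicator {1/2..1::real} s * (indicator A (z0 + (r * s) *\<^sub>R v) * ennreal (w v)) \<partial>lborel \<partial>lborel) =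
     (\<integral>\<^sup>+v. \<integral>\<^sup>+s. indicator {1/2..1::real} s * (indicator A (z0 + (r * s) *\<^sub>R v) * ennreal (w v)) \<partial>lborel \<partial>lborel)"
    by (rule lborel_pair.Fubini'[symmetric]) measurable
  also have "\<dots> \<le> (\<integral>\<^sup>+(v::'b). ennreal \<delta> * ennreal (1 / (1 + norm v) ^ n) \<partial>lborel)"
  proof (rule nn_integral_mono)
    fix v :: 'b
    have "(\<integral>\<^sup>+s. indicator {1/2..1::real} s * (indicator A (z0 + (r * s) *\<^sub>R v) * ennreal (w v)) \<partial>lborel) =
       (\<integral>\<^sup>+s. ennreal (w v) * indicator {s \<in> {1/2..1}. z0 + (r * s) *\<^sub>R v \<in> A} s \<partial>lborel)"
      by (intro nn_integral_cong) (auto simp: indicator_def)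
    also have "\<dots> = ennreal (w v) * emeasure lborel {s \<in> {1/2..1}. z0 + (r * s) *\<^sub>R v \<in> A}"
      by (rule nn_integral_cmult_indicator) (use meas in simp)
    also have "\<dots> \<le> ennreal (w v) * ennreal (\<delta> * (1 + norm v))"
      by (intro mult_left_mono rays) simp
    \<comment> \<open>One power of the weight is spent on the factor \<open>1 + norm v\<close> from
      \<open>rays\<close>; the other \<open>n\<close> stay integrable.\<close>
    also have "\<dots> = ennreal (\<delta> * (1 / (1 + norm v) ^ n))"
    proof -
      have "1 + norm v \<noteq> 0" using norm_ge_zero[of v] by linarith
      then have "w v * (\<delta> * (1 + norm v)) = \<delta> * (1 / (1 + norm v) ^ n)" by (simp add: w_def)
      then show ?thesis using w0[of v] \<delta> by (subst ennreal_mult[symmetric]) auto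
    qed
    also have "\<dots> = ennreal \<delta> * ennreal (1 / (1 + norm v) ^ n)" using \<delta> by (intro ennreal_mult) auto
    finally show "(\<integral>\<^sup>+s. indicator {1/2..1::real} s * (indicator A (z0 + (r * s) *\<^sub>R v) * ennreal (w v)) \<partial>lborel) \<le>
       ennreal \<delta> * ennreal (1 / (1 + norm v) ^ n)" .
  qed
  also have "\<dots> = ennreal \<delta> * ennreal (peak_mass TYPE('b))"
    unfolding n_def by (subst nn_integral_cmult) (auto simp: peak_mass_nn_integral)
  finally have half: "T * ennreal (1/2) \<le> ennreal (2 ^ (n + 1)) * (ennreal \<delta> * ennreal (peak_mass TYPE('b)))"
    by (simp only: mult_left_mono zero_le)
  have "ennreal (1/2) * ennreal 2 = 1" by (subst ennreal_mult[symmetric]) auto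
  then have "T = (T * ennreal (1/2)) * ennreal 2" by (simp only: mult.assoc mult_1_right)
  also have "\<dots> \<le> (ennreal (2 ^ (n + 1)) * (ennreal \<delta> * ennreal (peak_mass TYPE('b)))) * ennreal 2"
    by (intro mult_right_mono half) simp
  also have "\<dots> = ennreal ((2 ^ (n + 1) * (\<delta> * peak_mass TYPE('b))) * 2)"
    using \<delta> peak_mass_nonneg[where 'b='b]
    by (simp only: ennreal_mult mult_nonneg_nonneg zero_le_numeral zero_le_power)
  also have "(2 ^ (n + 1) * (\<delta> * peak_mass TYPE('b))) * 2 = 2 ^ (n + 2) * \<delta> * peak_mass TYPE('b)" by simp
  finally have "ennreal (r ^ DIM('b)) * T \<le> ennreal (r ^ DIM('b)) * ennreal (2 ^ (n + 2) * \<delta> * peak_mass TYPE('b))"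
    by (rule mult_left_mono) simp
  also have "\<dots> = ennreal (r ^ DIM('b) * 2 ^ (n + 2) * \<delta> * peak_mass TYPE('b))"
    using r \<delta> peak_mass_nonneg[where 'b='b] by (subst ennreal_mult[symmetric]) (auto simp: mult_ac)
  finally show ?thesis unfolding T_eq .
qed

context antiwick
begin

text \<open>Phase space has dimension \<open>2 * DIM('a)\<close>, so the dilation by
  \<open>sqrt h\<close> contributes \<open>h ^ DIM('a)\<close>, exactly the power in
  \<open>\<kappa>\<close>.\<close>

lemma kappa_h: "\<kappa> * sqrt h ^ DIM('a \<times> 'a) = 1 / (2 * pi) ^ DIM('a)"
proof -
  have "sqrt h ^ DIM('a \<times> 'a) = (sqrt h ^ 2) ^ DIM('a)"
    by (simp only: DIM_prod mult_2[symmetric] power_mult)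
  also have "\<dots> = h ^ DIM('a)" using h by simp
  finally show ?thesis using h by (simp add: \<kappa>_def power_mult_distrib)
qed

text \<open>The reproducing formula makes \<open>V f\<close> a superposition of peaks of width \<open>sqrt h\<close>. By the Schur
  test, its mass on \<open>A\<close> is controlled by the proportion of \<open>A\<close> in such a peak.\<close>

lemma transform_mass_bound:
  defines "n \<equiv> 2 * DIM('a \<times> 'a)" and "I \<equiv> peak_mass TYPE('a \<times> 'a)"
  assumes C: "0 \<le> C" "\<And>u w. norm (ambiguity \<phi> \<phi> u w) \<le> C / (1 + norm (u, w)) ^ (n + 1)"
    and A[measurable]: "A \<in> sets borel" and \<eta>: "0 \<le> \<eta>"
    and mass: "\<And>z'. (\<integral>\<^sup>+z. indicator A z * ennreal (1 / (1 + norm (z - z') / sqrt h) ^ (n + 1)) \<partial>lborel) \<le>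
       ennreal (sqrt h ^ DIM('a \<times> 'a) * \<eta>)"
    and f: "f \<in> L2" "l2_norm f = 1"
  shows "ennreal \<kappa> * (\<integral>\<^sup>+z. indicator A z * ennreal ((norm (V f z))\<^sup>2) \<partial>lborel) \<le>
    ennreal (C\<^sup>2 * (1 / (2 * pi) ^ DIM('a))\<^sup>2 * I * \<eta>)"
proof -
  have [measurable]: "V f \<in> borel_measurable borel"
    by (rule transform_measurable[OF phi phi1 h L2_measurable[OF f(1)]])
  have I0: "0 \<le> I" by (simp add: I_def peak_mass_nonneg)
  let ?H = "sqrt h ^ DIM('a \<times> 'a)"
  \<comment> \<open>Apart from \<open>C\<close>, a majorant of the overlap of two coherent
    states.\<close>
  define k where "k = (\<lambda>z::'a \<times> 'a. 1 / (1 + norm z / sqrt h) ^ (n + 1))"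
  have km[measurable]: "k \<in> borel_measurable borel" unfolding k_def by measurable
  have k0: "0 \<le> k z" for z using h by (simp add: k_def)
  have ksym: "k (z - z') = k (z' - z)" for z z' by (simp add: k_def norm_minus_commute)
  have kI: "(\<integral>\<^sup>+z'. ennreal (k (z' - z)) \<partial>lborel) \<le> ennreal (?H * I)" for z
  proof -
    have "(\<integral>\<^sup>+z'. ennreal (k (z' - z)) \<partial>lborel) = ennreal (\<bar>sqrt h\<bar> ^ DIM('a \<times> 'a)) * (\<integral>\<^sup>+w. ennreal (k (z + sqrt h *\<^sub>R w - z)) \<partial>lborel)"
      using h by (intro nn_integral_lborel_affine) auto
    also have "\<dots> \<le> ennreal ?H * (\<integral>\<^sup>+(w::'a \<times> 'a). ennreal (1 / (1 + norm w) ^ n) \<partial>lborel)"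
    proof -
      have "k (sqrt h *\<^sub>R w) \<le> 1 / (1 + norm w) ^ n" for w
      proof -
        have "k (sqrt h *\<^sub>R w) = 1 / (1 + norm w) ^ (n + 1)" using h by (simp add: k_def)
        also have "\<dots> \<le> 1 / (1 + norm w) ^ n"
          by (intro divide_left_mono power_increasing mult_pos_pos zero_less_power) (auto simp: add_pos_nonneg)
        finally show ?thesis .
      qed
      then have "(\<integral>\<^sup>+w. ennreal (k (z + sqrt h *\<^sub>R w - z)) \<partial>lborel) \<le> (\<integral>\<^sup>+(w::'a \<times> 'a). ennreal (1 / (1 + norm w) ^ n) \<partial>lborel)"
        by (intro nn_integral_mono ennreal_leI) simp
      then show ?thesis using h by (simp add: mult_left_mono)
    qed
    also have "\<dots> = ennreal (?H * I)"
      unfolding peak_mass_nn_integral[where 'b="'a \<times> 'a", folded n_def I_def]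
      using h I0 by (intro ennreal_mult[symmetric]) auto
    finally show ?thesis .
  qed
  \<comment> \<open>Reproducing formula and Cauchy-Schwarz with the kernel split into two square
    roots: one stays with \<open>V f\<close>, the other is integrated by \<open>kI\<close>.\<close>
  have pt: "(ennreal (norm (V f z)))\<^sup>2 \<le> ennreal (\<kappa>\<^sup>2 * C\<^sup>2 * (?H * I)) * (\<integral>\<^sup>+z'. ennreal ((norm (V f z'))\<^sup>2 * k (z - z')) \<partial>lborel)" for z
  proof -
    let ?p = "coherent_state \<phi> h z"
    have L: "V f \<in> L2" "V ?p \<in> L2" using transform_L2[OF phi phi1 h] f coherent_L2 by auto
    have "l2_inner (V f) (V ?p) = complex_of_real ((2 * pi * h) ^ DIM('a)) * V f z"
      by (rule transform_inner[OF phi phi1 h f(1) coherent_L2])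
    then have "V f z = complex_of_real \<kappa> * l2_inner (V f) (V ?p)"
      using h by (simp add: \<kappa>_def)
    then have "norm (V f z) = \<kappa> * norm (l2_inner (V f) (V ?p))"
      using kappa_pos by (simp add: norm_mult)
    also have "norm (l2_inner (V f) (V ?p)) \<le> (LINT z'|lborel. norm (V f z' * cnj (V ?p z')))"
      unfolding l2_inner_def[of "V f"] by (rule integral_norm_bound)
    finally have "norm (V f z) \<le> \<kappa> * (LINT z'|lborel. norm (V f z' * cnj (V ?p z')))"
      using kappa_pos by (simp add: mult_left_mono)
    then have "ennreal (norm (V f z)) \<le> ennreal (\<kappa> * (LINT z'|lborel. norm (V f z' * cnj (V ?p z'))))"
      by (rule ennreal_leI)
    also have "\<dots> = ennreal \<kappa> * ennreal (LINT z'|lborel. norm (V f z' * cnj (V ?p z')))"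
      using kappa_pos by (intro ennreal_mult) auto
    also have "ennreal (LINT z'|lborel. norm (V f z' * cnj (V ?p z'))) = (\<integral>\<^sup>+z'. ennreal (norm (V f z' * cnj (V ?p z'))) \<partial>lborel)"
      using l2_inner_integrable[OF L] by (intro nn_integral_eq_integral[symmetric]) auto
    also have "\<dots> \<le> (\<integral>\<^sup>+z'. ennreal C * (ennreal (norm (V f z') * sqrt (k (z - z'))) * ennreal (sqrt (k (z - z')))) \<partial>lborel)"
    proof (rule nn_integral_mono)
      fix z'
      have "norm (V ?p z') \<le> C * k (z - z')"
        using l2_inner_coherent_bound[OF C, of z z'] by (simp add: k_def norm_minus_commute)
      then have "norm (V f z' * cnj (V ?p z')) \<le> norm (V f z') * (C * k (z - z'))"
        unfolding norm_mult complex_mod_cnj by (intro mult_left_mono) auto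
      also have "\<dots> = C * ((norm (V f z') * sqrt (k (z - z'))) * sqrt (k (z - z')))"
        using k0[of "z - z'"] by simp
      finally have "ennreal (norm (V f z' * cnj (V ?p z'))) \<le> ennreal (C * ((norm (V f z') * sqrt (k (z - z'))) * sqrt (k (z - z'))))"
        by (rule ennreal_leI)
      also have "\<dots> = ennreal C * ennreal ((norm (V f z') * sqrt (k (z - z'))) * sqrt (k (z - z')))"
        using C(1) k0[of "z - z'"] by (intro ennreal_mult) auto
      also have "ennreal ((norm (V f z') * sqrt (k (z - z'))) * sqrt (k (z - z'))) =
          ennreal (norm (V f z') * sqrt (k (z - z'))) * ennreal (sqrt (k (z - z')))"
        using k0[of "z - z'"] by (intro ennreal_mult) auto
      finally show "ennreal (norm (V f z' * cnj (V ?p z'))) \<le> ennreal C * (ennreal (norm (V f z') * sqrt (k (z - z'))) * ennreal (sqrt (k (z - z'))))" .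
    qed
    also have "\<dots> = ennreal C * (\<integral>\<^sup>+z'. ennreal (norm (V f z') * sqrt (k (z - z'))) * ennreal (sqrt (k (z - z'))) \<partial>lborel)"
      by (rule nn_integral_cmult) measurable
    finally have "ennreal (norm (V f z)) \<le> ennreal \<kappa> * (ennreal C * (\<integral>\<^sup>+z'. ennreal (norm (V f z') * sqrt (k (z - z'))) * ennreal (sqrt (k (z - z'))) \<partial>lborel))"
      by (simp only: mult_left_mono zero_le)
    then have "(ennreal (norm (V f z)))\<^sup>2 \<le> (ennreal \<kappa> * (ennreal C * (\<integral>\<^sup>+z'. ennreal (norm (V f z') * sqrt (k (z - z'))) * ennreal (sqrt (k (z - z'))) \<partial>lborel)))\<^sup>2"
      by (intro power_mono) auto
    also have "\<dots> = ennreal (\<kappa>\<^sup>2 * C\<^sup>2) * (\<integral>\<^sup>+z'. ennreal (norm (V f z') * sqrt (k (z - z'))) * ennreal (sqrt (k (z - z'))) \<partial>lborel)\<^sup>2"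
      using kappa_pos C(1) by (simp add: power_mult_distrib ennreal_power ennreal_mult mult.assoc)
    also have "(\<integral>\<^sup>+z'. ennreal (norm (V f z') * sqrt (k (z - z'))) * ennreal (sqrt (k (z - z'))) \<partial>lborel)\<^sup>2 \<le>
       (\<integral>\<^sup>+z'. (ennreal (norm (V f z') * sqrt (k (z - z'))))\<^sup>2 \<partial>lborel) * (\<integral>\<^sup>+z'. (ennreal (sqrt (k (z - z'))))\<^sup>2 \<partial>lborel)"
      by (rule Cauchy_Schwarz_nn_integral) measurable
    also have "(\<integral>\<^sup>+z'. (ennreal (norm (V f z') * sqrt (k (z - z'))))\<^sup>2 \<partial>lborel) = (\<integral>\<^sup>+z'. ennreal ((norm (V f z'))\<^sup>2 * k (z - z')) \<partial>lborel)"
      using k0 by (intro nn_integral_cong) (simp add: ennreal_power power_mult_distrib)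
    also have "(\<integral>\<^sup>+z'. (ennreal (sqrt (k (z - z'))))\<^sup>2 \<partial>lborel) = (\<integral>\<^sup>+z'. ennreal (k (z' - z)) \<partial>lborel)"
      using k0 by (intro nn_integral_cong) (simp add: ennreal_power ksym[of z])
    also have "\<dots> \<le> ennreal (?H * I)" by (rule kI)
    finally have "(ennreal (norm (V f z)))\<^sup>2 \<le> ennreal (\<kappa>\<^sup>2 * C\<^sup>2) * ((\<integral>\<^sup>+z'. ennreal ((norm (V f z'))\<^sup>2 * k (z - z')) \<partial>lborel) * ennreal (?H * I))"
      by (simp only: mult_left_mono zero_le)
    also have "\<dots> = ennreal (\<kappa>\<^sup>2 * C\<^sup>2 * (?H * I)) * (\<integral>\<^sup>+z'. ennreal ((norm (V f z'))\<^sup>2 * k (z - z')) \<partial>lborel)"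
      using h I0 by (simp add: ennreal_mult mult_ac)
    finally show ?thesis .
  qed
  have "(\<integral>\<^sup>+z. indicator A z * ennreal ((norm (V f z))\<^sup>2) \<partial>lborel) \<le>
     (\<integral>\<^sup>+z. ennreal (\<kappa>\<^sup>2 * C\<^sup>2 * (?H * I)) * (\<integral>\<^sup>+z'. indicator A z * ennreal ((norm (V f z'))\<^sup>2 * k (z - z')) \<partial>lborel) \<partial>lborel)"
  proof (rule nn_integral_mono)
    fix z
    show "indicator A z * ennreal ((norm (V f z))\<^sup>2) \<le>
       ennreal (\<kappa>\<^sup>2 * C\<^sup>2 * (?H * I)) * (\<integral>\<^sup>+z'. indicator A z * ennreal ((norm (V f z'))\<^sup>2 * k (z - z')) \<partial>lborel)"
      using pt[of z] by (cases "z \<in> A") (auto simp: ennreal_power)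
  qed
  also have "\<dots> = ennreal (\<kappa>\<^sup>2 * C\<^sup>2 * (?H * I)) * (\<integral>\<^sup>+z. \<integral>\<^sup>+z'. indicator A z * ennreal ((norm (V f z'))\<^sup>2 * k (z - z')) \<partial>lborel \<partial>lborel)"
    by (rule nn_integral_cmult) measurable
  also have "(\<integral>\<^sup>+z. \<integral>\<^sup>+z'. indicator A z * ennreal ((norm (V f z'))\<^sup>2 * k (z - z')) \<partial>lborel \<partial>lborel) =
     (\<integral>\<^sup>+z'. \<integral>\<^sup>+z. indicator A z * ennreal ((norm (V f z'))\<^sup>2 * k (z - z')) \<partial>lborel \<partial>lborel)"
    by (rule lborel_pair.Fubini'[symmetric]) measurable
  \<comment> \<open>The integral over \<open>z\<close> in \<open>A\<close> is now the inner one, so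
    the kernel contributes the proportion \<open>\<eta>\<close> instead of its full mass.\<close>
  also have "\<dots> \<le> (\<integral>\<^sup>+z'. ennreal (?H * \<eta>) * ennreal ((norm (V f z'))\<^sup>2) \<partial>lborel)"
  proof (rule nn_integral_mono)
    fix z'
    have "(\<integral>\<^sup>+z. indicator A z * ennreal ((norm (V f z'))\<^sup>2 * k (z - z')) \<partial>lborel) =
       (\<integral>\<^sup>+z. ennreal ((norm (V f z'))\<^sup>2) * (indicator A z * ennreal (k (z - z'))) \<partial>lborel)"
      using k0 by (intro nn_integral_cong) (simp add: ennreal_mult mult_ac)
    also have "\<dots> = ennreal ((norm (V f z'))\<^sup>2) * (\<integral>\<^sup>+z. indicator A z * ennreal (k (z - z')) \<partial>lborel)"
      by (rule nn_integral_cmult) measurable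
    also have "\<dots> \<le> ennreal ((norm (V f z'))\<^sup>2) * ennreal (?H * \<eta>)"
      unfolding k_def by (intro mult_left_mono mass) simp
    finally show "(\<integral>\<^sup>+z. indicator A z * ennreal ((norm (V f z'))\<^sup>2 * k (z - z')) \<partial>lborel) \<le> ennreal (?H * \<eta>) * ennreal ((norm (V f z'))\<^sup>2)"
      by (simp only: mult.commute)
  qed
  also have "\<dots> = ennreal (?H * \<eta>) * (\<integral>\<^sup>+z'. ennreal ((norm (V f z'))\<^sup>2) \<partial>lborel)"
    by (rule nn_integral_cmult) measurable
  finally have "ennreal \<kappa> * (\<integral>\<^sup>+z. indicator A z * ennreal ((norm (V f z))\<^sup>2) \<partial>lborel) \<le>
     ennreal \<kappa> * (ennreal (\<kappa>\<^sup>2 * C\<^sup>2 * (?H * I)) * (ennreal (?H * \<eta>) * (\<integral>\<^sup>+z'. ennreal ((norm (V f z'))\<^sup>2) \<partial>lborel)))"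
    by (simp only: mult_left_mono zero_le)
  also have "\<dots> = ennreal (\<kappa>\<^sup>2 * C\<^sup>2 * (?H * I)) * (ennreal (?H * \<eta>) * (ennreal \<kappa> * (\<integral>\<^sup>+z'. ennreal ((norm (V f z'))\<^sup>2) \<partial>lborel)))"
    by (simp only: mult_ac)
  also have "ennreal \<kappa> * (\<integral>\<^sup>+z'. ennreal ((norm (V f z'))\<^sup>2) \<partial>lborel) = 1"
    using kappa_transform[OF f(1)] f(2) by simp
  also have "ennreal (\<kappa>\<^sup>2 * C\<^sup>2 * (?H * I)) * (ennreal (?H * \<eta>) * 1) = ennreal ((\<kappa>\<^sup>2 * C\<^sup>2 * (?H * I)) * (?H * \<eta>))"
    using h I0 \<eta> by (subst ennreal_mult) auto
  \<comment> \<open>Each of the two factors \<open>?H\<close> meets one factor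
    \<open>\<kappa>\<close>, which frees the constant of \<open>h\<close>.\<close>
  also have "(\<kappa>\<^sup>2 * C\<^sup>2 * (?H * I)) * (?H * \<eta>) = C\<^sup>2 * (\<kappa> * ?H)\<^sup>2 * I * \<eta>"
    by (simp add: power2_eq_square)
  finally show ?thesis by (simp only: kappa_h)
qed

end

section \<open>Bounds for the bottom of the spectrum\<close>

lemma continuous_bdd_above_ball:
  fixes f :: "'b::euclidean_space \<Rightarrow> real"
  assumes "continuous_on UNIV f"
  shows "bdd_above (f ` ball z r)"
proof -
  have "compact (f ` cball z r)"
    by (rule compact_continuous_image[OF continuous_on_subset[OF assms]]) auto
  then have "bdd_above (f ` cball z r)" by (intro bounded_imp_bdd_above compact_imp_bounded)
  then show ?thesis by (rule bdd_above_mono) (intro image_mono ball_subset_cball)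
qed

context antiwick
begin

text \<open>In the exponent of the overlap decay, \<open>K\<close> powers compensate the growth of
  the symbol and \<open>2 * DIM('a \<times> 'a)\<close> leave an integrable weight. The power of
  \<open>h\<close> in \<open>\<kappa>\<close> is cancelled by the Jacobian of the rescaling.\<close>

lemma inf_spectrum_upper:
  assumes cont: "continuous_on UNIV (\<lambda>z. a z h)" and E: "0 \<le> E"
    and poly: "\<And>w. \<exists>p. degree p < K \<and>
      (\<forall>t\<ge>0. \<bar>a (z0 + (t * sqrt h) *\<^sub>R w) h - poly p t\<bar> \<le> (E * norm w ^ K * h ^ N) * t ^ K)"
    and C: "0 \<le> C" "\<And>u w. norm (ambiguity \<phi> \<phi> u w) \<le> C / (1 + norm (u, w)) ^ (2 * DIM('a \<times> 'a) + K)"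
  shows "inf_spectrum (antiwick_op \<phi> a h) \<le>
    (real K * real K ^ K + 1) * C\<^sup>2 * peak_mass TYPE('a \<times> 'a) / (2 * pi) ^ DIM('a) *
      ((SUP z\<in>ball z0 (sqrt h). a z h) + E * h ^ N)"
proof -
  define n where "n = 2 * DIM('a \<times> 'a)"
  define I where "I = peak_mass TYPE('a \<times> 'a)"
  define L where "L = real K * real K ^ K + 1"
  define S where "S = (SUP z\<in>ball z0 (sqrt h). a z h)"
  have bdd: "bdd_above ((\<lambda>z. a z h) ` ball z0 (sqrt h))" by (rule continuous_bdd_above_ball[OF cont])
  have SU: "a z h \<le> S" if "z \<in> ball z0 (sqrt h)" for z
    unfolding S_def using that bdd by (rule cSUP_upper)
  have "0 \<le> S" using order_trans[OF a_nonneg SU[of z0]] h by simp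
  then have s0: "0 \<le> S + E * h ^ N" using E h by simp
  have L0: "0 \<le> L" and I0: "0 \<le> I" by (auto simp: L_def I_def peak_mass_nonneg)
  have growth: "a (z0 + sqrt h *\<^sub>R w) h \<le> L * (S + E * h ^ N) * (1 + norm w) ^ K" for w
  proof -
    have "\<bar>a (z0 + sqrt h *\<^sub>R w) h\<bar> \<le> (real K * real K ^ K + 1) * (S + E * h ^ N) * (1 + norm w) ^ K"
      by (rule symbol_growth[where a=a and h=h and N=N, OF poly h]) (use SU a_nonneg in auto)
    then show ?thesis unfolding L_def by linarith
  qed
  let ?p = "coherent_state \<phi> h z0"
  have am: "(\<lambda>z. ennreal (a z h * (norm (V ?p z))\<^sup>2)) \<in> borel_measurable borel"
    using a_measurable transform_measurable[OF phi phi1 h L2_measurable[OF coherent_L2[of z0]]] by measurable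
  have "antiwick_quad \<phi> a h ?p = ennreal \<kappa> * (\<integral>\<^sup>+z. ennreal (a z h * (norm (V ?p z))\<^sup>2) \<partial>lborel)"
    by (simp add: antiwick_quad_def \<kappa>_def)
  also have "(\<integral>\<^sup>+z. ennreal (a z h * (norm (V ?p z))\<^sup>2) \<partial>lborel) = ennreal (\<bar>sqrt h\<bar> ^ DIM('a \<times> 'a)) *
     (\<integral>\<^sup>+w. ennreal (a (z0 + sqrt h *\<^sub>R w) h * (norm (V ?p (z0 + sqrt h *\<^sub>R w)))\<^sup>2) \<partial>lborel)"
    using h by (intro nn_integral_lborel_affine am) auto
  also have "(\<integral>\<^sup>+w. ennreal (a (z0 + sqrt h *\<^sub>R w) h * (norm (V ?p (z0 + sqrt h *\<^sub>R w)))\<^sup>2) \<partial>lborel) \<le>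
     (\<integral>\<^sup>+(w::'a \<times> 'a). ennreal (L * (S + E * h ^ N) * C\<^sup>2) * ennreal (1 / (1 + norm w) ^ n) \<partial>lborel)"
  proof (rule nn_integral_mono)
    fix w :: "'a \<times> 'a"
    let ?t = "1 + norm w"
    have t: "1 \<le> ?t" by simp
    have "norm (V ?p (z0 + sqrt h *\<^sub>R w)) \<le> C / ?t ^ (n + K)"
      using l2_inner_coherent_bound[OF C, of z0 "z0 + sqrt h *\<^sub>R w"] h by (simp add: n_def)
    then have "(norm (V ?p (z0 + sqrt h *\<^sub>R w)))\<^sup>2 \<le> (C / ?t ^ (n + K))\<^sup>2" by (intro power_mono) auto
    then have "a (z0 + sqrt h *\<^sub>R w) h * (norm (V ?p (z0 + sqrt h *\<^sub>R w)))\<^sup>2 \<le>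
      (L * (S + E * h ^ N) * ?t ^ K) * (C / ?t ^ (n + K))\<^sup>2"
      using growth[of w] L0 s0 by (intro mult_mono) auto
    also have "\<dots> = L * (S + E * h ^ N) * C\<^sup>2 * (1 / ?t ^ n) * (1 / ?t ^ (n + K))"
      using t by (simp add: power_add power_divide power2_eq_square)
    also have "\<dots> \<le> L * (S + E * h ^ N) * C\<^sup>2 * (1 / ?t ^ n) * 1"
    proof (rule mult_left_mono)
      have "1 \<le> ?t ^ (n + K)" by (rule one_le_power[OF t])
      then show "1 / ?t ^ (n + K) \<le> 1" by (subst divide_le_eq_1) linarith
    qed (use L0 s0 in simp)
    finally have "ennreal (a (z0 + sqrt h *\<^sub>R w) h * (norm (V ?p (z0 + sqrt h *\<^sub>R w)))\<^sup>2) \<le>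
       ennreal (L * (S + E * h ^ N) * C\<^sup>2 * (1 / ?t ^ n))" by (intro ennreal_leI) simp
    also have "\<dots> = ennreal (L * (S + E * h ^ N) * C\<^sup>2) * ennreal (1 / ?t ^ n)"
      using L0 s0 by (intro ennreal_mult) auto
    finally show "ennreal (a (z0 + sqrt h *\<^sub>R w) h * (norm (V ?p (z0 + sqrt h *\<^sub>R w)))\<^sup>2) \<le>
      ennreal (L * (S + E * h ^ N) * C\<^sup>2) * ennreal (1 / ?t ^ n)" .
  qed
  also have "(\<integral>\<^sup>+(w::'a \<times> 'a). ennreal (L * (S + E * h ^ N) * C\<^sup>2) * ennreal (1 / (1 + norm w) ^ n) \<partial>lborel) =
     ennreal (L * (S + E * h ^ N) * C\<^sup>2) * ennreal I"
    unfolding n_def I_def peak_mass_nn_integral[symmetric] by (rule nn_integral_cmult) measurable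
  finally have "antiwick_quad \<phi> a h ?p \<le> ennreal \<kappa> * (ennreal (\<bar>sqrt h\<bar> ^ DIM('a \<times> 'a)) * (ennreal (L * (S + E * h ^ N) * C\<^sup>2) * ennreal I))"
    by (simp only: mult_left_mono zero_le)
  also have "\<dots> = ennreal (\<kappa> * (\<bar>sqrt h\<bar> ^ DIM('a \<times> 'a) * ((L * (S + E * h ^ N) * C\<^sup>2) * I)))"
    using kappa_pos L0 s0 I0 by (simp only: ennreal_mult mult_nonneg_nonneg zero_le_power abs_ge_zero less_imp_le zero_le_power2)
  also have "\<kappa> * (\<bar>sqrt h\<bar> ^ DIM('a \<times> 'a) * ((L * (S + E * h ^ N) * C\<^sup>2) * I)) =
      (\<kappa> * sqrt h ^ DIM('a \<times> 'a)) * (L * C\<^sup>2 * I * (S + E * h ^ N))"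
    using h by (simp only: mult_ac abs_of_pos real_sqrt_gt_0_iff)
  also have "\<dots> = L * C\<^sup>2 * I / (2 * pi) ^ DIM('a) * (S + E * h ^ N)"
    unfolding kappa_h by simp
  finally have "ennreal (inf_spectrum (antiwick_op \<phi> a h)) \<le> ennreal (L * C\<^sup>2 * I / (2 * pi) ^ DIM('a) * (S + E * h ^ N))"
    by (rule order_trans[OF inf_spectrum_le[OF coherent_state_dom l2_norm_coherent_state[OF phi phi1 h]]])
  moreover have "0 \<le> L * C\<^sup>2 * I / (2 * pi) ^ DIM('a) * (S + E * h ^ N)"
    using L0 I0 s0 by simp
  ultimately show ?thesis
    unfolding L_def I_def S_def by (simp only: ennreal_le_iff)
qed

text \<open>The factor 8 has two sources: \<open>A\<close> is cut at the level
  \<open>lambda' a h / (4 * \<Gamma>)\<close>, and at least half of the mass lies outside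
  \<open>A\<close>. The hypothesis \<open>large\<close> keeps the remainder of the polynomial
  approximation below \<open>lambda' a h / 4\<close>.\<close>

lemma inf_spectrum_lower:
  assumes cont: "continuous_on UNIV (\<lambda>z. a z h)" and E: "0 \<le> E" and K: "0 < K"
    and poly: "\<And>z w. \<exists>p. degree p < K \<and>
      (\<forall>t\<ge>0. \<bar>a (z + (t * sqrt h) *\<^sub>R w) h - poly p t\<bar> \<le> (E * norm w ^ K * h ^ N) * t ^ K)"
    and C: "0 \<le> C" "\<And>u w. norm (ambiguity \<phi> \<phi> u w) \<le> C / (1 + norm (u, w)) ^ (2 * DIM('a \<times> 'a) + 1)"
    and \<delta>: "0 < \<delta>" "\<delta> \<le> 1"
    and \<delta>_small: "C\<^sup>2 * (1 / (2 * pi) ^ DIM('a))\<^sup>2 * peak_mass TYPE('a \<times> 'a) *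
      (2 ^ (4 * DIM('a \<times> 'a) + 3) * \<delta> * peak_mass TYPE('a \<times> 'a)) \<le> 1 / 2"
    and \<Gamma>: "\<Gamma> = real K * (2 * real K / \<delta>) ^ K"
    and large: "\<Gamma> * E * (1 / \<delta>) ^ K * h ^ N < lambda' a h / 4"
  shows "lambda' a h / (8 * \<Gamma>) \<le> inf_spectrum (antiwick_op \<phi> a h)"
proof -
  define n where "n = 2 * DIM('a \<times> 'a)"
  define I where "I = peak_mass TYPE('a \<times> 'a)"
  define \<mu> where "\<mu> = lambda' a h"
  have I0: "0 \<le> I" by (simp add: I_def peak_mass_nonneg)
  have \<Gamma>0: "0 < \<Gamma>" using K \<delta> by (simp add: \<Gamma>)
  have "0 \<le> \<Gamma> * E * (1 / \<delta>) ^ K * h ^ N" using \<Gamma>0 E \<delta> h by simp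
  then have \<mu>: "0 < \<mu>" using large by (simp add: \<mu>_def)
  \<comment> \<open>At this level the sublevel estimate yields \<open>\<mu> / 4\<close> plus a
    remainder below \<open>\<mu> / 4\<close>, which contradicts a value above
    \<open>\<mu> / 2\<close> at the start of the ray.\<close>
  define A where "A = {z. a z h < \<mu> / (4 * \<Gamma>)}"
  have A[measurable]: "A \<in> sets borel" unfolding A_def using a_measurable by measurable
  have bdd: "bdd_above ((\<lambda>z. a z h) ` ball z (sqrt h))" for z by (rule continuous_bdd_above_ball[OF cont])
  \<comment> \<open>The supremum over the open ball need not be attained; half of
    \<open>\<mu>\<close> is exceeded at some point.\<close>
  have peak: "\<exists>z1\<in>ball z (sqrt h). \<mu> / 2 < a z1 h" for z
  proof -
    have S0: "0 \<le> (SUP z'\<in>ball z (sqrt h). a z' h)" for z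
      using order_trans[OF a_nonneg cSUP_upper[OF _ bdd, of z z]] h by simp
    have "\<mu> \<le> (SUP z'\<in>ball z (sqrt h). a z' h)"
      unfolding \<mu>_def lambda'_def by (rule cINF_lower) (auto intro!: bdd_belowI2[of _ 0] S0)
    then have "\<mu> / 2 < (SUP z'\<in>ball z (sqrt h). a z' h)" using \<mu> by simp
    then show ?thesis using h by (subst (asm) less_cSUP_iff[OF _ bdd]) auto
  qed
  have rays: "emeasure lborel {s \<in> {1/2..1}. z1 + (sqrt h * s) *\<^sub>R v \<in> A} \<le> ennreal (\<delta> * (1 + norm v))"
    if z1: "\<mu> / 2 < a z1 h" for z1 v
  proof (rule ccontr)
    let ?X = "{s \<in> {1/2..1}. z1 + (sqrt h * s) *\<^sub>R v \<in> A}"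
    have X: "?X \<in> sets borel" by measurable
    assume "\<not> emeasure lborel ?X \<le> ennreal (\<delta> * (1 + norm v))"
    then have big: "ennreal (\<delta> * (1 + norm v)) < emeasure lborel ?X" by simp
    show False
    \<comment> \<open>For long \<open>v\<close> the claimed bound exceeds the length 1/2 of the
      whole interval. For the others the remainder, which grows with \<open>norm v\<close>, is under
      control.\<close>
    proof (cases "norm v \<le> 1 / \<delta>")
      case True
      obtain p where p: "degree p < K"
        "\<And>t. 0 \<le> t \<Longrightarrow> \<bar>a (z1 + (t * sqrt h) *\<^sub>R v) h - poly p t\<bar> \<le> (E * norm v ^ K * h ^ N) * t ^ K"
        using poly[of z1 v] by blast
      have "\<bar>a (z1 + (0 * sqrt h) *\<^sub>R v) h\<bar> \<le> real K * (2 * real K / \<delta>) ^ K * (\<mu> / (4 * \<Gamma>) + E * norm v ^ K * h ^ N)"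
      proof (rule almost_polynomial_sublevel[OF p X])
        have "\<delta> \<le> \<delta> * (1 + norm v)" using \<delta> by simp
        then show "ennreal \<delta> < emeasure lborel ?X" using big by (meson ennreal_leI le_less_trans)
        show "\<bar>a (z1 + (t * sqrt h) *\<^sub>R v) h\<bar> \<le> \<mu> / (4 * \<Gamma>)" if "t \<in> ?X" for t
          using that a_nonneg[of "z1 + (t * sqrt h) *\<^sub>R v"] by (simp add: A_def mult.commute)
      qed (use \<delta> in auto)
      then have "a z1 h \<le> \<Gamma> * (\<mu> / (4 * \<Gamma>) + E * norm v ^ K * h ^ N)"
        unfolding \<Gamma>[symmetric] by simp
      also have "\<dots> = \<mu> / 4 + \<Gamma> * E * norm v ^ K * h ^ N" using \<Gamma>0 by (simp add: field_simps)
      also have "\<Gamma> * E * norm v ^ K * h ^ N \<le> \<Gamma> * E * (1 / \<delta>) ^ K * h ^ N"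
        using \<Gamma>0 E True h by (intro mult_right_mono mult_left_mono power_mono) auto
      also have "\<dots> < \<mu> / 4" using large by (simp add: \<mu>_def)
      finally show False using z1 by simp
    next
      case False
      have "emeasure lborel ?X \<le> emeasure lborel {1/2..1::real}" by (rule emeasure_mono) auto
      also have "\<dots> = ennreal (1/2)" by (subst emeasure_lborel_Icc) auto
      also have "\<dots> \<le> ennreal (\<delta> * (1 + norm v))"
      proof (rule ennreal_leI)
        have "1 \<le> \<delta> * norm v" using False \<delta> by (simp add: field_simps)
        then show "1/2 \<le> \<delta> * (1 + norm v)" using \<delta> by (simp add: distrib_left)
      qed
      finally show False using big by simp
    qed
  qed
  \<comment> \<open>The peak is centred at an arbitrary \<open>z'\<close>, while \<open>rays\<close>
    is available from a nearby \<open>z1\<close>; moving the centre by less than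
    \<open>sqrt h\<close> costs the factor \<open>2 ^ (n + 1)\<close>.\<close>
  have mass: "(\<integral>\<^sup>+z. indicator A z * ennreal (1 / (1 + norm (z - z') / sqrt h) ^ (n + 1)) \<partial>lborel) \<le>
     ennreal (sqrt h ^ DIM('a \<times> 'a) * (2 ^ (4 * DIM('a \<times> 'a) + 3) * \<delta> * I))" for z'
  proof -
    obtain z1 where z1: "z1 \<in> ball z' (sqrt h)" "\<mu> / 2 < a z1 h" using peak by blast
    have "(\<integral>\<^sup>+z. indicator A z * ennreal (1 / (1 + norm (z - z') / sqrt h) ^ (n + 1)) \<partial>lborel) \<le>
       (\<integral>\<^sup>+z. ennreal (2 ^ (n + 1)) * (indicator A z * ennreal (1 / (1 + norm (z - z1) / sqrt h) ^ (n + 1))) \<partial>lborel)"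
    proof (rule nn_integral_mono)
      fix z
      have pos: "0 < 1 + norm (z - z') / sqrt h" "0 < 1 + norm (z - z1) / sqrt h" using h by (auto simp: add_pos_nonneg)
      have "norm (z - z1) \<le> norm (z - z') + norm (z' - z1)"
        using norm_triangle_ineq[of "z - z'" "z' - z1"] by simp
      also have "norm (z' - z1) \<le> sqrt h" using z1(1) by (simp add: dist_norm)
      finally have "norm (z - z1) / sqrt h \<le> norm (z - z') / sqrt h + 1"
        using h by (simp add: field_simps)
      moreover have "0 \<le> norm (z - z') / sqrt h" using h by simp
      ultimately have "(1 + norm (z - z1) / sqrt h) ^ (n + 1) \<le> (2 * (1 + norm (z - z') / sqrt h)) ^ (n + 1)"
        using pos by (intro power_mono) auto
      also have "\<dots> = 2 ^ (n + 1) * (1 + norm (z - z') / sqrt h) ^ (n + 1)" by (rule power_mult_distrib)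
      finally have "1 / (1 + norm (z - z') / sqrt h) ^ (n + 1) \<le> 2 ^ (n + 1) * (1 / (1 + norm (z - z1) / sqrt h) ^ (n + 1))"
        using zero_less_power[OF pos(1), of "n + 1"] zero_less_power[OF pos(2), of "n + 1"]
        by (simp only: times_divide_eq_right mult_1_right pos_divide_le_eq pos_le_divide_eq times_divide_eq_left mult_1_left)
      then have "ennreal (1 / (1 + norm (z - z') / sqrt h) ^ (n + 1)) \<le> ennreal (2 ^ (n + 1) * (1 / (1 + norm (z - z1) / sqrt h) ^ (n + 1)))"
        by (rule ennreal_leI)
      also have "\<dots> = ennreal (2 ^ (n + 1)) * ennreal (1 / (1 + norm (z - z1) / sqrt h) ^ (n + 1))"
        using pos by (intro ennreal_mult) auto
      finally show "indicator A z * ennreal (1 / (1 + norm (z - z') / sqrt h) ^ (n + 1)) \<le>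
         ennreal (2 ^ (n + 1)) * (indicator A z * ennreal (1 / (1 + norm (z - z1) / sqrt h) ^ (n + 1)))"
        by (cases "z \<in> A") auto
    qed
    also have "\<dots> = ennreal (2 ^ (n + 1)) * (\<integral>\<^sup>+z. indicator A z * ennreal (1 / (1 + norm (z - z1) / sqrt h) ^ (n + 1)) \<partial>lborel)"
      by (rule nn_integral_cmult) measurable
    also have "(\<integral>\<^sup>+z. indicator A z * ennreal (1 / (1 + norm (z - z1) / sqrt h) ^ (n + 1)) \<partial>lborel) \<le>
       ennreal (sqrt h ^ DIM('a \<times> 'a) * 2 ^ (n + 2) * \<delta> * I)"
      unfolding n_def I_def by (rule dilation_average[OF A _ _ rays[OF z1(2)]]) (use h \<delta> in auto)
    finally have "(\<integral>\<^sup>+z. indicator A z * ennreal (1 / (1 + norm (z - z') / sqrt h) ^ (n + 1)) \<partial>lborel) \<le>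
       ennreal (2 ^ (n + 1)) * ennreal (sqrt h ^ DIM('a \<times> 'a) * 2 ^ (n + 2) * \<delta> * I)"
      by (simp only: mult_left_mono zero_le)
    also have "\<dots> = ennreal (2 ^ (n + 1) * (sqrt h ^ DIM('a \<times> 'a) * 2 ^ (n + 2) * \<delta> * I))"
      using h \<delta> I0 by (intro ennreal_mult[symmetric]) auto
    also have "2 ^ (n + 1) * (sqrt h ^ DIM('a \<times> 'a) * 2 ^ (n + 2) * \<delta> * I) = sqrt h ^ DIM('a \<times> 'a) * (2 ^ ((n + 1) + (n + 2)) * \<delta> * I)"
      by (simp only: power_add mult_ac)
    \<comment> \<open>\<open>n + 1\<close> stems from moving the centre, \<open>n + 2\<close> from
      \<open>dilation_average\<close>.\<close>
    also have "(n + 1) + (n + 2) = 4 * DIM('a \<times> 'a) + 3" by (simp only: n_def)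
    finally show ?thesis .
  qed
  show ?thesis
  proof (rule le_inf_spectrum)
    fix f :: "'a \<Rightarrow> complex" assume f: "f \<in> L2" "l2_norm f = 1"
    have [measurable]: "V f \<in> borel_measurable borel"
      by (rule transform_measurable[OF phi phi1 h L2_measurable[OF f(1)]])
    define P where "P = ennreal \<kappa> * (\<integral>\<^sup>+z. indicator A z * ennreal ((norm (V f z))\<^sup>2) \<partial>lborel)"
    define Q where "Q = ennreal \<kappa> * (\<integral>\<^sup>+z. indicator (- A) z * ennreal ((norm (V f z))\<^sup>2) \<partial>lborel)"
    have "P \<le> ennreal (C\<^sup>2 * (1 / (2 * pi) ^ DIM('a))\<^sup>2 * I * (2 ^ (4 * DIM('a \<times> 'a) + 3) * \<delta> * I))"
      unfolding P_def I_def
      by (rule transform_mass_bound[OF C A _ mass[unfolded n_def I_def] f]) (use \<delta> I0 in \<open>auto simp: I_def\<close>)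
    also have "\<dots> \<le> ennreal (1 / 2)"
      unfolding I_def by (rule ennreal_leI[OF \<delta>_small])
    finally have P: "P \<le> ennreal (1 / 2)" .
    have "P + Q = ennreal \<kappa> * (\<integral>\<^sup>+z. indicator A z * ennreal ((norm (V f z))\<^sup>2) + indicator (- A) z * ennreal ((norm (V f z))\<^sup>2) \<partial>lborel)"
      unfolding P_def Q_def distrib_left[symmetric] by (subst nn_integral_add[symmetric]) auto
    also have "(\<integral>\<^sup>+z. indicator A z * ennreal ((norm (V f z))\<^sup>2) + indicator (- A) z * ennreal ((norm (V f z))\<^sup>2) \<partial>lborel) =
       (\<integral>\<^sup>+z. ennreal ((norm (V f z))\<^sup>2) \<partial>lborel)"
      by (intro nn_integral_cong) (auto simp: indicator_def)
    also have "ennreal \<kappa> * \<dots> = 1" using kappa_transform[OF f(1)] f(2) by simp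
    finally have PQ: "P + Q = 1" .
    have Q: "ennreal (1 / 2) \<le> Q"
    proof (rule ccontr)
      assume "\<not> ennreal (1 / 2) \<le> Q"
      then have "Q < ennreal (1 / 2)" by simp
      then obtain r where r0: "Q = ennreal r" "0 \<le> r" by (cases Q) auto
      with \<open>Q < ennreal (1 / 2)\<close> have r: "Q = ennreal r" "0 \<le> r" "r < 1 / 2"
        by (auto simp only: ennreal_less_iff)
      have "P + Q \<le> ennreal (1 / 2) + ennreal r" using P r(1) by (intro add_mono) auto
      also have "\<dots> = ennreal (1 / 2 + r)" using r(2) by (intro ennreal_plus[symmetric]) auto
      finally have "ennreal 1 \<le> ennreal (1 / 2 + r)" by (simp only: PQ ennreal_1)
      then show False using r by (subst (asm) ennreal_le_iff) auto
    qed
    have e0: "0 \<le> \<mu> / (4 * \<Gamma>)" using \<mu> \<Gamma>0 by simp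
    have "ennreal (lambda' a h / (8 * \<Gamma>)) = ennreal ((\<mu> / (4 * \<Gamma>)) * (1 / 2))" by (simp add: \<mu>_def)
    also have "\<dots> = ennreal (\<mu> / (4 * \<Gamma>)) * ennreal (1 / 2)" using e0 by (intro ennreal_mult) auto
    also have "\<dots> \<le> ennreal (\<mu> / (4 * \<Gamma>)) * Q" using Q by (rule mult_left_mono) simp
    also have "\<dots> = ennreal \<kappa> * (ennreal (\<mu> / (4 * \<Gamma>)) * (\<integral>\<^sup>+z. indicator (- A) z * ennreal ((norm (V f z))\<^sup>2) \<partial>lborel))"
      unfolding Q_def by (simp only: mult_ac)
    also have "ennreal (\<mu> / (4 * \<Gamma>)) * (\<integral>\<^sup>+z. indicator (- A) z * ennreal ((norm (V f z))\<^sup>2) \<partial>lborel) =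
       (\<integral>\<^sup>+z. ennreal (\<mu> / (4 * \<Gamma>)) * (indicator (- A) z * ennreal ((norm (V f z))\<^sup>2)) \<partial>lborel)"
      by (rule nn_integral_cmult[symmetric]) measurable
    also have "ennreal \<kappa> * \<dots> \<le> ennreal \<kappa> * (\<integral>\<^sup>+z. ennreal (a z h * (norm (V f z))\<^sup>2) \<partial>lborel)"
    proof (intro mult_left_mono nn_integral_mono)
      fix z
      show "ennreal (\<mu> / (4 * \<Gamma>)) * (indicator (- A) z * ennreal ((norm (V f z))\<^sup>2)) \<le> ennreal (a z h * (norm (V f z))\<^sup>2)"
      proof (cases "z \<in> A")
        case False
        then have "\<mu> / (4 * \<Gamma>) * (norm (V f z))\<^sup>2 \<le> a z h * (norm (V f z))\<^sup>2"
          by (intro mult_right_mono) (auto simp: A_def)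
        then show ?thesis using False e0 by (simp add: ennreal_leI flip: ennreal_mult)
      qed simp
    qed simp
    also have "\<dots> = antiwick_quad \<phi> a h f" by (simp add: antiwick_quad_def \<kappa>_def)
    finally show "ennreal (lambda' a h / (8 * \<Gamma>)) \<le> antiwick_quad \<phi> a h f" .
  qed
qed

end

text \<open>Writing \<open>z\<close> as \<open>sqrt h\<close> times
  \<open>z /\<^sub>R sqrt h\<close> in the growth estimate about 0 gives polynomial growth, with
  \<open>sqrt h ^ K\<close> in the denominator of the constant; the locale tolerates this.\<close>

lemma antiwick_intro:
  fixes a :: "'a::euclidean_space \<times> 'a \<Rightarrow> real \<Rightarrow> real"
  assumes phi: "\<phi> \<in> schwartz" "l2_norm \<phi> = 1" and h: "0 < h" "h \<le> 1"
    and cont: "continuous_on UNIV (\<lambda>z. a z h)" and nonneg: "\<And>z. 0 \<le> a z h" and E: "0 \<le> E"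
    and poly: "\<And>z w. \<exists>p. degree p < K \<and>
      (\<forall>t\<ge>0. \<bar>a (z + (t * sqrt h) *\<^sub>R w) h - poly p t\<bar> \<le> (E * norm w ^ K * h ^ N) * t ^ K)"
  obtains Ca where "antiwick \<phi> a h Ca K"
proof -
  obtain S where "\<forall>x\<in>(\<lambda>z. a z h) ` ball 0 (sqrt h). x \<le> S"
    using continuous_bdd_above_ball[OF cont, of 0 "sqrt h"] unfolding bdd_above_def by blast
  then have S: "a z h \<le> S" if "z \<in> ball 0 (sqrt h)" for z using that by blast
  have S0: "0 \<le> S" using order_trans[OF nonneg S[of 0]] h by simp
  define L where "L = (real K * real K ^ K + 1) * (S + E * h ^ N)"
  have L0: "0 \<le> L" using S0 E h by (simp add: L_def)
  have "a z h \<le> L / sqrt h ^ K * (1 + norm z) ^ K" for z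
  proof -
    have "\<bar>a (0 + sqrt h *\<^sub>R (z /\<^sub>R sqrt h)) h\<bar> \<le> (real K * real K ^ K + 1) * (S + E * h ^ N) * (1 + norm (z /\<^sub>R sqrt h)) ^ K"
      by (rule symbol_growth[where a=a and h=h and N=N, OF poly h(1)]) (use S nonneg in auto)
    then have "a z h \<le> L * (1 + norm z / sqrt h) ^ K"
      using h by (simp add: L_def divide_inverse_commute)
    also have "\<dots> \<le> L * ((1 + norm z) / sqrt h) ^ K"
    proof (intro mult_left_mono power_mono L0)
      have "sqrt h \<le> 1" using h by simp
      then have "1 \<le> 1 / sqrt h" using h by simp
      then show "1 + norm z / sqrt h \<le> (1 + norm z) / sqrt h" by (simp add: add_divide_distrib)
    qed (use h in simp)
    also have "\<dots> = L / sqrt h ^ K * (1 + norm z) ^ K" by (simp add: power_divide)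
    finally show ?thesis .
  qed
  then have "antiwick \<phi> a h (L / sqrt h ^ K) K"
    using phi h nonneg borel_measurable_continuous_onI[OF cont] by unfold_locales auto
  then show ?thesis by (rule that)
qed

text \<open>All constants are fixed before \<open>h\<close>. Those of the lower bound come in the
  order \<open>Kc\<close> from the Schur test, \<open>\<delta>\<close> from \<open>Kc\<close>,
  \<open>\<Gamma>\<close> from \<open>\<delta>\<close> and \<open>K1\<close> from
  \<open>\<Gamma>\<close>.\<close>

lemma bottom_of_antiwick_spectrum:
  fixes \<phi> :: "'a::euclidean_space \<Rightarrow> complex" and a :: "'a \<times> 'a \<Rightarrow> real \<Rightarrow> real" and N :: nat
  assumes phi: "\<phi> \<in> schwartz" "l2_norm \<phi> = 1" and \<rho>: "\<rho> < 1 / 2"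
    and a: "a \<in> symbol_class m \<rho>" and nonneg: "\<forall>h\<in>{0<..1}. \<forall>z. 0 \<le> a z h"
  shows "\<exists>C>0. \<forall>h\<in>{0<..1}. lambda' a h / C - C * h ^ N \<le> inf_spectrum (antiwick_op \<phi> a h) \<and>
           inf_spectrum (antiwick_op \<phi> a h) \<le> C * (lambda' a h + h ^ N)"
proof -
  define I where "I = peak_mass TYPE('a \<times> 'a)"
  have I0: "0 \<le> I" by (simp add: I_def peak_mass_nonneg)
  obtain K :: nat and E :: real where K: "0 < K" and E: "0 \<le> E"
    and poly: "\<And>h z w. h \<in> {0<..1} \<Longrightarrow> \<exists>p. degree p < K \<and>
      (\<forall>t\<ge>0. \<bar>a (z + (t * sqrt h) *\<^sub>R w) h - poly p t\<bar> \<le> (E * norm w ^ K * h ^ N) * t ^ K)"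
    using symbol_almost_polynomial[OF a \<rho>, of N] by metis
  obtain C1 where C1: "0 \<le> C1" "\<And>u w. norm (ambiguity \<phi> \<phi> u w) \<le> C1 / (1 + norm (u, w)) ^ (2 * DIM('a \<times> 'a) + K)"
    using ambiguity_decay[OF phi(1) phi(1)] by metis
  obtain C2 where C2: "0 \<le> C2" "\<And>u w. norm (ambiguity \<phi> \<phi> u w) \<le> C2 / (1 + norm (u, w)) ^ (2 * DIM('a \<times> 'a) + 1)"
    using ambiguity_decay[OF phi(1) phi(1)] by metis
  define Kc where "Kc = C2\<^sup>2 * (1 / (2 * pi) ^ DIM('a))\<^sup>2 * I * (2 ^ (4 * DIM('a \<times> 'a) + 3) * I)"
  have Kc: "0 \<le> Kc" using I0 by (simp add: Kc_def)
  \<comment> \<open>Half of the mass is allowed in the sublevel set, which asks for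
    \<open>Kc * \<delta> \<le> 1/2\<close>; the summand 1 covers \<open>Kc = 0\<close> and keeps
    \<open>\<delta> \<le> 1\<close>.\<close>
  define \<delta> where "\<delta> = 1 / (2 * (Kc + 1))"
  have \<delta>: "0 < \<delta>" "\<delta> \<le> 1" using Kc by (auto simp: \<delta>_def)
  have "Kc * \<delta> \<le> 1 / 2" using Kc by (simp add: \<delta>_def divide_simps)
  then have \<delta>_small: "C2\<^sup>2 * (1 / (2 * pi) ^ DIM('a))\<^sup>2 * I * (2 ^ (4 * DIM('a \<times> 'a) + 3) * \<delta> * I) \<le> 1 / 2"
    by (simp only: Kc_def mult_ac)
  define \<Gamma> where "\<Gamma> = real K * (2 * real K / \<delta>) ^ K"
  have \<Gamma>: "0 < \<Gamma>" using K \<delta> by (simp add: \<Gamma>_def)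
  \<comment> \<open>Above \<open>K1 * h ^ N\<close>, \<open>lambda'\<close> dominates the polynomial
    remainder as \<open>inf_spectrum_lower\<close> demands.\<close>
  define K1 where "K1 = 4 * (\<Gamma> * E * (1 / \<delta>) ^ K)"
  have K1: "0 \<le> K1" using \<Gamma> E \<delta> by (simp add: K1_def)
  define Cu where "Cu = (real K * real K ^ K + 1) * C1\<^sup>2 * I / (2 * pi) ^ DIM('a)"
  have Cu: "0 \<le> Cu" using I0 by (simp add: Cu_def)
  define C where "C = 1 + K1 + 8 * \<Gamma> + Cu + Cu * E"
  have CuE: "0 \<le> Cu * E" using Cu E by simp
  have C: "1 \<le> C" "K1 \<le> C" "8 * \<Gamma> \<le> C" "Cu \<le> C" "Cu * E \<le> C"
    using K1 \<Gamma> Cu CuE by (auto simp: C_def)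
  have "lambda' a h / C - C * h ^ N \<le> inf_spectrum (antiwick_op \<phi> a h) \<and>
           inf_spectrum (antiwick_op \<phi> a h) \<le> C * (lambda' a h + h ^ N)" if hI: "h \<in> {0<..1}" for h
  proof -
    have h01: "0 < h" "h \<le> 1" using hI by auto
    have cont: "continuous_on UNIV (\<lambda>z. a z h)"
      using a hI unfolding symbol_class_def by (intro smooth_continuous) blast
    have pos: "0 \<le> a z h" for z using nonneg hI by blast
    obtain Ca where "antiwick \<phi> a h Ca K"
      using antiwick_intro[where a=a and h=h and N=N, OF phi h01 cont pos E poly[OF hI]] by metis
    then interpret antiwick \<phi> a h Ca K .
    have hN: "0 \<le> h ^ N" using h01 by simp
    have S0: "0 \<le> (SUP z\<in>ball z0 (sqrt h). a z h)" for z0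
      using order_trans[OF pos cSUP_upper[OF _ continuous_bdd_above_ball[OF cont], of z0 z0]] h01 by simp
    have lam0: "0 \<le> lambda' a h" unfolding lambda'_def by (intro cINF_greatest S0) simp
    have inf0: "0 \<le> inf_spectrum (antiwick_op \<phi> a h)" by (rule le_inf_spectrum) simp
    have up: "inf_spectrum (antiwick_op \<phi> a h) \<le> Cu * ((SUP z\<in>ball z0 (sqrt h). a z h) + E * h ^ N)" for z0
      unfolding Cu_def I_def by (rule inf_spectrum_upper[where N=N, OF cont E poly[OF hI] C1])
    have "inf_spectrum (antiwick_op \<phi> a h) \<le> Cu * (lambda' a h + E * h ^ N)"
    \<comment> \<open>To take the infimum over \<open>z0\<close> on one side, the estimate is
      divided by \<open>Cu\<close>.\<close>
    proof (cases "Cu = 0")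
      case True
      then show ?thesis using up[of 0] by simp
    next
      case False
      then have Cu0: "0 < Cu" using Cu by simp
      have "inf_spectrum (antiwick_op \<phi> a h) / Cu - E * h ^ N \<le> lambda' a h"
        unfolding lambda'_def
      proof (rule cINF_greatest)
        show "inf_spectrum (antiwick_op \<phi> a h) / Cu - E * h ^ N \<le> (SUP z\<in>ball z0 (sqrt h). a z h)" for z0
          using up[of z0] Cu0 by (simp add: pos_divide_le_eq mult.commute diff_le_eq)
      qed simp
      then show ?thesis using Cu0 by (simp add: pos_divide_le_eq mult.commute diff_le_eq)
    qed
    also have "\<dots> = Cu * lambda' a h + (Cu * E) * h ^ N" by (simp add: distrib_left)
    also have "\<dots> \<le> C * lambda' a h + C * h ^ N"
      using C lam0 hN by (intro add_mono mult_right_mono) auto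
    finally have upper: "inf_spectrum (antiwick_op \<phi> a h) \<le> C * (lambda' a h + h ^ N)" by (simp add: distrib_left)
    have lower: "lambda' a h / C - C * h ^ N \<le> inf_spectrum (antiwick_op \<phi> a h)"
    proof (cases "K1 * h ^ N < lambda' a h")
      case True
      have "lambda' a h / (8 * \<Gamma>) \<le> inf_spectrum (antiwick_op \<phi> a h)"
      proof (rule inf_spectrum_lower[where N=N, OF cont E K poly[OF hI] C2 \<delta> _ \<Gamma>_def])
        show "\<Gamma> * E * (1 / \<delta>) ^ K * h ^ N < lambda' a h / 4" using True by (simp add: K1_def)
      qed (use \<delta>_small in \<open>simp only: I_def\<close>)
      moreover have "lambda' a h / C \<le> lambda' a h / (8 * \<Gamma>)"
        using lam0 C \<Gamma> by (intro divide_left_mono) auto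
      moreover have "0 \<le> C * h ^ N" using C hN by simp
      ultimately show ?thesis by linarith
    next
      \<comment> \<open>Here \<open>lambda'\<close> is at most \<open>C * (C * h ^ N)\<close>, so
        the left side is at most 0, while the infimum of the spectrum is nonnegative.\<close>
      case False
      then have "lambda' a h \<le> K1 * h ^ N" by simp
      also have "\<dots> \<le> C * h ^ N" using C hN by (intro mult_right_mono) auto
      also have "\<dots> \<le> C * (C * h ^ N)" using C hN by (intro mult_right_mono[of 1 C, simplified]) auto
      finally have "lambda' a h / C \<le> C * h ^ N" using C by (simp add: pos_divide_le_eq mult.commute)
      then show ?thesis using inf0 by linarith
    qed
    show ?thesis using lower upper by blast
  qed
  then show ?thesis using C(1) by (intro exI[of _ C]) auto
qed

theorem theorem6p2:
  fixes \<phi> :: "real ^ 'n::finite \<Rightarrow> complex"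
    and a :: "(real ^ 'n) \<times> (real ^ 'n) \<Rightarrow> real \<Rightarrow> real"
    and m \<rho> :: real
  assumes "\<phi> \<in> schwartz"
    and "l2_norm \<phi> = 1"
    and "0 \<le> \<rho>" and "\<rho> < 1 / 2"
    and "a \<in> symbol_class m \<rho>"
    and "\<forall>h\<in>{0<..1}. \<forall>z. 0 \<le> a z h"
  shows "\<forall>N::nat. \<exists>C>0. \<forall>h\<in>{0<..1}.
           lambda' a h / C - C * h ^ N \<le> inf_spectrum (antiwick_op \<phi> a h) \<and>
           inf_spectrum (antiwick_op \<phi> a h) \<le> C * (lambda' a h + h ^ N)"
  using bottom_of_antiwick_spectrum[OF assms(1,2,4,5,6)] by (rule allI)

end
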